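(* Let $y=\det_n(X)$ and write $\overline{O(y)}-O(y)=\cup_iW_i$ as a finite union of closed $G$-varieties $W_i$ of dimension one less than that of $\overline{O(y)}$. If $W_i=\overline{O(Q_i)}$ for some form $Q_i\in V$ which is obtained as the limit (leading term) of a one-parameter subgroup $\lambda_i\subseteq G$ acting on $\det_n(X)$, then either the stabilizer $\mathcal H_i$ of $Q_i$ in $gl_{n^2}$ is of rank $1$, or there is an alignment between $Q_i$ and $\det_n$ (or a conjugate of it).
   Context: $X=(X_{ij})$ is an $n\times n$ matrix of indeterminates, $G=GL_{n^2}(\mathbb C)$ acts on the space of $n\times n$ matrices and hence on $V=Sym^n(X^* )$, the space of forms of degree $n$ in the $n^2$ variables. $O(v)$ denotes the $G$-orbit of $v$ and $\overline{O(v)}$ its closure. It is known that the boundary $\overline{O(\det_n)}-O(\det_n)$ is a finite union of closed $G$-varieties of codimension $1$ in $\overline{O(\det_n)}$. For a one-parameter subgroup $\lambda$ of $G$ and $v\ne0$ in $V$ with $\lambda(t)v=\sum_{i\geq d}t^iv_i$, $v_d\neq0$, the leading term (limit) of $v$ under $\lambda$ is $v_d$. Stabilizers are Lie algebra stabilizers: $\mathcal H_i=\{\mathfrak g\in gl_{n^2}\mid\mathfrak gQ_i=0\}$ and $\mathcal K_n=\{\mathfrak g\in gl_{n^2}\mid\mathfrak g\det_n=0\}$. The rank of a Lie algebra is the dimension of a maximal torus (abelian subalgebra consisting of semisimple elements). An alignment between $Q_i$ and a conjugate of $\det_n$ is a nonzero semisimple element of $\mathcal H_i\cap g\mathcal K_ng^{-1}$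 for some $g\in G$. *)

theory Defs
  imports "HOL-Analysis.Analysis" "HOL-Computational_Algebra.Polynomial"
begin

text \<open>
  Since the field of complex numbers is infinite, a form in the coordinates of \<open>\<complex>\<^sup>m\<close> is identified
  with the function on \<open>complex ^ 'm\<close> that it defines.
\<close>

definition forms :: "nat \<Rightarrow> (complex ^ 'm \<Rightarrow> complex) set" where
  "forms d = {f. \<exists>c. f = (\<lambda>x. \<Sum>\<alpha> | (\<Sum>i\<in>UNIV. \<alpha> i) = d. c \<alpha> * (\<Prod>i\<in>UNIV. x $ i ^ \<alpha> i))}"

text \<open>The coordinates of the space of square matrices are indexed by pairs (row, column).\<close>

definition det_form :: "complex ^ ('n::finite \<times> 'n) \<Rightarrow> complex" where
  "det_form x = det (\<chi> i j. x $ (i, j))"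

definition group_act :: "complex ^ 'm ^ 'm \<Rightarrow> (complex ^ 'm \<Rightarrow> complex) \<Rightarrow> (complex ^ 'm \<Rightarrow> complex)"
  where "group_act g f = (\<lambda>x. f (matrix_inv g *v x))"

definition orbit :: "(complex ^ 'm \<Rightarrow> complex) \<Rightarrow> (complex ^ 'm \<Rightarrow> complex) set" where
  "orbit f = {group_act g f | g. invertible g}"


subsection \<open>Closed subvarieties of a space of forms\<close>

text \<open>
  The coordinate ring of a finite-dimensional complex vector space \<open>V\<close> of functions is generated
  by the linear functionals on \<open>V\<close>. Only the values of these functions on \<open>V\<close> are relevant.
\<close>

inductive_set regular_functions :: "('a \<Rightarrow> complex) set \<Rightarrow> (('a \<Rightarrow> complex) \<Rightarrow> complex) set"
  for V :: "('a \<Rightarrow> complex) set" where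
  const: "(\<lambda>_. c) \<in> regular_functions V"
| linear: "\<lbrakk>\<And>u v. u \<in> V \<Longrightarrow> v \<in> V \<Longrightarrow> \<phi> (\<lambda>x. u x + v x) = \<phi> u + \<phi> v;
            \<And>c u. u \<in> V \<Longrightarrow> \<phi> (\<lambda>x. c * u x) = c * \<phi> u\<rbrakk> \<Longrightarrow> \<phi> \<in> regular_functions V"
| add: "\<lbrakk>F \<in> regular_functions V; F' \<in> regular_functions V\<rbrakk>
          \<Longrightarrow> (\<lambda>v. F v + F' v) \<in> regular_functions V"
| mult: "\<lbrakk>F \<in> regular_functions V; F' \<in> regular_functions V\<rbrakk>
          \<Longrightarrow> (\<lambda>v. F v * F' v) \<in> regular_functions V"

definition zariski_closed :: "('a \<Rightarrow> complex) set \<Rightarrow> ('a \<Rightarrow> complex) set \<Rightarrow> bool" where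
  "zariski_closed V Z \<longleftrightarrow> (\<exists>S \<subseteq> regular_functions V. Z = {v \<in> V. \<forall>F\<in>S. F v = 0})"

definition zariski_closure :: "('a \<Rightarrow> complex) set \<Rightarrow> ('a \<Rightarrow> complex) set \<Rightarrow> ('a \<Rightarrow> complex) set" where
  "zariski_closure V A = zariski_closed V hull A"

definition closed_G_variety ::
  "(complex ^ 'm \<Rightarrow> complex) set \<Rightarrow> (complex ^ 'm \<Rightarrow> complex) set \<Rightarrow> bool" where
  "closed_G_variety V Z \<longleftrightarrow>
     zariski_closed V Z \<and> (\<forall>g f. invertible g \<longrightarrow> f \<in> Z \<longrightarrow> group_act g f \<in> Z)"

text \<open>Algebraic independence over the complex numbers of the restrictions of
  \<open>f 0, \<dots>, f (d - 1)\<close> to \<open>Z\<close>.\<close>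

definition alg_independent_on :: "'b set \<Rightarrow> nat \<Rightarrow> (nat \<Rightarrow> 'b \<Rightarrow> complex) \<Rightarrow> bool" where
  "alg_independent_on Z d f \<longleftrightarrow>
     (\<forall>M c. finite M \<and> M \<subseteq> {\<alpha>. \<forall>k\<ge>d. \<alpha> k = (0::nat)} \<and>
            (\<forall>z\<in>Z. (\<Sum>\<alpha>\<in>M. c \<alpha> * (\<Prod>k<d. f k z ^ \<alpha> k)) = 0)
            \<longrightarrow> (\<forall>\<alpha>\<in>M. c \<alpha> = 0))"

text \<open>
  The dimension of a nonempty closed subvariety \<open>Z\<close> is the transcendence degree of its coordinate
  ring. For irreducible \<open>Z\<close> this is the transcendence degree of the function field of \<open>Z\<close>; in general
  it is the maximum of these over the irreducible components, because multiplying relations that hold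
  on the individual components gives a relation that holds on \<open>Z\<close>.
\<close>

definition variety_dim :: "('a \<Rightarrow> complex) set \<Rightarrow> ('a \<Rightarrow> complex) set \<Rightarrow> nat" where
  "variety_dim V Z =
     Max {d. \<exists>f. (\<forall>k<d. f k \<in> regular_functions V) \<and> alg_independent_on Z d f}"


subsection \<open>One-parameter subgroups and leading terms\<close>

text \<open>Homomorphisms of algebraic groups from the multiplicative group of \<open>\<complex>\<close> to the general linear
  group; regular functions on the former are Laurent polynomials. The value at 0 is irrelevant.\<close>

definition one_parameter_subgroup :: "(complex \<Rightarrow> complex ^ 'm ^ 'm) \<Rightarrow> bool" where
  "one_parameter_subgroup L \<longleftrightarrow>
     (\<forall>t. t \<noteq> 0 \<longrightarrow> invertible (L t)) \<and>
     (\<forall>s t. s \<noteq> 0 \<longrightarrow> t \<noteq> 0 \<longrightarrow> L (s * t) = L s ** L t) \<and>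
     (\<forall>i j. \<exists>p k. \<forall>t. t \<noteq> 0 \<longrightarrow> L t $ i $ j = poly p t / t ^ k)"

definition leading_term ::
  "(complex \<Rightarrow> complex ^ 'm ^ 'm) \<Rightarrow> (complex ^ 'm \<Rightarrow> complex) \<Rightarrow> (complex ^ 'm \<Rightarrow> complex) \<Rightarrow> bool" where
  "leading_term L f w \<longleftrightarrow>
     (\<exists>(d::int) e c. d \<le> e \<and> c d = w \<and> w \<noteq> (\<lambda>_. 0) \<and>
        (\<forall>t. t \<noteq> 0 \<longrightarrow> group_act (L t) f = (\<lambda>x. \<Sum>i=d..e. t powi i * c i x)))"


subsection \<open>Lie algebra stabilizers, rank and alignment\<close>

definition mscale :: "'a::field \<Rightarrow> 'a ^ 'k ^ 'm \<Rightarrow> 'a ^ 'k ^ 'm" where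
  "mscale c A = (\<chi> i j. c * A $ i $ j)"

global_interpretation matrix_space: vector_space "mscale :: 'a::field \<Rightarrow> 'a ^ 'k ^ 'm \<Rightarrow> 'a ^ 'k ^ 'm"
  by unfold_locales (simp_all add: mscale_def vec_eq_iff algebra_simps)

text \<open>The differential at the identity, in the direction \<open>A\<close>, of \<open>g \<mapsto> group_act g f\<close>; explicitly,
  its value at \<open>x\<close> is \<open>- (\<Sum>i. (A *v x) $ i * (\<partial>f/\<partial>x\<^sub>i) x)\<close>.\<close>

definition lie_act :: "complex ^ 'm ^ 'm \<Rightarrow> (complex ^ 'm \<Rightarrow> complex) \<Rightarrow> (complex ^ 'm \<Rightarrow> complex)" where
  "lie_act A f = (\<lambda>x. deriv (\<lambda>t. group_act (mat 1 + mscale t A) f x) 0)"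

definition lie_stabilizer :: "(complex ^ 'm \<Rightarrow> complex) \<Rightarrow> (complex ^ 'm ^ 'm) set" where
  "lie_stabilizer f = {A. lie_act A f = (\<lambda>_. 0)}"

definition semisimple_matrix :: "complex ^ 'm ^ 'm \<Rightarrow> bool" where
  "semisimple_matrix A \<longleftrightarrow>
     (\<exists>P D :: complex ^ 'm ^ 'm.
        invertible P \<and> (\<forall>i j. i \<noteq> j \<longrightarrow> D $ i $ j = 0) \<and> A = P ** D ** matrix_inv P)"

definition lie_torus :: "(complex ^ 'm ^ 'm) set \<Rightarrow> bool" where
  "lie_torus T \<longleftrightarrow> matrix_space.subspace T \<and> (\<forall>A\<in>T. \<forall>B\<in>T. A ** B = B ** A) \<and>
     (\<forall>A\<in>T. semisimple_matrix A)"

definition lie_rank :: "(complex ^ 'm ^ 'm) set \<Rightarrow> nat" where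
  "lie_rank H = Max {matrix_space.dim T | T. T \<subseteq> H \<and> lie_torus T}"

definition is_alignment ::
  "complex ^ 'm ^ 'm \<Rightarrow> (complex ^ 'm \<Rightarrow> complex) \<Rightarrow> (complex ^ 'm \<Rightarrow> complex) \<Rightarrow> bool" where
  "is_alignment A f h \<longleftrightarrow> A \<noteq> 0 \<and> semisimple_matrix A \<and>
     (\<exists>g. invertible g \<and>
        A \<in> lie_stabilizer f \<inter> (\<lambda>B. g ** B ** matrix_inv g) ` lie_stabilizer h)"

end

theory Submission
  imports Defs "HOL-Library.Function_Algebras" "HOL-Computational_Algebra.Fundamental_Theorem_Algebra"
begin

text \<open>Write \<open>f = det_form\<close>, let \<open>K\<close> and \<open>H\<close> be the Lie algebra stabilizers of \<open>f\<close> and of its limit \<open>Q\<close>, and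
  let \<open>n\<close> be the degree.

  The hypothesis on codimension enters only as \<open>dim H \<le> dim K + 1\<close>. It becomes this inequality through
  \<open>variety_dim_orbit_closure\<close>: the dimension of the orbit closure of a form and the dimension of its
  Lie algebra stabilizer add up to the dimension of the matrix algebra. Since \<open>Q\<close> lies in
  its own orbit closure, which is part of the boundary, \<open>Q\<close> is not in the orbit of \<open>f\<close>.

  In a basis that diagonalizes the one-parameter subgroup, the limit becomes the part of \<open>f\<close> of lowest
  weight \<open>a\<close> for integral weights \<open>w\<close> on the variables. The matrix \<open>diag \<omega>\<close> with \<open>\<omega> i = w i - a / n\<close>
  stabilizes \<open>Q\<close>. It is not zero, since otherwise \<open>f\<close> would have only one weight and \<open>Q = f\<close>. Hence \<open>H\<close>
  has rank at least 1, and if the rank is not 1 then \<open>H\<close> contains a torus of dimension at least 2.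

  This torus need not contain \<open>diag \<omega>\<close>. Instead of the conjugacy of maximal tori, the proof uses
  traces of powers (\<open>semisimple_not_multiple_of_grading\<close>). Suppose that every semisimple element of \<open>H\<close>
  that commutes with \<open>diag \<omega>\<close> is a multiple of it. Then each element of the centralizer of \<open>diag \<omega>\<close> in
  \<open>H\<close> has the eigenvalues of a multiple of \<open>diag \<omega>\<close>, so certain invariant polynomials in the traces of
  powers vanish on the centralizer. Being invariant, they vanish on all of \<open>H\<close>. On a two-dimensional
  torus the quadratic form \<open>trace (X ** X)\<close> has a nontrivial zero, and there the polynomials force all
  traces of powers to vanish, which is impossible for a nonzero semisimple matrix.

  So \<open>H\<close> contains a two-dimensional space \<open>T\<close> of commuting diagonalizable matrices with
  \<open>diag \<omega> \<in> T\<close>. The leading parts of the elements of \<open>K\<close>, for the grading of matrices by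
  \<open>w\<close>, span a subspace of \<open>H\<close> of dimension at least \<open>dim K\<close>. For dimension reasons it meets \<open>T\<close>
  in a nonzero \<open>t\<close>. As \<open>t\<close> has degree 0, it is the leading part of some \<open>k = t + n\<close> in \<open>K\<close>, where \<open>n\<close>
  is nilpotent of positive degree. The semisimple part of \<open>k\<close> again lies in \<open>K\<close>, and it is conjugate
  to \<open>t\<close>: this is the alignment (\<open>alignment_in_coordinates\<close>).\<close>

section \<open>Matrices as a finite-dimensional vector space\<close>

definition unit_matrix :: "'k \<times> 'm \<Rightarrow> 'a::field ^ 'm ^ 'k" where
  "unit_matrix p = (\<chi> i j. if p = (i, j) then 1 else 0)"

lemma unit_matrix_nth [simp]: "unit_matrix p $ i $ j = (if p = (i, j) then 1 else 0)"
  by (simp add: unit_matrix_def)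

lemma mscale_nth [simp]: "mscale c A $ i $ j = c * A $ i $ j"
  by (simp add: mscale_def)

lemma matrix_eq_iff: "A = B \<longleftrightarrow> (\<forall>i j. A $ i $ j = B $ i $ j)"
  by (auto simp: vec_eq_iff)

lemma inj_unit_matrix: "inj (unit_matrix :: 'k::finite \<times> 'm::finite \<Rightarrow> 'a::field ^ 'm ^ 'k)"
proof (rule injI)
  fix p q :: "'k \<times> 'm" assume "unit_matrix p = (unit_matrix q :: 'a ^ 'm ^ 'k)"
  then have "(unit_matrix p :: 'a ^ 'm ^ 'k) $ fst p $ snd p = unit_matrix q $ fst p $ snd p" by simp
  then show "p = q" by (auto split: if_splits)
qed

lemma matrix_as_sum:
  "A = (\<Sum>p\<in>UNIV. mscale (A $ fst p $ snd p) (unit_matrix p))" for A :: "'a::field ^ 'm::finite ^ 'k::finite"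
  by (simp add: matrix_eq_iff sum_component if_distrib [of "\<lambda>x. _ * x"] split_beta
      sum.delta cong: if_cong)

interpretation matrix_space: finite_dimensional_vector_space
  "mscale :: 'a::field \<Rightarrow> 'a ^ 'm::finite ^ 'k::finite \<Rightarrow> 'a ^ 'm ^ 'k" "range unit_matrix"
proof unfold_locales
  show "finite (range (unit_matrix :: _ \<Rightarrow> 'a ^ 'm ^ 'k))" by simp
  show "matrix_space.independent (range (unit_matrix :: _ \<Rightarrow> 'a ^ 'm ^ 'k))"
  proof (rule matrix_space.independent_if_scalars_zero)
    fix f :: "'a ^ 'm ^ 'k \<Rightarrow> 'a" and X :: "'a ^ 'm ^ 'k"
    assume s: "(\<Sum>x\<in>range unit_matrix. mscale (f x) x) = 0" and "X \<in> range unit_matrix"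
    then obtain i j where X: "X = unit_matrix (i, j)" by auto
    have "0 = (\<Sum>p\<in>UNIV. mscale (f (unit_matrix p)) (unit_matrix p :: 'a ^ 'm ^ 'k)) $ i $ j"
      using s by (simp add: sum.reindex inj_unit_matrix o_def)
    also have "\<dots> = f X"
      by (simp add: X sum_component if_distrib [of "\<lambda>x. _ * x"] sum.delta cong: if_cong)
    finally show "f X = 0" by simp
  qed simp
  show "matrix_space.span (range (unit_matrix :: _ \<Rightarrow> 'a ^ 'm ^ 'k)) = UNIV"
  proof (intro set_eqI iffI UNIV_I)
    fix A :: "'a ^ 'm ^ 'k"
    show "A \<in> matrix_space.span (range unit_matrix)"
      by (subst matrix_as_sum)
        (intro matrix_space.span_sum matrix_space.span_scale matrix_space.span_base, auto)
  qed
qed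

section \<open>Polynomial functions on a vector space\<close>

text \<open>Polynomial functions are generated by linear functionals, so no coordinates are needed: the class is
  used for vectors, for matrices and for sequences, each with its own scalar multiplication.\<close>

inductive_set polyfun :: "(complex \<Rightarrow> 'v::ab_group_add \<Rightarrow> 'v) \<Rightarrow> ('v \<Rightarrow> complex) set"
  for scl :: "complex \<Rightarrow> 'v \<Rightarrow> 'v" where
  const: "(\<lambda>_. c) \<in> polyfun scl"
| linear: "\<lbrakk>\<And>x y. \<phi> (x + y) = \<phi> x + \<phi> y; \<And>c x. \<phi> (scl c x) = c * \<phi> x\<rbrakk> \<Longrightarrow> \<phi> \<in> polyfun scl"
| add: "\<lbrakk>P \<in> polyfun scl; P' \<in> polyfun scl\<rbrakk> \<Longrightarrow> (\<lambda>x. P x + P' x) \<in> polyfun scl"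
| mult: "\<lbrakk>P \<in> polyfun scl; P' \<in> polyfun scl\<rbrakk> \<Longrightarrow> (\<lambda>x. P x * P' x) \<in> polyfun scl"

lemma polyfun_cmult: "P \<in> polyfun scl \<Longrightarrow> (\<lambda>x. c * P x) \<in> polyfun scl"
  by (intro polyfun.mult polyfun.const)

lemma polyfun_diff:
  assumes "P \<in> polyfun scl" "P' \<in> polyfun scl" shows "(\<lambda>x. P x - P' x) \<in> polyfun scl"
  using polyfun.add [OF assms(1) polyfun_cmult [OF assms(2), of "-1"]] by simp

lemma polyfun_sum: "(\<And>i. i \<in> I \<Longrightarrow> P i \<in> polyfun scl) \<Longrightarrow> (\<lambda>x. \<Sum>i\<in>I. P i x) \<in> polyfun scl"
  by (induction I rule: infinite_finite_induct) (auto intro: polyfun.const polyfun.add)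

lemma polyfun_prod: "(\<And>i. i \<in> I \<Longrightarrow> P i \<in> polyfun scl) \<Longrightarrow> (\<lambda>x. \<Prod>i\<in>I. P i x) \<in> polyfun scl"
  by (induction I rule: infinite_finite_induct) (auto intro: polyfun.const polyfun.mult)

lemma polyfun_power: "P \<in> polyfun scl \<Longrightarrow> (\<lambda>x. P x ^ k) \<in> polyfun scl"
  by (induction k) (auto intro: polyfun.const polyfun.mult)

text \<open>Along the lines through \<open>a\<close> a polynomial function is a polynomial in the parameter. Its coefficients
  are again polynomial functions of the direction and play the role of the homogeneous parts of \<open>P\<close> at
  \<open>a\<close>.\<close>

lemma polyfun_expansion:
  assumes "P \<in> polyfun scl"
  shows "\<exists>p d. (\<forall>x t. P (a + scl t x) = poly (p x) t) \<and> (\<forall>l. (\<lambda>x. coeff (p x) l) \<in> polyfun scl)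
     \<and> (\<forall>x. degree (p x) \<le> d)"
  using assms
proof induction
  case (const c)
  have "(\<lambda>x. coeff [:c:] l) \<in> polyfun scl" for l by (rule polyfun.const)
  then show ?case by (intro exI [of _ "\<lambda>_. [:c:]"] exI [of _ 0]) simp
next
  case (linear \<phi>)
  have "(\<lambda>x. coeff [:\<phi> a, \<phi> x:] l) \<in> polyfun scl" for l
    using linear by (cases l) (auto simp: coeff_pCons split: nat.split intro: polyfun.const polyfun.linear)
  then show ?case using linear
    by (intro exI [of _ "\<lambda>x. [:\<phi> a, \<phi> x:]"] exI [of _ 1]) auto
next
  case (add P P')
  then obtain p d p' d' where p: "\<forall>x t. P (a + scl t x) = poly (p x) t" "\<And>l. (\<lambda>x. coeff (p x) l) \<in> polyfun scl"
    "\<forall>x. degree (p x) \<le> d" and p': "\<forall>x t. P' (a + scl t x) = poly (p' x) t"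
    "\<And>l. (\<lambda>x. coeff (p' x) l) \<in> polyfun scl" "\<forall>x. degree (p' x) \<le> d'" by metis
  have "degree (p x + p' x) \<le> max d d'" for x
    using p(3) p'(3) by (meson degree_add_le max.cobounded1 max.cobounded2 order_trans)
  then show ?case using p p'
    by (intro exI [of _ "\<lambda>x. p x + p' x"] exI [of _ "max d d'"]) (auto intro: polyfun.add)
next
  case (mult P P')
  then obtain p d p' d' where p: "\<forall>x t. P (a + scl t x) = poly (p x) t" "\<And>l. (\<lambda>x. coeff (p x) l) \<in> polyfun scl"
    "\<forall>x. degree (p x) \<le> d" and p': "\<forall>x t. P' (a + scl t x) = poly (p' x) t"
    "\<And>l. (\<lambda>x. coeff (p' x) l) \<in> polyfun scl" "\<forall>x. degree (p' x) \<le> d'" by metis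
  have "degree (p x * p' x) \<le> d + d'" for x
    using p(3) p'(3) by (meson add_mono degree_mult_le order_trans)
  then show ?case using p p'
    by (intro exI [of _ "\<lambda>x. p x * p' x"] exI [of _ "d + d'"])
      (auto simp: coeff_mult intro!: polyfun_sum polyfun.mult)
qed

lemma polyfun_along_line: "P \<in> polyfun scl \<Longrightarrow> \<exists>p. \<forall>t. P (a + scl t x) = poly p t"
  using polyfun_expansion [of P scl a] by blast

lemma polyfun_derivative:
  assumes "vector_space scl" "P \<in> polyfun scl"
  obtains dP where "\<And>x v v'. dP x (v + v') = dP x v + dP x v'" "\<And>x c v. dP x (scl c v) = c * dP x v"
    "\<And>x v. ((\<lambda>t. P (x + scl t v)) has_field_derivative dP x v) (at 0)"
proof -
  interpret vector_space scl by fact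
  have "\<exists>dP. (\<forall>x v v'. dP x (v + v') = dP x v + dP x v') \<and> (\<forall>x c v. dP x (scl c v) = c * dP x v) \<and>
    (\<forall>x v. ((\<lambda>t. P (x + scl t v)) has_field_derivative dP x v) (at 0))"
    using assms(2)
  proof induction
    case (const c)
    then show ?case by (intro exI [of _ "\<lambda>_ _. 0"]) auto
  next
    case (linear \<phi>)
    then show ?case by (intro exI [of _ "\<lambda>_ v. \<phi> v"]) (auto intro!: derivative_eq_intros)
  next
    case (add P P')
    then obtain dP dP' where "(\<forall>x v v'. dP x (v + v') = dP x v + dP x v') \<and> (\<forall>x c v. dP x (scl c v) = c * dP x v) \<and>
    (\<forall>x v. ((\<lambda>t. P (x + scl t v)) has_field_derivative dP x v) (at 0))"
      "(\<forall>x v v'. dP' x (v + v') = dP' x v + dP' x v') \<and> (\<forall>x c v. dP' x (scl c v) = c * dP' x v) \<and>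
    (\<forall>x v. ((\<lambda>t. P' (x + scl t v)) has_field_derivative dP' x v) (at 0))" by metis
    then show ?case
      by (intro exI [of _ "\<lambda>x v. dP x v + dP' x v"]) (auto simp: algebra_simps intro!: derivative_eq_intros)
  next
    case (mult P P')
    then obtain dP dP' where d: "(\<forall>x v v'. dP x (v + v') = dP x v + dP x v') \<and> (\<forall>x c v. dP x (scl c v) = c * dP x v) \<and>
    (\<forall>x v. ((\<lambda>t. P (x + scl t v)) has_field_derivative dP x v) (at 0))"
      "(\<forall>x v v'. dP' x (v + v') = dP' x v + dP' x v') \<and> (\<forall>x c v. dP' x (scl c v) = c * dP' x v) \<and>
    (\<forall>x v. ((\<lambda>t. P' (x + scl t v)) has_field_derivative dP' x v) (at 0))" by metis
    have "((\<lambda>t. P (x + scl t v) * P' (x + scl t v)) has_field_derivative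
       dP x v * P' (x + scl 0 v) + dP' x v * P (x + scl 0 v)) (at 0)" for x v
      using d by (intro DERIV_mult) auto
    then show ?case
      using d by (intro exI [of _ "\<lambda>x v. dP x v * P' (x + scl 0 v) + dP' x v * P (x + scl 0 v)"])
        (auto simp: algebra_simps)
  qed
  then show ?thesis using that by blast
qed


lemma polyfun_differentiable:
  assumes "vector_space scl" "P \<in> polyfun scl"
  shows "(\<lambda>t. P (x + scl t v)) field_differentiable (at 0)"
  using polyfun_derivative [OF assms] unfolding field_differentiable_def by meson

lemma poly_eq_0_if_off_0:
  fixes p :: "complex poly"
  assumes "\<And>t. t \<noteq> 0 \<Longrightarrow> poly p t = 0"
  shows "p = 0"
proof (rule ccontr)
  assume "p \<noteq> 0"
  then have "finite {t. poly p t = 0}" by (rule poly_roots_finite)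
  moreover have "UNIV - {0} \<subseteq> {t. poly p t = 0}" using assms by auto
  ultimately have "finite (UNIV - {0 :: complex})" by (rule rev_finite_subset)
  then show False by (simp add: infinite_UNIV_char_0)
qed

text \<open>The main analytic tool: an infinitesimal transversality argument that stays within polynomials. The
  linear vector fields in \<open>C\<close> annihilate \<open>P\<close>, and at \<open>a\<close> they span a complement of the slice \<open>a + S\<close> on
  which \<open>P\<close> vanishes. If \<open>m\<close> is the order of vanishing of \<open>P\<close> at \<open>a\<close>, then comparing lowest
  order terms in the invariance shows that the homogeneous part of order \<open>m\<close> is constant in the
  directions \<open>c a\<close>. As it vanishes on \<open>S\<close>, it vanishes on \<open>E\<close>. Induction on the order gives \<open>P = 0\<close>.\<close>

lemma polyfun_zero_if_invariant:
  assumes vs: "vector_space scl" and P: "P \<in> polyfun scl"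
    and E: "module.subspace scl E" "a \<in> E" "S \<subseteq> E"
    and field_in: "\<And>c x. c \<in> C \<Longrightarrow> x \<in> E \<Longrightarrow> c x \<in> E"
    and field_add: "\<And>c x y. c \<in> C \<Longrightarrow> c (x + y) = c x + c y"
    and field_scale: "\<And>c r x. c \<in> C \<Longrightarrow> c (scl r x) = scl r (c x)"
    and inv: "\<And>c x. c \<in> C \<Longrightarrow> x \<in> E \<Longrightarrow> ((\<lambda>t. P (x + scl t (c x))) has_field_derivative 0) (at 0)"
    and S: "\<And>s r. s \<in> S \<Longrightarrow> scl r s \<in> S"
    and vanish: "\<And>s. s \<in> S \<Longrightarrow> P (a + s) = 0"
    and span: "\<And>x. x \<in> E \<Longrightarrow> \<exists>s\<in>S. \<exists>c\<in>C. x = s + c a"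
    and x: "x \<in> E"
  shows "P x = 0"
proof -
  interpret vector_space scl by fact
  note sub = subspace_add [OF E(1)] subspace_scale [OF E(1)] subspace_diff [OF E(1)]
  obtain p d where p: "\<And>x t. P (a + scl t x) = poly (p x) t"
    and pq: "\<And>l. (\<lambda>x. coeff (p x) l) \<in> polyfun scl" and deg: "\<And>x. degree (p x) \<le> d"
    using polyfun_expansion [OF P, of a] by metis
  have "\<exists>dQ. (\<forall>x v v'. dQ x (v + v') = dQ x v + dQ x v') \<and> (\<forall>x c v. dQ x (scl c v) = c * dQ x v) \<and>
      (\<forall>x v. ((\<lambda>t. coeff (p (x + scl t v)) l) has_field_derivative dQ x v) (at 0))" for l
    by (rule polyfun_derivative [OF vs pq [of l]]) blast
  then obtain dQ where dQ_add: "\<And>l x v v'. dQ l x (v + v') = dQ l x v + dQ l x v'"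
    and dQ_scale: "\<And>l x c v. dQ l x (scl c v) = c * dQ l x v"
    and dQ: "\<And>l x v. ((\<lambda>t. coeff (p (x + scl t v)) l) has_field_derivative dQ l x v) (at 0)"
    by metis
  have vS: "coeff (p s) l = 0" if "s \<in> S" for s l
  proof -
    have "p s = 0" by (rule poly_eq_0_if_off_0) (use that vanish S p in metis)
    then show ?thesis by simp
  qed
  \<comment> \<open>Both summands come from the derivative of the coefficients in the direction \<open>c a + t c X\<close>: the
    equation is the invariance of \<open>P\<close> at \<open>a + t X\<close>, expanded in powers of \<open>t\<close>.\<close>
  have recursion: "(\<Sum>l\<le>d. monom (dQ l X (c a)) l + monom (dQ l X (c X)) (Suc l)) = 0"
    if X: "X \<in> E" and c: "c \<in> C" for X c
  proof (rule poly_eq_0_if_off_0)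
    fix t :: complex assume "t \<noteq> 0"
    define Y where "Y = c a + scl t (c X)"
    have tY: "scl t Y = scl t (c (a + scl t X))"
      using c by (simp add: Y_def field_add field_scale)
    have "P (a + scl t (X + scl \<eta> Y)) = P ((a + scl t X) + scl (t * \<eta>) (c (a + scl t X)))" for \<eta>
    proof -
      have "scl t (scl \<eta> Y) = scl (t * \<eta>) (c (a + scl t X))"
        by (metis tY scale_scale mult.commute)
      then show ?thesis by (simp only: scale_right_distrib add.assoc)
    qed
    moreover have "((\<lambda>\<eta>. P ((a + scl t X) + scl (t * \<eta>) (c (a + scl t X)))) has_field_derivative 0 * t) (at 0)"
    proof (rule DERIV_chain' [where g = "\<lambda>t'. P ((a + scl t X) + scl t' (c (a + scl t X)))"])
      show "((\<lambda>\<eta>. t * \<eta>) has_field_derivative t) (at 0)" by (auto intro!: derivative_eq_intros)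
      show "((\<lambda>t'. P ((a + scl t X) + scl t' (c (a + scl t X)))) has_field_derivative 0) (at (t * 0))"
        using inv [OF c] sub E X by simp
    qed
    ultimately have 1: "((\<lambda>\<eta>. P (a + scl t (X + scl \<eta> Y))) has_field_derivative 0) (at 0)" by simp
    have "P (a + scl t (X + scl \<eta> Y)) = (\<Sum>l\<le>d. coeff (p (X + scl \<eta> Y)) l * t ^ l)" for \<eta>
      unfolding p by (subst poly_altdef, rule sum.mono_neutral_left)
        (use deg in \<open>auto simp: coeff_eq_0\<close>)
    moreover have "((\<lambda>\<eta>. \<Sum>l\<le>d. coeff (p (X + scl \<eta> Y)) l * t ^ l) has_field_derivative
        (\<Sum>l\<le>d. dQ l X Y * t ^ l)) (at 0)"
      by (intro DERIV_sum DERIV_cmult_right dQ)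
    ultimately have "(\<Sum>l\<le>d. dQ l X Y * t ^ l) = 0"
      using 1 by (simp add: DERIV_unique)
    then show "poly (\<Sum>l\<le>d. monom (dQ l X (c a)) l + monom (dQ l X (c X)) (Suc l)) t = 0"
      by (simp add: poly_sum poly_monom Y_def dQ_add dQ_scale algebra_simps sum.distrib)
  qed
  have zero: "\<forall>X\<in>E. coeff (p X) m = 0" for m
  proof (induction m rule: less_induct)
    case (less m)
    have step: "dQ m X (c a) = 0" if X: "X \<in> E" and c: "c \<in> C" and m: "m \<le> d" for X c
    proof -
      have "coeff (\<Sum>l\<le>d. monom (dQ l X (c a)) l + monom (dQ l X (c X)) (Suc l)) m = 0"
        by (simp only: recursion [OF X c] coeff_0)
      then have "dQ m X (c a) + (\<Sum>l\<le>d. if Suc l = m then dQ l X (c X) else 0) = 0"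
        using m by (simp add: coeff_sum coeff_monom sum.distrib)
      moreover have "dQ l X (c X) = 0" if "Suc l = m" for l
      proof (rule DERIV_unique [OF dQ])
        have "coeff (p (X + scl t (c X))) l = 0" for t
          using less [of l] that sub X field_in [OF c X] by simp
        then show "((\<lambda>t. coeff (p (X + scl t (c X))) l) has_field_derivative 0) (at 0)" by simp
      qed
      ultimately show ?thesis by (simp add: sum.neutral)
    qed
    show ?case
    proof
      fix X assume X: "X \<in> E"
      show "coeff (p X) m = 0"
      proof (cases "m \<le> d")
        case False
        then show ?thesis using deg [of X] by (intro coeff_eq_0) simp
      next
        case m: True
        obtain s c where s: "s \<in> S" "c \<in> C" "X = s + c a" using span X by blast
        have sE: "s \<in> E" "c a \<in> E" using s E field_in by auto
        have "((\<lambda>t. coeff (p (s + scl t (c a))) m) has_field_derivative 0) (at t)" for t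
        proof -
          have "((\<lambda>u. coeff (p ((s + scl t (c a)) + scl u (c a))) m) has_field_derivative
              dQ m (s + scl t (c a)) (c a)) (at 0)" by (rule dQ)
          moreover have "dQ m (s + scl t (c a)) (c a) = 0" using step sub sE s(2) m by simp
          moreover have "(s + scl t (c a)) + scl u (c a) = s + scl (u + t) (c a)" for u
            by (simp add: algebra_simps)
          ultimately show ?thesis
            using DERIV_shift [of "\<lambda>t. coeff (p (s + scl t (c a))) m" 0 0 t] by simp
        qed
        then obtain k where "\<And>t. coeff (p (s + scl t (c a))) m = k"
          using has_field_derivative_zero_constant [of UNIV "\<lambda>t. coeff (p (s + scl t (c a))) m"] by auto
        from this [of 0] this [of 1] show ?thesis using s vS by simp
      qed
    qed
  qed
  have "P x = poly (p (x - a)) 1" using p [of 1 "x - a"] by simp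
  moreover have "p (x - a) = 0" using zero sub x E by (intro poly_eqI) simp
  ultimately show ?thesis by simp
qed

section \<open>Derivatives of polynomial functions in coordinates\<close>

lemma polyfun_coordinate: "(\<lambda>x::complex ^ 'm. x $ i) \<in> polyfun (*s)"
  by (intro polyfun.linear) auto

lemma vec_linear_expansion:
  fixes \<phi> :: "complex ^ 'm::finite \<Rightarrow> complex"
  assumes "\<And>x y. \<phi> (x + y) = \<phi> x + \<phi> y" "\<And>c x. \<phi> (c *s x) = c * \<phi> x"
  shows "\<phi> x = (\<Sum>i\<in>UNIV. x $ i * \<phi> (axis i 1))"
proof -
  have [simp]: "\<phi> 0 = 0" using assms(2) [of 0 0] by simp
  have "\<phi> (\<Sum>i\<in>I. x $ i *s axis i 1) = (\<Sum>i\<in>I. x $ i * \<phi> (axis i 1))" for I :: "'m set"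
    by (induction I rule: infinite_finite_induct) (auto simp: assms)
  from this [of UNIV] show ?thesis by (simp only: basis_expansion)
qed

definition dird :: "(complex ^ 'm::finite \<Rightarrow> complex) \<Rightarrow> complex ^ 'm \<Rightarrow> complex ^ 'm \<Rightarrow> complex" where
  "dird f x v = deriv (\<lambda>t. f (x + t *s v)) 0"

lemma vec_vector_space: "vector_space ((*s) :: complex \<Rightarrow> complex ^ 'm \<Rightarrow> complex ^ 'm)"
  by unfold_locales

lemma
  assumes "f \<in> polyfun (*s)"
  shows has_dird: "((\<lambda>t. f (x + t *s v)) has_field_derivative dird f x v) (at 0)"
    and dird_plus: "dird f x (v + v') = dird f x v + dird f x v'"
    and dird_scale: "dird f x (c *s v) = c * dird f x v"
proof -
  obtain dP where dP: "\<And>x v v'. dP x (v + v') = dP x v + dP x v'" "\<And>x c v. dP x (c *s v) = c * dP x v"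
    "\<And>x v. ((\<lambda>t. f (x + t *s v)) has_field_derivative dP x v) (at 0)"
    by (rule polyfun_derivative [OF vec_vector_space assms], rule that)
  then have "dird f x v = dP x v" for x v
    unfolding dird_def by (intro DERIV_imp_deriv)
  then show "((\<lambda>t. f (x + t *s v)) has_field_derivative dird f x v) (at 0)"
    "dird f x (v + v') = dird f x v + dird f x v'" "dird f x (c *s v) = c * dird f x v"
    using dP by auto
qed

lemma dird_const [simp]: "dird (\<lambda>_. c) = (\<lambda>x v. 0)"
  by (simp add: dird_def fun_eq_iff)

lemma dird_linear:
  assumes "\<And>x y. \<phi> (x + y) = \<phi> x + \<phi> y" "\<And>c x. \<phi> (c *s x) = c * \<phi> x"
  shows "dird \<phi> = (\<lambda>x v. \<phi> v)"
  unfolding dird_def fun_eq_iff by (auto intro!: DERIV_imp_deriv derivative_eq_intros simp: assms)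

lemma dird_add:
  assumes "f \<in> polyfun (*s)" "h \<in> polyfun (*s)"
  shows "dird (\<lambda>x. f x + h x) = (\<lambda>x v. dird f x v + dird h x v)"
  unfolding fun_eq_iff dird_def [of "\<lambda>x. f x + h x"]
  using assms by (auto intro!: DERIV_imp_deriv DERIV_add has_dird)

lemma dird_mult:
  assumes "f \<in> polyfun (*s)" "h \<in> polyfun (*s)"
  shows "dird (\<lambda>x. f x * h x) = (\<lambda>x v. dird f x v * h x + dird h x v * f x)"
proof (intro ext)
  fix x v
  have "((\<lambda>t. f (x + t *s v) * h (x + t *s v)) has_field_derivative
      dird f x v * h (x + 0 *s v) + dird h x v * f (x + 0 *s v)) (at 0)"
    by (intro DERIV_mult has_dird assms)
  then show "dird (\<lambda>x. f x * h x) x v = dird f x v * h x + dird h x v * f x"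
    unfolding dird_def [of "\<lambda>x. f x * h x"] by (intro DERIV_imp_deriv) simp
qed

lemma dird_sum:
  assumes "\<And>i. i \<in> I \<Longrightarrow> f i \<in> polyfun (*s)"
  shows "dird (\<lambda>x. \<Sum>i\<in>I. f i x) = (\<lambda>x v. \<Sum>i\<in>I. dird (f i) x v)"
  using assms by (induction I rule: infinite_finite_induct) (simp_all add: dird_add polyfun_sum)

lemma dird_cmult:
  assumes "f \<in> polyfun (*s)"
  shows "dird (\<lambda>x. c * f x) = (\<lambda>x v. c * dird f x v)"
  using dird_mult [OF polyfun.const assms, of c] by (simp add: mult.commute)

lemma dird_zero [simp]: "f \<in> polyfun (*s) \<Longrightarrow> dird f x 0 = 0"
  using dird_scale [of f x 0 0] by simp

lemma dird_sum_right: "f \<in> polyfun (*s) \<Longrightarrow> dird f x (\<Sum>i\<in>I. v i) = (\<Sum>i\<in>I. dird f x (v i))"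
  by (induction I rule: infinite_finite_induct) (simp_all add: dird_plus)

text \<open>For a linear functional this is differentiation under a finite sum; the product rule does the rest.\<close>

lemma dird_chain:
  assumes "f \<in> polyfun (*s)" "\<And>i. ((\<lambda>t. y t $ i) has_field_derivative y' $ i) (at t0)"
  shows "((\<lambda>t. f (y t)) has_field_derivative dird f (y t0) y') (at t0)"
  using assms(1)
proof induction
  case (linear \<phi>)
  have "((\<lambda>t. \<Sum>i\<in>UNIV. y t $ i * \<phi> (axis i 1)) has_field_derivative (\<Sum>i\<in>UNIV. y' $ i * \<phi> (axis i 1))) (at t0)"
    by (intro DERIV_sum DERIV_cmult_right assms(2))
  moreover have "(\<Sum>i\<in>UNIV. z $ i * \<phi> (axis i 1)) = \<phi> z" for z
    by (rule vec_linear_expansion [symmetric]) (use linear in auto)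
  ultimately show ?case using linear by (simp add: dird_linear)
next
  case (mult f h)
  then show ?case by (simp only: dird_mult) (rule DERIV_mult)
qed (auto simp: dird_add intro!: derivative_eq_intros)

section \<open>The stabilizer of a polynomial function\<close>

lemma polyfun_comp:
  fixes B :: "complex ^ 'm::finite ^ 'k::finite"
  assumes "f \<in> polyfun (*s)" shows "(\<lambda>x. f (B *v x)) \<in> polyfun (*s)"
  using assms
proof induction
  case (linear \<phi>)
  then show ?case by (intro polyfun.linear) (auto simp: matrix_vector_right_distrib vector_scalar_commute)
qed (auto intro: polyfun.intros)

lemma dird_comp:
  fixes B :: "complex ^ 'm::finite ^ 'k::finite"
  assumes "f \<in> polyfun (*s)"
  shows "dird (\<lambda>x. f (B *v x)) x v = dird f (B *v x) (B *v v)"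
  by (simp add: dird_def matrix_vector_right_distrib vector_scalar_commute)

lemma polyfun_dird:
  assumes "f \<in> polyfun (*s)" shows "(\<lambda>x. dird f x (A *v x)) \<in> polyfun (*s)"
  using assms
proof induction
  case (linear \<phi>)
  then show ?case
    by (auto simp: dird_linear matrix_vector_right_distrib vector_scalar_commute intro!: polyfun.linear)
qed (auto simp: dird_add dird_mult intro!: polyfun.intros)

text \<open>The derivations \<open>f \<mapsto> (\<lambda>x. dird f x (A *v x))\<close> form a Lie algebra: both sides are derivations in
  \<open>f\<close>, so it suffices to compare them on linear functionals.\<close>

lemma dird_commutator:
  assumes "f \<in> polyfun (*s)"
  shows "dird (\<lambda>x. dird f x (B *v x)) x (A *v x) - dird (\<lambda>x. dird f x (A *v x)) x (B *v x)
    = dird f x ((B ** A - A ** B) *v x)"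
  using assms
proof induction
  case (linear \<phi>)
  have "dird (\<lambda>x. \<phi> (C *v x)) = (\<lambda>x v. \<phi> (C *v v))" for C :: "complex^'a^'a"
    by (rule dird_linear) (use linear in \<open>auto simp: matrix_vector_right_distrib vector_scalar_commute\<close>)
  moreover have "\<phi> (x - y) = \<phi> x - \<phi> y" for x y
    using linear(1) [of "x - y" y] by simp
  ultimately show ?case using linear
    by (simp add: dird_linear matrix_vector_mult_diff_rdistrib matrix_vector_mul_assoc)
next
  case (add f h)
  then show ?case by (simp add: dird_add polyfun_dird) (simp flip: add(3,4))
next
  case (mult f h)
  then show ?case
    by (simp add: dird_mult dird_add polyfun_dird polyfun.mult)
       (simp add: algebra_simps flip: mult(3,4))
qed simp

lemma matrix_inv_inverse:
  assumes "invertible (A :: 'a::field ^ 'm::finite ^ 'm)"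
  shows "A ** matrix_inv A = mat 1" "matrix_inv A ** A = mat 1"
  using assms unfolding invertible_def matrix_inv_def by (metis (mono_tags, lifting) someI_ex)+

lemma matrix_inv_eqI:
  assumes "A ** B = mat 1" shows "matrix_inv (A :: 'a::field ^ 'm::finite ^ 'm) = B"
  using assms matrix_inv_inverse by (metis invertible_right_inverse matrix_mul_assoc matrix_mul_lid matrix_mul_rid)

lemma invertibleI: "A ** B = mat 1 \<Longrightarrow> invertible (A :: 'a::field ^ 'm::finite ^ 'm)"
  using invertible_right_inverse by blast

lemma field_differentiable_prod:
  fixes f :: "'i \<Rightarrow> complex \<Rightarrow> complex"
  assumes "\<And>i. i \<in> I \<Longrightarrow> f i field_differentiable (at t0)"
  shows "(\<lambda>t. \<Prod>i\<in>I. f i t) field_differentiable (at t0)"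
  using assms by (induction I rule: infinite_finite_induct)
    (auto intro: field_differentiable_mult field_differentiable_const simp: field_differentiable_const)

lemma field_differentiable_det:
  assumes "\<And>i j. (\<lambda>t. M t $ i $ j) field_differentiable (at t0)"
  shows "(\<lambda>t. det (M t :: complex ^ 'm::finite ^ 'm)) field_differentiable (at t0)"
  unfolding det_def
  by (intro field_differentiable_sum field_differentiable_mult field_differentiable_const
      field_differentiable_prod assms)

lemma mscale_matrix_vector: "mscale c A *v x = c *s (A *v x)"
  by (simp add: vec_eq_iff matrix_vector_mult_def sum_distrib_left mult.assoc)

text \<open>The curve \<open>y t = matrix_inv (mat 1 + mscale t A) *v x\<close> is differentiable by Cramer's rule, and
  differentiating \<open>y t + t *s (A *v y t) = x\<close> at 0 gives its velocity \<open>- (A *v x)\<close>.\<close>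

lemma lie_act_eq:
  fixes f :: "complex ^ 'm::finite \<Rightarrow> complex"
  assumes f: "f \<in> polyfun (*s)"
  shows "lie_act A f = (\<lambda>x. - dird f x (A *v x))"
proof
  fix x
  define M where "M t = mat 1 + mscale t A" for t
  define y where "y t = matrix_inv (M t) *v x" for t
  define z where "z t k = det (\<chi> i j. if j = k then x $ i else M t $ i $ j) / det (M t)" for t k
  have entry: "(\<lambda>t. M t $ i $ j) field_differentiable (at 0)" for i j
    by (auto simp: M_def intro!: derivative_intros)
  have detM: "(\<lambda>t. det (M t)) field_differentiable (at 0)" by (rule field_differentiable_det [OF entry])
  have M0: "M 0 = mat 1" by (simp add: M_def vec_eq_iff)
  have "isCont (\<lambda>t. det (M t)) 0" using detM by (rule field_differentiable_imp_continuous_at)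
  then have "((\<lambda>t. det (M t)) \<longlongrightarrow> 1) (nhds 0)"
    using M0 by (simp add: isCont_def tendsto_nhds_iff)
  then have ev: "\<forall>\<^sub>F t in nhds 0. det (M t) \<noteq> 0"
    by (rule tendsto_imp_eventually_ne) simp
  have sol: "M t *v y t = x \<and> (\<forall>k. y t $ k = z t k)" if "det (M t) \<noteq> 0" for t
  proof -
    have "M t *v y t = x"
      using that by (simp add: y_def matrix_vector_mul_assoc matrix_inv_inverse invertible_det_nz)
    moreover from this have "y t = (\<chi> k. z t k)" unfolding z_def by (rule cramer [OF that, THEN iffD1])
    ultimately show ?thesis by simp
  qed
  have "(\<lambda>t. (\<chi> i j. if j = k then x $ i else M t $ i $ j) $ i $ j) field_differentiable (at 0)" for i j k
    by (cases "j = k") (simp_all add: entry field_differentiable_const)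
  then have zdiff: "(\<lambda>t. z t k) field_differentiable (at 0)" for k
    unfolding z_def by (intro field_differentiable_divide field_differentiable_det detM) (simp_all add: M0)
  have "\<forall>k. \<exists>d. ((\<lambda>t. y t $ k) has_field_derivative d) (at 0)"
  proof
    fix k
    obtain d where "((\<lambda>t. z t k) has_field_derivative d) (at 0)"
      using zdiff field_differentiable_def by blast
    moreover have e: "\<forall>\<^sub>F t in nhds 0. y t $ k = z t k" using ev by eventually_elim (use sol in auto)
    ultimately show "\<exists>d. ((\<lambda>t. y t $ k) has_field_derivative d) (at 0)"
      using DERIV_cong_ev [OF refl e refl] by blast
  qed
  then obtain y' where y': "\<And>k. ((\<lambda>t. y t $ k) has_field_derivative y' k) (at 0)" by metis
  have "matrix_inv (M 0) = mat 1" by (rule matrix_inv_eqI) (simp add: M0)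
  then have y0: "y 0 = x" by (simp add: y_def)
  have "y' k = (- (A *v x)) $ k" for k
  proof -
    have "((\<lambda>t. y t $ k + t * (\<Sum>j\<in>UNIV. A $ k $ j * y t $ j)) has_field_derivative
        y' k + (0 * (\<Sum>j\<in>UNIV. A $ k $ j * y' j) + 1 * (\<Sum>j\<in>UNIV. A $ k $ j * y 0 $ j))) (at 0)"
      by (intro DERIV_add DERIV_mult' DERIV_ident DERIV_sum DERIV_cmult y')
    moreover have e: "\<forall>\<^sub>F t in nhds 0. y t $ k + t * (\<Sum>j\<in>UNIV. A $ k $ j * y t $ j) = x $ k"
      using ev
    proof eventually_elim
      case (elim t)
      have "(M t *v y t) $ k = y t $ k + t * (A *v y t) $ k"
        by (simp add: M_def matrix_vector_mult_add_rdistrib mscale_matrix_vector)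
      moreover have "(M t *v y t) $ k = x $ k" using sol [OF elim] by simp
      ultimately have "y t $ k + t * (A *v y t) $ k = x $ k" by simp
      then show ?case by (simp add: matrix_vector_mult_def)
    qed
    ultimately have "((\<lambda>t. x $ k) has_field_derivative y' k + (A *v x) $ k) (at 0)"
      using DERIV_cong_ev [OF refl e refl] by (simp add: y0 matrix_vector_mult_def)
    then have "y' k + (A *v x) $ k = 0" by (rule DERIV_unique [OF _ DERIV_const])
    then show ?thesis by (simp add: eq_neg_iff_add_eq_0)
  qed
  then have "((\<lambda>t. y t $ k) has_field_derivative (- (A *v x)) $ k) (at 0)" for k
    using y' by metis
  then have "((\<lambda>t. f (y t)) has_field_derivative dird f (y 0) (- (A *v x))) (at 0)"
    by (rule dird_chain [OF f])
  moreover have "dird f x (- (A *v x)) = - dird f x (A *v x)"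
    using dird_scale [OF f, of x "-1" "A *v x"] by simp
  ultimately show "lie_act A f x = - dird f x (A *v x)"
    unfolding lie_act_def group_act_def by (intro DERIV_imp_deriv) (simp add: y0 flip: M_def y_def)
qed

lemma lie_stabilizer_iff:
  assumes "f \<in> polyfun (*s)"
  shows "A \<in> lie_stabilizer f \<longleftrightarrow> (\<forall>x. dird f x (A *v x) = 0)"
  by (simp add: lie_stabilizer_def lie_act_eq [OF assms] fun_eq_iff)

lemma subspace_lie_stabilizer:
  assumes "f \<in> polyfun (*s)"
  shows "matrix_space.subspace (lie_stabilizer f)"
  by (rule matrix_space.subspaceI)
    (simp_all add: lie_stabilizer_iff assms matrix_vector_mult_add_rdistrib mscale_matrix_vector
      dird_plus dird_scale)

lemma lie_stabilizer_commutator: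
  assumes f: "f \<in> polyfun (*s)" and "A \<in> lie_stabilizer f" "B \<in> lie_stabilizer f"
  shows "A ** B - B ** A \<in> lie_stabilizer f"
proof -
  have "(\<lambda>x. dird f x (A *v x)) = (\<lambda>_. 0)" "(\<lambda>x. dird f x (B *v x)) = (\<lambda>_. 0)"
    using assms by (auto simp: lie_stabilizer_iff)
  then show ?thesis
    using dird_commutator [OF f, of A _ B] by (simp add: lie_stabilizer_iff f)
qed

lemma lie_stabilizer_comp:
  fixes P P' :: "complex ^ 'm::finite ^ 'm"
  assumes f: "f \<in> polyfun (*s)" and P: "P ** P' = mat 1"
  shows "B \<in> lie_stabilizer (\<lambda>x. f (P *v x)) \<longleftrightarrow> P ** B ** P' \<in> lie_stabilizer f"
proof -
  have P': "P' ** P = mat 1" using P by (simp add: matrix_left_right_inverse)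
  have "(\<forall>x. dird f (P *v x) (P *v (B *v x)) = 0) \<longleftrightarrow> (\<forall>y. dird f y (P *v (B *v (P' *v y))) = 0)"
    (is "?L = ?R")
  proof
    assume ?L
    then have "dird f (P *v (P' *v y)) (P *v (B *v (P' *v y))) = 0" for y by blast
    then show ?R by (simp add: matrix_vector_mul_assoc P)
  next
    assume ?R
    then have "dird f (P *v x) (P *v (B *v (P' *v (P *v x)))) = 0" for x by blast
    then show ?L by (simp add: matrix_vector_mul_assoc P' flip: matrix_mul_assoc)
  qed
  then show ?thesis
    by (simp add: lie_stabilizer_iff f polyfun_comp dird_comp matrix_vector_mul_assoc matrix_mul_assoc)
qed

section \<open>Forms and their coefficients\<close>

abbreviation exponents :: "nat \<Rightarrow> ('m::finite \<Rightarrow> nat) set" where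
  "exponents d \<equiv> {\<alpha>. (\<Sum>i\<in>UNIV. \<alpha> i) = d}"

definition monomial :: "('m::finite \<Rightarrow> nat) \<Rightarrow> complex ^ 'm \<Rightarrow> complex" where
  "monomial \<alpha> x = (\<Prod>i\<in>UNIV. x $ i ^ \<alpha> i)"

definition form_of :: "nat \<Rightarrow> (('m::finite \<Rightarrow> nat) \<Rightarrow> complex) \<Rightarrow> complex ^ 'm \<Rightarrow> complex" where
  "form_of d c x = (\<Sum>\<alpha>\<in>exponents d. c \<alpha> * monomial \<alpha> x)"

lemma forms_iff: "f \<in> forms d \<longleftrightarrow> (\<exists>c. f = form_of d c)"
  by (simp add: forms_def form_of_def monomial_def fun_eq_iff)

lemma form_of_in_forms [simp]: "form_of d c \<in> forms d"
  by (auto simp: forms_iff)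

lemma finite_exponents: "finite (exponents d :: ('m::finite \<Rightarrow> nat) set)"
proof (rule finite_subset)
  show "exponents d \<subseteq> PiE (UNIV :: 'm set) (\<lambda>_. {..d})"
    by (auto simp: PiE_def extensional_def intro: member_le_sum)
  show "finite (PiE (UNIV :: 'm set) (\<lambda>_. {..d}))" by (rule finite_PiE) auto
qed

lemma polyfun_monomial: "monomial \<alpha> \<in> polyfun (*s)"
  unfolding monomial_def by (intro polyfun_prod polyfun_power polyfun_coordinate)

lemma polyfun_form_of: "form_of d c \<in> polyfun (*s)"
  unfolding form_of_def by (intro polyfun_sum polyfun_cmult polyfun_monomial)

lemma polyfun_form: "f \<in> forms d \<Longrightarrow> f \<in> polyfun (*s)"
  by (auto simp: forms_iff polyfun_form_of)

text \<open>A polynomial that vanishes identically has zero coefficients. The variables are indexed by a finite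
  subset \<open>J\<close> of an arbitrary type, because both coordinates of vectors and initial segments of the natural
  numbers occur as index sets.\<close>

lemma polynomial_zero_imp_coefficients_zero:
  fixes c :: "('j \<Rightarrow> nat) \<Rightarrow> complex"
  assumes "finite J" "finite M" "\<And>\<alpha> k. \<alpha> \<in> M \<Longrightarrow> k \<notin> J \<Longrightarrow> \<alpha> k = 0"
    and "\<And>z :: 'j \<Rightarrow> complex. (\<Sum>\<alpha>\<in>M. c \<alpha> * (\<Prod>k\<in>J. z k ^ \<alpha> k)) = 0"
    and "\<alpha> \<in> M"
  shows "c \<alpha> = 0"
  using assms
proof (induction J arbitrary: M c \<alpha> rule: finite_induct)
  case empty
  have "\<beta> = (\<lambda>_. 0)" if "\<beta> \<in> M" for \<beta> using empty.prems(2) [OF that] by (auto simp: fun_eq_iff)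
  then have "M = {\<alpha>}" using empty.prems(4) by blast
  then show ?case using empty.prems(3) by simp
next
  case (insert j J)
  define e where "e = \<alpha> j"
  define M' where "M' = (\<lambda>\<beta>. \<beta>(j := 0)) ` {\<beta> \<in> M. \<beta> j = e}"
  define c' where "c' \<beta> = c (\<beta>(j := e))" for \<beta>
  have inj: "inj_on (\<lambda>\<beta>. \<beta>(j := 0)) {\<beta> \<in> M. \<beta> j = e}"
    by (rule inj_on_inverseI [of _ "\<lambda>\<beta>. \<beta>(j := e)"]) auto
  have "c' (\<alpha>(j := 0)) = 0"
  proof (rule insert.IH)
    show "finite M'" using insert.prems(1) by (simp add: M'_def)
    show "\<beta> k = 0" if "\<beta> \<in> M'" "k \<notin> J" for \<beta> k
      using that insert.prems(2) by (auto simp: M'_def)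
    show "\<alpha>(j := 0) \<in> M'" using insert.prems(4) by (auto simp: M'_def e_def)
    fix z :: "'j \<Rightarrow> complex"
    define p where "p = (\<Sum>\<beta>\<in>M. monom (c \<beta> * (\<Prod>k\<in>J. z k ^ \<beta> k)) (\<beta> j))"
    have "poly p t = 0" for t
    proof -
      have "(\<Prod>k\<in>J. (z(j := t)) k ^ \<beta> k) = (\<Prod>k\<in>J. z k ^ \<beta> k)" for \<beta>
        using insert.hyps(2) by (intro prod.cong) auto
      then show ?thesis
        using insert.prems(3) [of "z(j := t)"] insert.hyps
        by (simp add: p_def poly_sum poly_monom mult_ac)
    qed
    then have "p = 0" by (intro poly_eq_0_if_off_0)
    then have "0 = coeff p e" by simp
    also have "\<dots> = (\<Sum>\<beta>\<in>{\<beta>\<in>M. \<beta> j = e}. c \<beta> * (\<Prod>k\<in>J. z k ^ \<beta> k))"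
      using insert.prems(1) by (simp add: p_def coeff_sum coeff_monom sum.inter_filter)
    also have "\<dots> = (\<Sum>\<beta>\<in>M'. c' \<beta> * (\<Prod>k\<in>J. z k ^ \<beta> k))"
      unfolding M'_def sum.reindex [OF inj] o_def
    proof (intro sum.cong refl arg_cong2 [where f = "(*)"] prod.cong)
      fix \<beta> assume "\<beta> \<in> {\<beta> \<in> M. \<beta> j = e}"
      then show "c \<beta> = c' (\<beta>(j := 0))" by (auto simp: c'_def fun_upd_idem)
    next
      fix \<beta> k assume "k \<in> J"
      then show "z k ^ \<beta> k = z k ^ (\<beta>(j := 0)) k" using insert.hyps(2) by auto
    qed
    finally show "(\<Sum>\<beta>\<in>M'. c' \<beta> * (\<Prod>k\<in>J. z k ^ \<beta> k)) = 0" by simp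
  qed
  then show ?case by (simp add: c'_def e_def)
qed

lemma form_coefficients_unique:
  assumes "finite M" "\<And>x :: complex ^ 'm::finite. (\<Sum>\<alpha>\<in>M. c \<alpha> * monomial \<alpha> x) = 0" "\<alpha> \<in> M"
  shows "c \<alpha> = 0"
proof (rule polynomial_zero_imp_coefficients_zero [of UNIV M])
  fix z :: "'m \<Rightarrow> complex"
  show "(\<Sum>\<alpha>\<in>M. c \<alpha> * (\<Prod>k\<in>UNIV. z k ^ \<alpha> k)) = 0"
    using assms(2) [of "\<chi> k. z k"] by (simp add: monomial_def)
qed (use assms in auto)

lemma form_of_eq_0_iff: "form_of d c = (\<lambda>_. 0) \<longleftrightarrow> (\<forall>\<alpha>\<in>exponents d. c \<alpha> = 0)"
proof
  assume "form_of d c = (\<lambda>_. 0)"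
  then show "\<forall>\<alpha>\<in>exponents d. c \<alpha> = 0"
    using form_coefficients_unique [OF finite_exponents] unfolding form_of_def fun_eq_iff by blast
qed (simp add: form_of_def fun_eq_iff)

text \<open>Forms whose coefficients depend on a parameter \<open>p\<close> through functions in \<open>R\<close>. With \<open>R\<close> the polynomial
  functions of a matrix \<open>g\<close> this describes \<open>f (g *v x)\<close>; with a trivial parameter it describes plain
  forms.\<close>

definition forms_over :: "('p \<Rightarrow> complex) set \<Rightarrow> nat \<Rightarrow> ('p \<Rightarrow> complex ^ 'm::finite \<Rightarrow> complex) set" where
  "forms_over R d = {G. \<exists>q. (\<forall>\<beta>. q \<beta> \<in> R) \<and> G = (\<lambda>p. form_of d (\<lambda>\<beta>. q \<beta> p))}"

locale function_ring =
  fixes R :: "('p \<Rightarrow> complex) set"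
  assumes const: "(\<lambda>_. c) \<in> R"
    and add: "P \<in> R \<Longrightarrow> P' \<in> R \<Longrightarrow> (\<lambda>p. P p + P' p) \<in> R"
    and mult: "P \<in> R \<Longrightarrow> P' \<in> R \<Longrightarrow> (\<lambda>p. P p * P' p) \<in> R"
begin

lemma forms_over_0: "(\<lambda>_ _. 0) \<in> forms_over R d"
  unfolding forms_over_def by (intro CollectI exI [of _ "\<lambda>_ _. 0"]) (simp add: const form_of_def fun_eq_iff)

lemma forms_over_add:
  "F \<in> forms_over R d \<Longrightarrow> G \<in> forms_over R d \<Longrightarrow> (\<lambda>p x. F p x + G p x) \<in> forms_over R d"
  unfolding forms_over_def
proof (safe, goal_cases)
  case (1 q q')
  then show ?case
    by (intro exI [of _ "\<lambda>\<beta> p. q \<beta> p + q' \<beta> p"])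
      (auto simp: form_of_def fun_eq_iff algebra_simps sum.distrib intro: add)
qed

lemma forms_over_scale: "P \<in> R \<Longrightarrow> G \<in> forms_over R d \<Longrightarrow> (\<lambda>p x. P p * G p x) \<in> forms_over R d"
  unfolding forms_over_def
proof (safe, goal_cases)
  case (1 q)
  then show ?case
    by (intro exI [of _ "\<lambda>\<beta> p. P p * q \<beta> p"])
      (auto simp: form_of_def fun_eq_iff mult.assoc sum_distrib_left intro: mult)
qed

lemma forms_over_sum: "(\<And>i. i \<in> I \<Longrightarrow> G i \<in> forms_over R d) \<Longrightarrow> (\<lambda>p x. \<Sum>i\<in>I. G i p x) \<in> forms_over R d"
  by (induction I rule: infinite_finite_induct) (simp_all add: forms_over_0 forms_over_add)

lemma forms_over_1: "(\<lambda>_ _. 1) \<in> (forms_over R 0 :: ('p \<Rightarrow> complex ^ 'm::finite \<Rightarrow> complex) set)"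
proof -
  have e: "exponents 0 = {\<lambda>_::'m. 0}" by (auto simp: fun_eq_iff)
  have "form_of 0 (\<lambda>_. 1) x = 1" for x :: "complex ^ 'm"
    by (simp only: form_of_def e) (simp add: monomial_def)
  then show ?thesis unfolding forms_over_def
    by (intro CollectI exI [of _ "\<lambda>_ _. 1"]) (simp add: const fun_eq_iff)
qed

lemma forms_over_coordinate:
  fixes G :: "'p \<Rightarrow> complex ^ 'm::finite \<Rightarrow> complex"
  assumes "G \<in> forms_over R d"
  shows "(\<lambda>p x. x $ j * G p x) \<in> forms_over R (Suc d)"
proof -
  obtain q where q: "\<And>\<beta>. q \<beta> \<in> R" "G = (\<lambda>p. form_of d (\<lambda>\<beta>. q \<beta> p))"
    using assms by (auto simp: forms_over_def)
  define q' where "q' \<beta> = (if \<beta> j = 0 then (\<lambda>_. 0) else q (\<beta>(j := \<beta> j - 1)))" for \<beta>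
  have s: "(\<Sum>i\<in>UNIV. (\<beta>(j := k)) i) = k + (\<Sum>i\<in>UNIV - {j}. \<beta> i)" for \<beta> :: "'m \<Rightarrow> nat" and k
    by (subst sum.remove [of _ j]) auto
  have "x $ j * G p x = form_of (Suc d) (\<lambda>\<beta>. q' \<beta> p) x" for p x
  proof -
    have "form_of (Suc d) (\<lambda>\<beta>. q' \<beta> p) x = (\<Sum>\<beta>\<in>{\<beta>\<in>exponents (Suc d). \<beta> j \<noteq> 0}. q' \<beta> p * monomial \<beta> x)"
      unfolding form_of_def by (intro sum.mono_neutral_right finite_exponents) (auto simp: q'_def)
    also have "\<dots> = (\<Sum>\<beta>\<in>exponents d. q \<beta> p * (x $ j * monomial \<beta> x))"
    proof (rule sum.reindex_bij_witness [of _ "\<lambda>\<beta>. \<beta>(j := Suc (\<beta> j))" "\<lambda>\<beta>. \<beta>(j := \<beta> j - 1)"])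
      fix \<beta> assume b: "\<beta> \<in> {\<beta>\<in>exponents (Suc d). \<beta> j \<noteq> 0}"
      then show "\<beta>(j := \<beta> j - 1) \<in> exponents d"
        using s [of \<beta> "\<beta> j"] s [of \<beta> "\<beta> j - 1"] by simp
      have "monomial \<beta> x = x $ j * monomial (\<beta>(j := \<beta> j - 1)) x"
        unfolding monomial_def using b
        by (subst (1 2) prod.remove [of _ j]) (auto simp: power_eq_if intro!: prod.cong)
      then show "q (\<beta>(j := \<beta> j - 1)) p * (x $ j * monomial (\<beta>(j := \<beta> j - 1)) x) = q' \<beta> p * monomial \<beta> x"
        using b by (simp add: q'_def)
    next
      fix \<beta> :: "'m \<Rightarrow> nat" assume b: "\<beta> \<in> exponents d"
      then show "\<beta>(j := Suc (\<beta> j)) \<in> {\<beta>\<in>exponents (Suc d). \<beta> j \<noteq> 0}"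
        using s [of \<beta> "\<beta> j"] s [of \<beta> "Suc (\<beta> j)"] by simp
    qed auto
    also have "\<dots> = x $ j * G p x"
      by (simp add: q form_of_def sum_distrib_left mult_ac)
    finally show ?thesis by simp
  qed
  then show ?thesis
    unfolding forms_over_def
    by (intro CollectI exI [of _ q']) (auto simp: fun_eq_iff q'_def q(1) const)
qed

lemma forms_over_prod_linear:
  assumes "finite J" "\<And>j i. l j i \<in> R"
  shows "(\<lambda>p x. \<Prod>j\<in>J. (\<Sum>i\<in>UNIV. l j i p * x $ i) ^ a j) \<in> forms_over R (\<Sum>j\<in>J. a j)"
  using assms(1)
proof (induction J rule: finite_induct)
  case empty
  then show ?case by (simp add: forms_over_1)
next
  case (insert j J)
  let ?G = "\<lambda>p x. \<Prod>j\<in>J. (\<Sum>i\<in>UNIV. l j i p * x $ i) ^ a j"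
  have "(\<lambda>p x. (\<Sum>i\<in>UNIV. l j i p * x $ i) ^ k * ?G p x) \<in> forms_over R (k + (\<Sum>j\<in>J. a j))" for k
  proof (induction k)
    case 0
    then show ?case using insert.IH by simp
  next
    case (Suc k)
    have "(\<lambda>p x. \<Sum>i\<in>UNIV. l j i p * (x $ i * ((\<Sum>i\<in>UNIV. l j i p * x $ i) ^ k * ?G p x)))
        \<in> forms_over R (Suc (k + (\<Sum>j\<in>J. a j)))"
      by (intro forms_over_sum forms_over_scale forms_over_coordinate assms Suc)
    then show ?case by (simp add: sum_distrib_right mult.assoc)
  qed
  then show ?case using insert.hyps by simp
qed

end

interpretation all_functions: function_ring UNIV by unfold_locales auto

lemma forms_over_UNIV_iff: "(\<lambda>_::unit. f) \<in> forms_over UNIV d \<longleftrightarrow> f \<in> forms d"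
proof
  assume "f \<in> forms d"
  then obtain c where "f = form_of d c" by (auto simp: forms_iff)
  then show "(\<lambda>_::unit. f) \<in> forms_over UNIV d"
    unfolding forms_over_def by (intro CollectI exI [of _ "\<lambda>\<beta> _. c \<beta>"]) simp
qed (auto simp: forms_over_def dest: fun_cong)

lemma det_form_in_forms: "(det_form :: complex ^ ('n::finite \<times> 'n) \<Rightarrow> complex) \<in> forms CARD('n)"
proof -
  let ?l = "\<lambda>\<pi> j i (_::unit). if i = (j, \<pi> j) then 1 else 0 :: complex"
  have "(\<lambda>(_::unit) x. \<Sum>\<pi>\<in>{\<pi>. \<pi> permutes (UNIV :: 'n set)}. of_int (sign \<pi>) *
      (\<Prod>j\<in>UNIV. (\<Sum>i\<in>UNIV. ?l \<pi> j i () * x $ i) ^ 1)) \<in> forms_over UNIV (\<Sum>j\<in>(UNIV::'n set). 1)"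
    by (intro all_functions.forms_over_sum all_functions.forms_over_scale
        all_functions.forms_over_prod_linear) auto
  moreover have "(\<Sum>i\<in>UNIV. ?l \<pi> j i () * x $ i) = x $ (j, \<pi> j)" for \<pi> :: "'n \<Rightarrow> 'n" and j x
    by (simp add: if_distrib [of "\<lambda>y. y * _"] cong: if_cong)
  moreover have "(det_form :: complex ^ ('n \<times> 'n) \<Rightarrow> complex) = (\<lambda>x. \<Sum>\<pi>\<in>{\<pi>. \<pi> permutes (UNIV :: 'n set)}.
      of_int (sign \<pi>) * (\<Prod>j\<in>UNIV. x $ (j, \<pi> j)))"
    by (simp add: det_form_def det_def fun_eq_iff)
  ultimately show ?thesis by (simp add: forms_over_UNIV_iff)
qed

lemma polyfun_entry: "(\<lambda>g::complex ^ 'm ^ 'k. g $ i $ j) \<in> polyfun mscale"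
  by (intro polyfun.linear) auto

interpretation matrix_polyfun: function_ring "polyfun (mscale :: complex \<Rightarrow> complex ^ 'm::finite ^ 'k::finite \<Rightarrow> _)"
  by unfold_locales (auto intro: polyfun.intros)

text \<open>The coefficients of \<open>f (g *v x)\<close> are polynomials in the entries of \<open>g\<close>.\<close>

lemma form_comp_over:
  assumes "f \<in> forms d"
  shows "(\<lambda>(g :: complex ^ 'k::finite ^ 'm::finite) x. f (g *v x)) \<in> forms_over (polyfun mscale) d"
proof -
  obtain c where c: "f = form_of d c" using assms by (auto simp: forms_iff)
  have "(\<lambda>(g :: complex ^ 'k ^ 'm) x. \<Sum>\<alpha>\<in>exponents d. c \<alpha> * (\<Prod>j\<in>UNIV. (\<Sum>i\<in>UNIV. g $ j $ i * x $ i) ^ \<alpha> j))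
      \<in> forms_over (polyfun mscale) d"
  proof (intro matrix_polyfun.forms_over_sum matrix_polyfun.forms_over_scale polyfun.const)
    fix \<alpha> :: "'m \<Rightarrow> nat" assume "\<alpha> \<in> exponents d"
    then show "(\<lambda>(g :: complex ^ 'k ^ 'm) x. \<Prod>j\<in>UNIV. (\<Sum>i\<in>UNIV. g $ j $ i * x $ i) ^ \<alpha> j)
        \<in> forms_over (polyfun mscale) d"
      using matrix_polyfun.forms_over_prod_linear [of UNIV "\<lambda>j i g. g $ j $ i" \<alpha>]
      by (simp add: polyfun_entry)
  qed
  then show ?thesis by (simp add: c form_of_def monomial_def matrix_vector_mult_def)
qed

lemma forms_comp: "f \<in> forms d \<Longrightarrow> (\<lambda>x. f (g *v x)) \<in> forms d" for g :: "complex ^ 'k::finite ^ 'm::finite"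
  using form_comp_over [of f d, where 'k = 'k] by (auto simp: forms_over_def dest!: fun_cong [of _ _ g])

lemma forms_add: "f \<in> forms d \<Longrightarrow> h \<in> forms d \<Longrightarrow> (\<lambda>x. f x + h x) \<in> forms d"
  using all_functions.forms_over_add [of "\<lambda>_::unit. f" d "\<lambda>_. h"] by (simp add: forms_over_UNIV_iff)

lemma forms_scale: "f \<in> forms d \<Longrightarrow> (\<lambda>x. c * f x) \<in> forms d"
  using all_functions.forms_over_scale [of "\<lambda>_::unit. c" "\<lambda>_::unit. f" d] by (simp add: forms_over_UNIV_iff)

lemma monomial_in_forms: "\<alpha> \<in> exponents d \<Longrightarrow> monomial \<alpha> \<in> forms d"
  unfolding forms_iff
  by (intro exI [of _ "\<lambda>\<beta>. if \<beta> = \<alpha> then 1 else 0"] ext)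
    (simp add: form_of_def if_distrib [of "\<lambda>y. y * _"] finite_exponents cong: if_cong)

section \<open>Pulling regular functions back along an orbit map\<close>

lemma linear_on_form_of:
  fixes \<phi> :: "(complex ^ 'm::finite \<Rightarrow> complex) \<Rightarrow> complex"
  assumes add: "\<And>u v. u \<in> forms d \<Longrightarrow> v \<in> forms d \<Longrightarrow> \<phi> (\<lambda>x. u x + v x) = \<phi> u + \<phi> v"
    and scale: "\<And>c u. u \<in> forms d \<Longrightarrow> \<phi> (\<lambda>x. c * u x) = c * \<phi> u"
  shows "\<phi> (form_of d c) = (\<Sum>\<alpha>\<in>exponents d. c \<alpha> * \<phi> (monomial \<alpha>))"
proof -
  have zero_form: "(\<lambda>_ :: complex ^ 'm. 0) \<in> forms d"
    using forms_scale [of "form_of d c" d 0] by simp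
  have "\<phi> (\<lambda>x. \<Sum>\<alpha>\<in>M. c \<alpha> * monomial \<alpha> x) = (\<Sum>\<alpha>\<in>M. c \<alpha> * \<phi> (monomial \<alpha>)) \<and>
      (\<lambda>x. \<Sum>\<alpha>\<in>M. c \<alpha> * monomial \<alpha> x) \<in> forms d"
    if "finite M" "M \<subseteq> exponents d" for M
    using that
  proof (induction M rule: finite_induct)
    case empty
    then show ?case using scale [OF zero_form, of 0] zero_form by simp
  next
    case (insert \<alpha> M)
    then have "monomial \<alpha> \<in> forms d" by (intro monomial_in_forms) auto
    with insert show ?case by (simp add: add scale forms_scale forms_add)
  qed
  from this [OF finite_exponents subset_refl] show ?thesis by (simp add: form_of_def [abs_def])
qed

text \<open>A linear functional on the space of forms sees \<open>f (g *v x)\<close> only through its coefficients, so it can be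
  differentiated in \<open>g\<close> under the functional.\<close>

lemma linear_pullback:
  fixes f :: "complex ^ 'm::finite \<Rightarrow> complex"
  assumes f: "f \<in> forms d"
    and lin: "\<And>u v. u \<in> forms d \<Longrightarrow> v \<in> forms d \<Longrightarrow> \<phi> (\<lambda>x. u x + v x) = \<phi> u + \<phi> v"
      "\<And>c u. u \<in> forms d \<Longrightarrow> \<phi> (\<lambda>x. c * u x) = c * \<phi> u"
  shows "(\<lambda>g :: complex ^ 'm ^ 'm. \<phi> (\<lambda>x. f (g *v x))) \<in> polyfun mscale"
    and "((\<lambda>t. \<phi> (\<lambda>x. f ((X + mscale t Y) *v x))) has_field_derivative
      \<phi> (\<lambda>x. dird f (X *v x) (Y *v x))) (at 0)"
    and "(\<lambda>x. dird f (X *v x) (Y *v x)) \<in> forms d"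
proof -
  obtain q where q: "\<And>\<beta>. q \<beta> \<in> polyfun mscale"
    and q_eq: "(\<lambda>(g :: complex ^ 'm ^ 'm) x. f (g *v x)) = (\<lambda>g. form_of d (\<lambda>\<beta>. q \<beta> g))"
    using form_comp_over [OF f, where 'k = 'm] by (auto simp: forms_over_def)
  have eq: "(\<lambda>x. f (g *v x)) = form_of d (\<lambda>\<beta>. q \<beta> g)" for g :: "complex ^ 'm ^ 'm"
    using fun_cong [OF q_eq] .
  have L: "\<phi> (form_of d c) = (\<Sum>\<alpha>\<in>exponents d. c \<alpha> * \<phi> (monomial \<alpha>))" for c
    by (rule linear_on_form_of) (use lin in auto)
  show "(\<lambda>g :: complex ^ 'm ^ 'm. \<phi> (\<lambda>x. f (g *v x))) \<in> polyfun mscale"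
    unfolding eq L by (intro polyfun_sum polyfun.mult q polyfun.const)
  define q' where "q' \<beta> = deriv (\<lambda>t. q \<beta> (X + mscale t Y)) 0" for \<beta>
  have q': "((\<lambda>t. q \<beta> (X + mscale t Y)) has_field_derivative q' \<beta>) (at 0)" for \<beta>
    using polyfun_differentiable [OF matrix_space.vector_space_axioms q] unfolding q'_def
    by (rule DERIV_deriv_iff_field_differentiable [THEN iffD2])
  have form': "(\<lambda>x. dird f (X *v x) (Y *v x)) = form_of d q'"
  proof
    fix x
    have "((\<lambda>t. f (X *v x + t *s (Y *v x))) has_field_derivative dird f (X *v x) (Y *v x)) (at 0)"
      by (rule has_dird [OF polyfun_form [OF f]])
    moreover have "f (X *v x + t *s (Y *v x)) = form_of d (\<lambda>\<beta>. q \<beta> (X + mscale t Y)) x" for t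
      using fun_cong [OF eq, of "X + mscale t Y" x]
      by (simp add: matrix_vector_mult_add_rdistrib mscale_matrix_vector)
    moreover have "((\<lambda>t. form_of d (\<lambda>\<beta>. q \<beta> (X + mscale t Y)) x) has_field_derivative form_of d q' x) (at 0)"
      unfolding form_of_def by (intro DERIV_sum DERIV_cmult_right q')
    ultimately show "dird f (X *v x) (Y *v x) = form_of d q' x" by (simp add: DERIV_unique)
  qed
  then show "(\<lambda>x. dird f (X *v x) (Y *v x)) \<in> forms d" by simp
  show "((\<lambda>t. \<phi> (\<lambda>x. f ((X + mscale t Y) *v x))) has_field_derivative
      \<phi> (\<lambda>x. dird f (X *v x) (Y *v x))) (at 0)"
    unfolding form' unfolding eq L by (intro DERIV_sum DERIV_cmult_right q')
qed

lemma regular_pullback: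
  fixes f :: "complex ^ 'm::finite \<Rightarrow> complex"
  assumes f: "f \<in> forms d" and "\<Phi> \<in> regular_functions (forms d)"
  shows "(\<lambda>g :: complex ^ 'm ^ 'm. \<Phi> (\<lambda>x. f (g *v x))) \<in> polyfun mscale"
  using assms(2)
proof induction
  case (linear \<phi>)
  then show ?case using linear_pullback(1) [OF f] by blast
qed (auto intro: polyfun.intros)

text \<open>Moving \<open>X\<close> infinitesimally to \<open>X + t A X\<close> with \<open>A\<close> in the stabilizer does not move \<open>f (X *v x)\<close> to first
  order.\<close>

lemma regular_pullback_stabilizer:
  fixes f :: "complex ^ 'm::finite \<Rightarrow> complex" and X :: "complex ^ 'm ^ 'm"
  assumes f: "f \<in> forms d" and "\<Phi> \<in> regular_functions (forms d)" and A: "A \<in> lie_stabilizer f"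
  shows "((\<lambda>t. \<Phi> (\<lambda>x. f ((X + mscale t (A ** X)) *v x))) has_field_derivative 0) (at 0)"
  using assms(2)
proof induction
  case (linear \<phi>)
  have "dird f (X *v x) (A ** X *v x) = 0" for x
    using A lie_stabilizer_iff [OF polyfun_form [OF f]] by (simp flip: matrix_vector_mul_assoc)
  moreover have "\<phi> (\<lambda>x. 0) = 0" using linear(2) [OF f, of 0] by simp
  moreover have "((\<lambda>t. \<phi> (\<lambda>x. f ((X + mscale t (A ** X)) *v x))) has_field_derivative
      \<phi> (\<lambda>x. dird f (X *v x) (A ** X *v x))) (at 0)"
    by (rule linear_pullback(2) [OF f]) (use linear in auto)
  ultimately show ?case by simp
next
  case (add P P')
  show ?case using DERIV_add [OF add(3,4)] by simp
next
  case (mult P P')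
  show ?case using DERIV_mult [OF mult(3,4)] by simp
qed simp

lemma orbit_eq: "orbit f = {\<lambda>x. f (g *v x) | g. invertible g}" for f :: "complex ^ 'm::finite \<Rightarrow> complex"
proof -
  have "invertible (matrix_inv g)" "matrix_inv (matrix_inv g) = g" if "invertible g" for g :: "complex ^ 'm ^ 'm"
    using matrix_inv_inverse [OF that] by (auto intro: invertibleI matrix_inv_eqI)
  then show ?thesis unfolding orbit_def group_act_def by (safe; metis)
qed

lemma orbit_subset_forms:
  fixes f :: "complex ^ 'm::finite \<Rightarrow> complex"
  assumes "f \<in> forms d" shows "orbit f \<subseteq> forms d"
  using forms_comp [OF assms] by (auto simp: orbit_eq)

lemma self_in_orbit: "f \<in> orbit f" for f :: "complex ^ 'm::finite \<Rightarrow> complex"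
  unfolding orbit_eq by (intro CollectI exI [of _ "mat 1"]) (simp add: invertibleI [of "mat 1" "mat 1"])

section \<open>Zariski closures and algebraic independence\<close>

lemma zariski_closure_superset: "A \<subseteq> zariski_closure V A"
  by (simp add: zariski_closure_def hull_subset)

lemma vanishing_on_zariski_closure:
  assumes "A \<subseteq> V" "F \<in> regular_functions V" "\<And>v. v \<in> A \<Longrightarrow> F v = 0" "v \<in> zariski_closure V A"
  shows "F v = 0"
proof -
  have "zariski_closed V {v \<in> V. F v = 0}"
    unfolding zariski_closed_def using assms(2) by (intro exI [of _ "{F}"]) auto
  then have "zariski_closure V A \<subseteq> {v \<in> V. F v = 0}"
    unfolding zariski_closure_def using assms by (intro hull_minimal) auto
  then show ?thesis using assms(4) by auto
qed

lemma regular_functions_sum: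
  "(\<And>i. i \<in> I \<Longrightarrow> F i \<in> regular_functions V) \<Longrightarrow> (\<lambda>v. \<Sum>i\<in>I. F i v) \<in> regular_functions V"
  by (induction I rule: infinite_finite_induct) (auto intro: regular_functions.const regular_functions.add)

lemma regular_functions_prod:
  "(\<And>i. i \<in> I \<Longrightarrow> F i \<in> regular_functions V) \<Longrightarrow> (\<lambda>v. \<Prod>i\<in>I. F i v) \<in> regular_functions V"
  by (induction I rule: infinite_finite_induct) (auto intro: regular_functions.const regular_functions.mult)

lemma regular_functions_power: "F \<in> regular_functions V \<Longrightarrow> (\<lambda>v. F v ^ k) \<in> regular_functions V"
  by (induction k) (auto intro: regular_functions.const regular_functions.mult)

lemma regular_functions_polynomial:
  assumes "\<And>k. k < e \<Longrightarrow> F k \<in> regular_functions V"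
  shows "(\<lambda>v. \<Sum>\<alpha>\<in>M. c \<alpha> * (\<Prod>k<e. F k v ^ \<alpha> k)) \<in> regular_functions V"
  using assms by (intro regular_functions_sum regular_functions.mult regular_functions.const
      regular_functions_prod regular_functions_power) auto

text \<open>An algebraic relation between regular functions is itself a regular function, so it holds on a set
  iff it holds on its Zariski closure.\<close>

lemma alg_independent_on_zariski_closure:
  assumes "A \<subseteq> V" "\<And>k. k < e \<Longrightarrow> F k \<in> regular_functions V"
  shows "alg_independent_on (zariski_closure V A) e F \<longleftrightarrow> alg_independent_on A e F"
proof -
  have "(\<forall>z\<in>zariski_closure V A. (\<Sum>\<alpha>\<in>M. c \<alpha> * (\<Prod>k<e. F k z ^ \<alpha> k)) = 0) \<longleftrightarrow>
      (\<forall>z\<in>A. (\<Sum>\<alpha>\<in>M. c \<alpha> * (\<Prod>k<e. F k z ^ \<alpha> k)) = 0)"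
    (is "?L = ?R") for M c
  proof
    assume ?L
    then show ?R using zariski_closure_superset [of A V] by auto
  next
    assume R: ?R
    have "(\<lambda>z. \<Sum>\<alpha>\<in>M. c \<alpha> * (\<Prod>k<e. F k z ^ \<alpha> k)) \<in> regular_functions V"
      by (rule regular_functions_polynomial) (rule assms(2))
    from vanishing_on_zariski_closure [OF assms(1) this] R show ?L by simp
  qed
  then show ?thesis unfolding alg_independent_on_def by simp
qed

section \<open>More polynomials than monomials are algebraically dependent\<close>

interpretation fun_space: vector_space "\<lambda>(c::complex) (f :: 'x \<Rightarrow> complex) x. c * f x"
  by unfold_locales (auto simp: algebra_simps)

lemma (in vector_space) dependent_family:
  assumes "finite A" "finite T" "card T < card A" "\<And>a. a \<in> A \<Longrightarrow> G a \<in> span T"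
  shows "\<exists>c. (\<exists>a\<in>A. c a \<noteq> 0) \<and> (\<Sum>a\<in>A. scale (c a) (G a)) = 0"
proof (cases "inj_on G A")
  case True
  have "dependent (G ` A)"
    using independent_span_bound [OF assms(2), of "G ` A"] assms card_image [OF True] by fastforce
  then obtain u where "\<exists>v\<in>G ` A. u v \<noteq> 0" "(\<Sum>v\<in>G ` A. scale (u v) v) = 0"
    using dependent_finite [of "G ` A"] assms(1) by auto
  then show ?thesis using True by (intro exI [of _ "u \<circ> G"]) (auto simp: sum.reindex)
next
  case False
  then obtain a b where ab: "a \<in> A" "b \<in> A" "a \<noteq> b" "G a = G b" by (auto simp: inj_on_def)
  have "(\<Sum>x\<in>A. scale (if x = a then 1 else if x = b then - 1 else 0) (G x))
      = (\<Sum>x\<in>{a, b}. scale (if x = a then 1 else if x = b then - 1 else 0) (G x))"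
    using ab assms(1) by (intro sum.mono_neutral_right) auto
  also have "\<dots> = 0" using ab by simp
  finally show ?thesis
    using ab by (intro exI [of _ "\<lambda>x. if x = a then 1 else if x = b then - 1 else 0"]) auto
qed

definition box :: "nat \<Rightarrow> nat \<Rightarrow> (nat \<Rightarrow> nat) set" where
  "box D r = {\<beta>. (\<forall>i<D. \<beta> i \<le> r) \<and> (\<forall>i\<ge>D. \<beta> i = 0)}"

lemma bij_betw_box: "bij_betw (\<lambda>\<beta>. restrict \<beta> {..<D}) (box D r) (PiE {..<D} (\<lambda>_. {..r}))"
  by (rule bij_betw_byWitness [where f' = "\<lambda>\<beta> i. if i < D then \<beta> i else 0"])
    (auto simp: box_def fun_eq_iff restrict_def PiE_def extensional_def)

lemma finite_box: "finite (box D r)"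
  using bij_betw_finite [OF bij_betw_box] by (simp add: finite_PiE)

lemma card_box: "card (box D r) = (r + 1) ^ D"
  using bij_betw_same_card [OF bij_betw_box] by (simp add: card_PiE)

definition power_product :: "nat \<Rightarrow> (nat \<Rightarrow> nat) \<Rightarrow> (nat \<Rightarrow> complex) \<Rightarrow> complex" where
  "power_product D \<beta> z = (\<Prod>i<D. z i ^ \<beta> i)"

definition polys :: "nat \<Rightarrow> nat \<Rightarrow> ((nat \<Rightarrow> complex) \<Rightarrow> complex) set" where
  "polys D r = fun_space.span (power_product D ` box D r)"

lemma polys_mono: "r \<le> r' \<Longrightarrow> polys D r \<subseteq> polys D r'"
  unfolding polys_def by (intro fun_space.span_mono image_mono) (fastforce simp: box_def)

lemma polys_add: "P \<in> polys D r \<Longrightarrow> P' \<in> polys D r \<Longrightarrow> (\<lambda>z. P z + P' z) \<in> polys D r"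
  unfolding polys_def using fun_space.span_add [of P _ P'] by (simp add: plus_fun_def)

lemma polys_const: "(\<lambda>_. c) \<in> polys D r"
proof -
  have "power_product D (\<lambda>_. 0) \<in> polys D r"
    unfolding polys_def by (intro fun_space.span_base imageI) (simp add: box_def)
  from fun_space.span_scale [OF this [unfolded polys_def], of c] show ?thesis
    by (simp add: polys_def power_product_def)
qed

lemma polys_coordinate: "i < D \<Longrightarrow> (\<lambda>z. z i) \<in> polys D 1"
proof -
  assume i: "i < D"
  have "power_product D (\<lambda>j. if j = i then 1 else 0) \<in> polys D 1"
    unfolding polys_def by (intro fun_space.span_base imageI) (use i in \<open>auto simp: box_def\<close>)
  moreover have "power_product D (\<lambda>j. if j = i then 1 else 0) = (\<lambda>z. z i)"
    using i by (simp add: power_product_def fun_eq_iff if_distrib [of "\<lambda>k. _ ^ k"] prod.delta cong: if_cong)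
  ultimately show ?thesis by simp
qed

lemma polys_mult:
  assumes "P \<in> polys D r" "P' \<in> polys D r'"
  shows "(\<lambda>z. P z * P' z) \<in> polys D (r + r')"
proof -
  have sub: "fun_space.subspace {F. (\<lambda>z. G z * F z) \<in> polys D (r + r')}" for G
  proof (rule fun_space.subspaceI)
    show "0 \<in> {F. (\<lambda>z. G z * F z) \<in> polys D (r + r')}" using polys_const [of 0] by simp
    fix F F' c assume F: "F \<in> {F. (\<lambda>z. G z * F z) \<in> polys D (r + r')}"
    show "(\<lambda>x. c * F x) \<in> {F. (\<lambda>z. G z * F z) \<in> polys D (r + r')}"
      using F fun_space.span_scale [of "\<lambda>z. G z * F z" _ c]
      by (simp add: polys_def mult.left_commute)
    assume F': "F' \<in> {F. (\<lambda>z. G z * F z) \<in> polys D (r + r')}"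
    show "F + F' \<in> {F. (\<lambda>z. G z * F z) \<in> polys D (r + r')}"
      using polys_add [of "\<lambda>z. G z * F z" D "r + r'" "\<lambda>z. G z * F' z"] F F' by (simp add: distrib_left)
  qed
  have mono: "(\<lambda>z. power_product D \<beta> z * P' z) \<in> polys D (r + r')" if \<beta>: "\<beta> \<in> box D r" for \<beta>
    using assms(2) unfolding polys_def [of D r']
  proof (rule fun_space.span_induct [OF _ sub])
    fix F assume "F \<in> power_product D ` box D r'"
    then obtain \<gamma> where \<gamma>: "\<gamma> \<in> box D r'" "F = power_product D \<gamma>" by auto
    have "(\<lambda>z. power_product D \<beta> z * F z) = power_product D (\<lambda>i. \<beta> i + \<gamma> i)"
      by (simp add: \<gamma> power_product_def power_add prod.distrib fun_eq_iff)
    moreover have "(\<lambda>i. \<beta> i + \<gamma> i) \<in> box D (r + r')"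
      using \<beta> \<gamma> by (auto simp: box_def add_mono)
    ultimately show "(\<lambda>z. power_product D \<beta> z * F z) \<in> polys D (r + r')"
      by (auto simp: polys_def intro: fun_space.span_base)
  qed
  have "(\<lambda>z. P' z * P z) \<in> polys D (r + r')"
    using assms(1) unfolding polys_def [of D r]
  proof (rule fun_space.span_induct [OF _ sub])
    fix F assume "F \<in> power_product D ` box D r"
    then show "(\<lambda>z. P' z * F z) \<in> polys D (r + r')" using mono by (auto simp: mult.commute)
  qed
  then show ?thesis by (simp add: mult.commute)
qed

lemma polys_power: "P \<in> polys D r \<Longrightarrow> (\<lambda>z. P z ^ k) \<in> polys D (k * r)"
  by (induction k) (auto intro: polys_const polys_mult)

lemma polys_prod:
  assumes "finite I" "\<And>i. i \<in> I \<Longrightarrow> P i \<in> polys D (r i)"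
  shows "(\<lambda>z. \<Prod>i\<in>I. P i z) \<in> polys D (\<Sum>i\<in>I. r i)"
  using assms by (induction I rule: finite_induct) (auto intro: polys_const polys_mult)

lemma polyfun_pullback_polys:
  fixes b :: "nat \<Rightarrow> complex ^ 'm::finite ^ 'm"
  assumes "P \<in> polyfun mscale"
  shows "\<exists>r. (\<lambda>z. P (a + (\<Sum>i<D. mscale (z i) (b i)))) \<in> polys D r"
  using assms
proof induction
  case (const c)
  then show ?case using polys_const by blast
next
  case (linear \<phi>)
  have "\<phi> 0 = 0" using linear(2) [of 0 0] by simp
  then have "\<phi> (\<Sum>i\<in>I. mscale (z i) (b i)) = (\<Sum>i\<in>I. z i * \<phi> (b i))" for I z
    by (induction I rule: infinite_finite_induct) (simp_all add: linear)
  then have *: "\<phi> (a + (\<Sum>i<D. mscale (z i) (b i))) = \<phi> a + (\<Sum>i<D. z i * \<phi> (b i))" for z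
    by (simp add: linear)
  have "(\<lambda>z. \<phi> a + (\<Sum>i\<in>I. z i * \<phi> (b i))) \<in> polys D 1" if "finite I" "I \<subseteq> {..<D}" for I
    using that
  proof (induction I rule: finite_induct)
    case (insert i I)
    have 1: "(\<lambda>z. z i * \<phi> (b i)) \<in> polys D (1 + 0)"
      using insert by (intro polys_mult polys_coordinate polys_const) auto
    have "(\<lambda>z. z i * \<phi> (b i) + (\<phi> a + (\<Sum>i\<in>I. z i * \<phi> (b i)))) \<in> polys D 1"
      by (rule polys_add) (use insert 1 in auto)
    then show ?case using insert by (simp add: add.left_commute)
  qed (simp add: polys_const)
  from this [of "{..<D}"] show ?case unfolding * by auto
next
  case (add P P')
  then obtain r r' where "(\<lambda>z. P (a + (\<Sum>i<D. mscale (z i) (b i)))) \<in> polys D r"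
    "(\<lambda>z. P' (a + (\<Sum>i<D. mscale (z i) (b i)))) \<in> polys D r'" by blast
  then have "(\<lambda>z. P (a + (\<Sum>i<D. mscale (z i) (b i)))) \<in> polys D (max r r')"
    "(\<lambda>z. P' (a + (\<Sum>i<D. mscale (z i) (b i)))) \<in> polys D (max r r')"
    using polys_mono by (meson max.cobounded1 max.cobounded2 subsetD)+
  then show ?case using polys_add by blast
next
  case (mult P P')
  then show ?case using polys_mult by blast
qed

text \<open>Counting: the \<open>(r + 1) ^ e\<close> power products of \<open>P 0, \<dots>, P (e - 1)\<close> with exponents at most \<open>r\<close> lie in a
  space spanned by \<open>(e * R * r + 1) ^ D\<close> power products of the variables, where \<open>R\<close> bounds the degrees.
  Since \<open>D < e\<close>, there are too many of them for large \<open>r\<close>; \<open>r = (e * R + 1) ^ D\<close> is large enough.\<close>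

lemma polys_algebraically_dependent:
  assumes "\<And>k. k < e \<Longrightarrow> \<exists>r. P k \<in> polys D r" "D < e"
  shows "\<exists>r c. (\<exists>\<alpha>\<in>box e r. c \<alpha> \<noteq> 0) \<and> (\<forall>z. (\<Sum>\<alpha>\<in>box e r. c \<alpha> * (\<Prod>k<e. P k z ^ \<alpha> k)) = 0)"
proof -
  obtain \<rho> where \<rho>: "\<And>k. k < e \<Longrightarrow> P k \<in> polys D (\<rho> k)" using assms(1) by metis
  define R where "R = (\<Sum>k<e. \<rho> k)"
  have R: "P k \<in> polys D R" if "k < e" for k
    using \<rho> [OF that] polys_mono [of "\<rho> k" R D] that member_le_sum [of k "{..<e}" \<rho>]
    by (auto simp: R_def)
  define r where "r = (e * R + 1) ^ D"
  have in_polys: "(\<lambda>z. \<Prod>k<e. P k z ^ \<alpha> k) \<in> polys D (e * R * r)" if "\<alpha> \<in> box e r" for \<alpha>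
  proof -
    have "(\<lambda>z. \<Prod>k<e. P k z ^ \<alpha> k) \<in> polys D (\<Sum>k<e. \<alpha> k * R)"
      by (intro polys_prod polys_power R) auto
    moreover have "(\<Sum>k<e. \<alpha> k * R) \<le> (\<Sum>k<e. r * R)"
      using that by (intro sum_mono) (auto simp: box_def)
    ultimately show ?thesis
      using polys_mono [of "\<Sum>k<e. \<alpha> k * R" "e * R * r" D] by (auto simp: mult_ac)
  qed
  have less: "card (power_product D ` box D (e * R * r)) < card (box e r)"
  proof -
    have "card (power_product D ` box D (e * R * r)) \<le> card (box D (e * R * r))"
      by (rule card_image_le [OF finite_box])
    also have "\<dots> = (e * R * r + 1) ^ D" by (simp add: card_box)
    also have "\<dots> \<le> ((e * R + 1) * (r + 1)) ^ D"
      by (intro power_mono) (auto simp: algebra_simps)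
    also have "\<dots> = r * (r + 1) ^ D" by (simp only: power_mult_distrib r_def [symmetric])
    also have "\<dots> < (r + 1) * (r + 1) ^ D" by simp
    also have "\<dots> = (r + 1) ^ Suc D" by simp
    also have "\<dots> \<le> (r + 1) ^ e" using assms(2) by (intro power_increasing) auto
    finally show ?thesis by (simp add: card_box)
  qed
  have app: "(\<Sum>\<alpha>\<in>A. G \<alpha>) z = (\<Sum>\<alpha>\<in>A. G \<alpha> z)"
    for A and G :: "(nat \<Rightarrow> nat) \<Rightarrow> (nat \<Rightarrow> complex) \<Rightarrow> complex" and z
    by (induction A rule: infinite_finite_induct) auto
  have "\<exists>c. (\<exists>\<alpha>\<in>box e r. c \<alpha> \<noteq> 0) \<and> (\<Sum>\<alpha>\<in>box e r. (\<lambda>z. c \<alpha> * (\<Prod>k<e. P k z ^ \<alpha> k))) = 0"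
    by (rule fun_space.dependent_family [OF finite_box _ less])
      (use in_polys in \<open>simp_all add: finite_box polys_def\<close>)
  then obtain c where c: "\<exists>\<alpha>\<in>box e r. c \<alpha> \<noteq> 0"
    and c0: "(\<Sum>\<alpha>\<in>box e r. (\<lambda>z. c \<alpha> * (\<Prod>k<e. P k z ^ \<alpha> k))) = 0" by blast
  have "(\<Sum>\<alpha>\<in>box e r. c \<alpha> * (\<Prod>k<e. P k z ^ \<alpha> k)) = 0" for z
    using fun_cong [OF c0, of z] unfolding app by simp
  with c show ?thesis by (intro exI [of _ r] exI [of _ c]) simp
qed

section \<open>The dimension of an orbit closure\<close>

text \<open>The last two properties say that the \<open>b i\<close> span and are independent modulo \<open>H\<close>.\<close>

lemma complement_basis:
  fixes H :: "(complex ^ 'm::finite ^ 'm) set"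
  assumes "matrix_space.subspace H"
  obtains b :: "nat \<Rightarrow> complex ^ 'm ^ 'm" and D where
    "D + matrix_space.dim H = matrix_space.dim (UNIV :: (complex ^ 'm ^ 'm) set)"
    "\<And>X. \<exists>z. X - (\<Sum>i<D. mscale (z i) (b i)) \<in> H"
    "\<And>z i. (\<Sum>i<D. mscale (z i) (b i)) \<in> H \<Longrightarrow> i < D \<Longrightarrow> z i = 0"
proof -
  obtain BH where BH: "BH \<subseteq> H" "matrix_space.independent BH" "H \<subseteq> matrix_space.span BH"
    "card BH = matrix_space.dim H" by (rule matrix_space.basis_exists)
  obtain B where B: "BH \<subseteq> B" "matrix_space.independent B" "UNIV \<subseteq> matrix_space.span B"
    using matrix_space.maximal_independent_subset_extend [of BH UNIV] BH by auto
  have finB: "finite B" using B matrix_space.finiteI_independent by blast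
  then have finBH: "finite BH" using B(1) finite_subset by blast
  have cardB: "card B = matrix_space.dim (UNIV :: (complex ^ 'm ^ 'm) set)"
    using matrix_space.basis_card_eq_dim [of B UNIV] B by simp
  obtain b where b: "bij_betw b {..<card (B - BH)} (B - BH)"
    using ex_bij_betw_nat_finite [of "B - BH"] finB by (auto simp: atLeast0LessThan)
  have H: "matrix_space.span BH = H"
    using BH assms by (simp add: matrix_space.span_subspace)
  have sum_b: "(\<Sum>i<card (B - BH). mscale (z (b i)) (b i)) = (\<Sum>v\<in>B - BH. mscale (z v) v)" for z
    by (rule sum.reindex_bij_betw [OF b])
  show ?thesis
  proof (rule that [of "card (B - BH)" b])
    show "card (B - BH) + matrix_space.dim H = matrix_space.dim (UNIV :: (complex ^ 'm ^ 'm) set)"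
      using B(1) BH(4) cardB finB card_mono [OF finB B(1)] by (simp add: card_Diff_subset finBH)
  next
    fix X :: "complex ^ 'm ^ 'm"
    obtain u where u: "X = (\<Sum>v\<in>B. mscale (u v) v)"
      using B(3) matrix_space.span_finite [OF finB] by auto
    have "X - (\<Sum>v\<in>B - BH. mscale (u v) v) = (\<Sum>v\<in>BH. mscale (u v) v)"
      by (simp add: u sum.subset_diff [OF B(1) finB])
    moreover have "(\<Sum>v\<in>BH. mscale (u v) v) \<in> H"
      unfolding H [symmetric]
      by (intro matrix_space.span_sum matrix_space.span_scale matrix_space.span_base)
    ultimately have "X - (\<Sum>i<card (B - BH). mscale (u (b i)) (b i)) \<in> H" by (simp add: sum_b)
    then show "\<exists>z. X - (\<Sum>i<card (B - BH). mscale (z i) (b i)) \<in> H"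
      by (intro exI [of _ "u \<circ> b"]) simp
  next
    fix z :: "nat \<Rightarrow> complex" and i
    assume h: "(\<Sum>i<card (B - BH). mscale (z i) (b i)) \<in> H" and i: "i < card (B - BH)"
    define z' where "z' v = z (the_inv_into {..<card (B - BH)} b v)" for v
    have z': "z' (b i) = z i" if "i < card (B - BH)" for i
      using the_inv_into_f_f [OF bij_betw_imp_inj_on [OF b]] that by (simp add: z'_def)
    have "(\<Sum>i<card (B - BH). mscale (z i) (b i)) = (\<Sum>v\<in>B - BH. mscale (z' v) v)"
      unfolding sum_b [symmetric] by (intro sum.cong) (auto simp: z')
    moreover obtain u where "(\<Sum>i<card (B - BH). mscale (z i) (b i)) = (\<Sum>v\<in>BH. mscale (u v) v)"
      using h H matrix_space.span_finite [OF finBH] by auto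
    ultimately have "(\<Sum>v\<in>B. mscale (if v \<in> BH then - u v else z' v) v) = 0"
      unfolding sum.subset_diff [OF B(1) finB] by (simp add: sum_negf)
    moreover have bi: "b i \<in> B - BH" using b i by (auto simp: bij_betw_def)
    ultimately have "(if b i \<in> BH then - u (b i) else z' (b i)) = 0"
      using matrix_space.independentD [OF B(2) finB subset_refl,
          where u = "\<lambda>v. if v \<in> BH then - u v else z' v" and v = "b i"] by blast
    then show "z i = 0" using bi z' [OF i] by simp
  qed
qed

text \<open>Upper bound for the dimension. Let \<open>S\<close> be a complement of the stabilizer. If there were more
  functions than \<open>dim S\<close>, then by counting they would satisfy a relation on the slice of all
  \<open>f ((mat 1 + s) *v x)\<close> with \<open>s \<in> S\<close>. The relation, pulled back to matrices, is annihilated by the vector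
  fields \<open>X \<mapsto> A ** X\<close> with \<open>A\<close> in the stabilizer, so by \<open>polyfun_zero_if_invariant\<close> it holds on the
  orbit.\<close>

lemma alg_independent_on_orbit_bound:
  fixes f :: "complex ^ 'm::finite \<Rightarrow> complex"
  assumes f: "f \<in> forms d" and F: "\<And>k. k < e \<Longrightarrow> F k \<in> regular_functions (forms d)"
    and indep: "alg_independent_on (orbit f) e F"
  shows "e + matrix_space.dim (lie_stabilizer f) \<le> matrix_space.dim (UNIV :: (complex ^ 'm ^ 'm) set)"
proof (rule ccontr)
  assume contr: "\<not> ?thesis"
  let ?H = "lie_stabilizer f"
  have subH: "matrix_space.subspace ?H" by (rule subspace_lie_stabilizer [OF polyfun_form [OF f]])
  obtain b D where D: "D + matrix_space.dim ?H = matrix_space.dim (UNIV :: (complex ^ 'm ^ 'm) set)"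
    and spanning: "\<And>X. \<exists>z. X - (\<Sum>i<D. mscale (z i) (b i)) \<in> ?H"
    by (rule complement_basis [OF subH], rule that)
  define S where "S z = (\<Sum>i<D. mscale (z i) (b i))" for z
  define P where "P k = (\<lambda>z. F k (\<lambda>x. f ((mat 1 + S z) *v x)))" for k
  have "\<exists>r. P k \<in> polys D r" if "k < e" for k
    unfolding P_def S_def by (rule polyfun_pullback_polys [OF regular_pullback [OF f F [OF that]]])
  moreover have "D < e" using contr D by simp
  ultimately obtain r c where c: "\<exists>\<alpha>\<in>box e r. c \<alpha> \<noteq> 0"
    and relation: "\<And>z. (\<Sum>\<alpha>\<in>box e r. c \<alpha> * (\<Prod>k<e. P k z ^ \<alpha> k)) = 0"
    using polys_algebraically_dependent [of e P D] by blast
  define \<Phi> where "\<Phi> = (\<lambda>v. \<Sum>\<alpha>\<in>box e r. c \<alpha> * (\<Prod>k<e. F k v ^ \<alpha> k))"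
  have \<Phi>: "\<Phi> \<in> regular_functions (forms d)"
    unfolding \<Phi>_def by (rule regular_functions_polynomial) (rule F)
  have S_scale: "mscale t (S z) = S (\<lambda>i. t * z i)" for t z
    by (simp add: S_def matrix_space.scale_sum_right)
  have "\<Phi> (\<lambda>x. f (X *v x)) = 0" for X :: "complex ^ 'm ^ 'm"
  proof (rule polyfun_zero_if_invariant [where a = "mat 1" and E = UNIV and S = "range S"
        and C = "(\<lambda>A X. A ** X) ` ?H" and P = "\<lambda>X. \<Phi> (\<lambda>x. f (X *v x))"
        and scl = mscale])
    show "vector_space (mscale :: complex \<Rightarrow> complex ^ 'm ^ 'm \<Rightarrow> _)" by (rule matrix_space.vector_space_axioms)
    show "(\<lambda>X :: complex ^ 'm ^ 'm. \<Phi> (\<lambda>x. f (X *v x))) \<in> polyfun mscale" by (rule regular_pullback [OF f \<Phi>])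
    show "c (X + Y) = c X + c Y" if "c \<in> (\<lambda>A X. A ** X) ` ?H" for c X Y
      using that by (auto simp: matrix_add_ldistrib)
    show "c (mscale r X) = mscale r (c X)" if "c \<in> (\<lambda>A X. A ** X) ` ?H" for c r X
      using that by (auto simp: matrix_eq_iff matrix_matrix_mult_def sum_distrib_left mult.left_commute)
    show "((\<lambda>t. \<Phi> (\<lambda>x. f ((X + mscale t (c X)) *v x))) has_field_derivative 0) (at 0)"
      if "c \<in> (\<lambda>A X. A ** X) ` ?H" for c X
      using that regular_pullback_stabilizer [OF f \<Phi>] by auto
    show "mscale t s \<in> range S" if "s \<in> range S" for s t using that by (auto simp: S_scale)
    show "\<Phi> (\<lambda>x. f ((mat 1 + s) *v x)) = 0" if "s \<in> range S" for s
      using that relation by (auto simp: \<Phi>_def P_def)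
    show "\<exists>s\<in>range S. \<exists>c\<in>(\<lambda>A X. A ** X) ` ?H. X = s + c (mat 1)" for X
    proof -
      obtain z where "X - S z \<in> ?H" using spanning unfolding S_def by blast
      then show ?thesis by (intro bexI [of _ "S z"] bexI [of _ "\<lambda>Y. (X - S z) ** Y"]) auto
    qed
  qed auto
  then have "\<forall>v\<in>orbit f. (\<Sum>\<alpha>\<in>box e r. c \<alpha> * (\<Prod>k<e. F k v ^ \<alpha> k)) = 0"
    by (auto simp: orbit_eq \<Phi>_def)
  then have "\<forall>\<alpha>\<in>box e r. c \<alpha> = 0"
    using indep [unfolded alg_independent_on_def, rule_format, of "box e r" c] finite_box
    by (simp add: box_def subset_iff)
  then show False using c by blast
qed


interpretation functional: vector_space_pair "\<lambda>(c::complex) (f :: 'x \<Rightarrow> complex) x. c * f x" "(*) :: complex \<Rightarrow> complex \<Rightarrow> complex"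
  by unfold_locales

lemma dual_functionals:
  fixes T :: "nat \<Rightarrow> 'x \<Rightarrow> complex"
  assumes "\<And>z i. (\<lambda>x. \<Sum>i<D. z i * T i x) = (\<lambda>_. 0) \<Longrightarrow> i < D \<Longrightarrow> z i = 0"
  obtains \<phi> :: "nat \<Rightarrow> ('x \<Rightarrow> complex) \<Rightarrow> complex" where
    "\<And>k u v. \<phi> k (\<lambda>x. u x + v x) = \<phi> k u + \<phi> k v" "\<And>k c u. \<phi> k (\<lambda>x. c * u x) = c * \<phi> k u"
    "\<And>k z. k < D \<Longrightarrow> \<phi> k (\<lambda>x. \<Sum>i<D. z i * T i x) = z k"
proof -
  have app: "(\<Sum>\<alpha>\<in>A. G \<alpha>) x = (\<Sum>\<alpha>\<in>A. G \<alpha> x)" for A and G :: "'i \<Rightarrow> 'x \<Rightarrow> complex" and x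
    by (induction A rule: infinite_finite_induct) auto
  have inj: "inj_on T {..<D}"
  proof (rule inj_onI, rule ccontr)
    fix i j assume ij: "i \<in> {..<D}" "j \<in> {..<D}" "T i = T j" "i \<noteq> j"
    let ?z = "\<lambda>k. if k = i then 1 else if k = j then - 1 else 0 :: complex"
    have "(\<Sum>k<D. ?z k * T k x) = (\<Sum>k\<in>{i, j}. ?z k * T k x)" for x
      using ij by (intro sum.mono_neutral_right) auto
    then have "(\<lambda>x. \<Sum>k<D. ?z k * T k x) = (\<lambda>_. 0)" using ij by (simp add: fun_eq_iff)
    from assms [OF this, of i] ij show False by simp
  qed
  have indep: "fun_space.independent (T ` {..<D})"
  proof (rule fun_space.independent_if_scalars_zero)
    fix u v assume s: "(\<Sum>v\<in>T ` {..<D}. (\<lambda>x. u v * v x)) = 0" and "v \<in> T ` {..<D}"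
    then obtain i where i: "i < D" "v = T i" by auto
    have "(\<lambda>x. \<Sum>i<D. u (T i) * T i x) = (\<lambda>_. 0)"
      using s unfolding fun_eq_iff app by (simp add: sum.reindex [OF inj] fun_eq_iff app)
    from assms [OF this i(1)] show "u v = 0" by (simp add: i)
  qed simp
  have "\<exists>\<psi>. Vector_Spaces.linear (\<lambda>c f x. c * f x) (*) \<psi> \<and> (\<forall>i<D. \<psi> (T i) = (if i = k then 1 else 0))" for k
  proof -
    obtain \<psi> where "Vector_Spaces.linear (\<lambda>c f x. c * f x) (*) \<psi>"
      "\<forall>v\<in>T ` {..<D}. \<psi> v = (if the_inv_into {..<D} T v = k then 1 else 0)"
      using functional.linear_independent_extend [OF indep,
          of "\<lambda>v. if the_inv_into {..<D} T v = k then 1 else 0"] by blast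
    then show ?thesis using the_inv_into_f_f [OF inj] by (intro exI [of _ \<psi>]) auto
  qed
  then obtain \<psi> where lin: "\<And>k. Vector_Spaces.linear (\<lambda>c f x. c * f x) (*) (\<psi> k)"
    and dual: "\<And>k i. i < D \<Longrightarrow> \<psi> k (T i) = (if i = k then 1 else 0)" by metis
  have add: "\<psi> k (\<lambda>x. u x + v x) = \<psi> k u + \<psi> k v" for k u v
    using functional.linear_add [OF lin, of k u v] by (simp add: plus_fun_def)
  have scale: "\<psi> k (\<lambda>x. c * u x) = c * \<psi> k u" for k c u
    by (rule functional.linear_scale [OF lin])
  have "\<psi> k 0 = 0" for k by (rule functional.linear_0 [OF lin])
  then have "\<psi> k (\<lambda>x. \<Sum>i\<in>I. z i * T i x) = (\<Sum>i\<in>I. z i * \<psi> k (T i))" for k z I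
    by (induction I rule: infinite_finite_induct) (simp_all add: add scale zero_fun_def)
  then have "\<psi> k (\<lambda>x. \<Sum>i<D. z i * T i x) = z k" if "k < D" for k z
    using that by (simp add: dual if_distrib [of "\<lambda>y. _ * y"] cong: if_cong)
  with add scale show ?thesis using that by blast
qed

lemma polyfun_on_curve:
  fixes Y :: "nat \<Rightarrow> complex poly"
  assumes "Q \<in> polyfun (\<lambda>(c::complex) (z :: nat \<Rightarrow> complex) i. c * z i)"
  shows "\<exists>q. \<forall>t. Q (\<lambda>i. if i < D then poly (Y i) t else 0) = poly q t"
  using assms
proof induction
  case (const c)
  show ?case by (intro exI [of _ "[:c:]"]) simp
next
  case (linear \<phi>)
  define e where "e i = (\<lambda>j. if j = i then 1 else 0 :: complex)" for i :: nat
  have "\<phi> 0 = 0" using linear(1) [of 0 0] by simp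
  then have "\<phi> (\<Sum>i\<in>I. (\<lambda>j. z i * e i j)) = (\<Sum>i\<in>I. z i * \<phi> (e i))" for z I
    by (induction I rule: infinite_finite_induct) (simp_all add: linear)
  moreover have "(\<Sum>i\<in>I. (\<lambda>j. z i * e i j)) = (\<lambda>i. if i \<in> I then z i else 0)" if "finite I" for z I
    using that by (induction I rule: finite_induct) (auto simp: e_def fun_eq_iff)
  from this [of "{..<D}"] have "(\<Sum>i<D. (\<lambda>j. z i * e i j)) = (\<lambda>i. if i < D then z i else 0)" for z by simp
  ultimately have "\<phi> (\<lambda>i. if i < D then z i else 0) = (\<Sum>i<D. z i * \<phi> (e i))" for z
    by (metis (no_types, lifting))
  then show ?case
    by (intro exI [of _ "\<Sum>i<D. smult (\<phi> (e i)) (Y i)"]) (simp add: poly_sum mult.commute)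
next
  case (add P P')
  then show ?case by (metis poly_add)
next
  case (mult P P')
  then show ?case by (metis poly_mult)
qed

text \<open>Lower bound for the dimension. On a complement of the stabilizer the tangent map \<open>A \<mapsto> A f\<close> is
  injective, so there are linear functionals \<open>\<phi> k\<close> on forms that are dual to its image. A relation \<open>R\<close>
  between them would vanish along the curves \<open>t \<mapsto> \<phi> (f ((mat 1 + t S z) *v x))\<close>, whose velocity at 0 is
  the arbitrary vector \<open>z\<close>. Hence the lowest homogeneous part of \<open>R\<close> at the point \<open>\<phi> f\<close> would vanish, and
  by induction so would all of \<open>R\<close>.\<close>

lemma alg_independent_on_orbit_exists:
  fixes f :: "complex ^ 'm::finite \<Rightarrow> complex"
  assumes f: "f \<in> forms d"
  obtains e F where "\<And>k. k < e \<Longrightarrow> F k \<in> regular_functions (forms d)" "alg_independent_on (orbit f) e F"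
    "e + matrix_space.dim (lie_stabilizer f) = matrix_space.dim (UNIV :: (complex ^ 'm ^ 'm) set)"
proof -
  let ?H = "lie_stabilizer f"
  let ?scl = "\<lambda>(c::complex) (z :: nat \<Rightarrow> complex) i. c * z i"
  note pf = polyfun_form [OF f]
  have subH: "matrix_space.subspace ?H" by (rule subspace_lie_stabilizer [OF pf])
  obtain b D where D: "D + matrix_space.dim ?H = matrix_space.dim (UNIV :: (complex ^ 'm ^ 'm) set)"
    and indep: "\<And>z i. (\<Sum>i<D. mscale (z i) (b i)) \<in> ?H \<Longrightarrow> i < D \<Longrightarrow> z i = 0"
    by (rule complement_basis [OF subH], rule that)
  define S where "S z = (\<Sum>i<D. mscale (z i) (b i))" for z
  define T where "T i x = dird f x (b i *v x)" for i x
  have mv_sum: "(\<Sum>i\<in>I. A i) *v x = (\<Sum>i\<in>I. A i *v x)" for I and A :: "nat \<Rightarrow> complex ^ 'm ^ 'm" and x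
    by (induction I rule: infinite_finite_induct) (simp_all add: matrix_vector_mult_add_rdistrib)
  have T_S: "(\<lambda>x. \<Sum>i<D. z i * T i x) = (\<lambda>x. dird f x (S z *v x))" for z
    by (simp add: S_def T_def mv_sum mscale_matrix_vector dird_sum_right [OF pf] dird_scale [OF pf])
  have T_indep: "z i = 0" if "(\<lambda>x. \<Sum>i<D. z i * T i x) = (\<lambda>_. 0)" "i < D" for z i
    using that indep [of z i] unfolding T_S S_def [symmetric]
    by (simp add: lie_stabilizer_iff [OF pf] fun_eq_iff)
  obtain \<phi> :: "nat \<Rightarrow> (complex ^ 'm \<Rightarrow> complex) \<Rightarrow> complex" where
    \<phi>: "\<And>k u v. \<phi> k (\<lambda>x. u x + v x) = \<phi> k u + \<phi> k v" "\<And>k c u. \<phi> k (\<lambda>x. c * u x) = c * \<phi> k u"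
    and dual: "\<And>k z. k < D \<Longrightarrow> \<phi> k (\<lambda>x. \<Sum>i<D. z i * T i x) = z k"
    by (rule dual_functionals [of T D], erule (1) T_indep, rule that)
  have pull: "(\<lambda>g :: complex ^ 'm ^ 'm. \<phi> k (\<lambda>x. f (g *v x))) \<in> polyfun mscale" for k
    by (rule linear_pullback(1) [OF f]) (rule \<phi>)+
  have "alg_independent_on (orbit f) D \<phi>"
    unfolding alg_independent_on_def
  proof (intro allI impI ballI, elim conjE)
    fix M c \<alpha>
    assume finM: "finite M" and M: "M \<subseteq> {\<alpha>. \<forall>k\<ge>D. \<alpha> k = 0}" and \<alpha>: "\<alpha> \<in> M"
      and relation: "\<forall>v\<in>orbit f. (\<Sum>\<alpha>\<in>M. c \<alpha> * (\<Prod>k<D. \<phi> k v ^ \<alpha> k)) = 0"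
    define R where "R = (\<lambda>z :: nat \<Rightarrow> complex. \<Sum>\<alpha>\<in>M. c \<alpha> * (\<Prod>k<D. z k ^ \<alpha> k))"
    define a where "a = (\<lambda>k. if k < D then \<phi> k f else 0)"
    have "R \<in> polyfun ?scl"
      unfolding R_def by (intro polyfun_sum polyfun_cmult polyfun_prod polyfun_power polyfun.linear) auto
    from polyfun_expansion [OF this, of a] obtain p n where
      p: "\<And>z t. R (a + ?scl t z) = poly (p z) t" and pq: "\<And>l. (\<lambda>z. coeff (p z) l) \<in> polyfun ?scl"
      and deg: "\<And>z. degree (p z) \<le> n" by metis
    define trunc where "trunc z = (\<lambda>i. if i < D then z i else 0 :: complex)" for z
    have zero: "\<forall>z. coeff (p (trunc z)) l = 0" for l
    proof (induction l rule: less_induct)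
      case (less l)
      show ?case
      proof
        fix z
        have curve: "\<exists>P. poly P 0 = z k \<and> (\<forall>t. \<phi> k (\<lambda>x. f ((mat 1 + mscale t (S z)) *v x)) = \<phi> k f + t * poly P t)"
          if k: "k < D" for k
        proof -
          obtain P where P: "\<And>t. \<phi> k (\<lambda>x. f ((mat 1 + mscale t (S z)) *v x)) = poly P t"
            using polyfun_along_line [OF pull [of k], of "mat 1" "S z"] by blast
          have "((\<lambda>t. \<phi> k (\<lambda>x. f ((mat 1 + mscale t (S z)) *v x))) has_field_derivative
              \<phi> k (\<lambda>x. dird f (mat 1 *v x) (S z *v x))) (at 0)"
            by (rule linear_pullback(2) [OF f]) (rule \<phi>)+
          then have "(poly P has_field_derivative z k) (at 0)"
            unfolding P using dual [OF k, of z] T_S [of z] by simp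
          then have "poly (pderiv P) 0 = z k" by (rule DERIV_unique [OF poly_DERIV])
          moreover have "poly P 0 = \<phi> k f" using P [of 0] by simp
          moreover obtain a0 P' where P': "P = pCons a0 P'" by (cases P)
          ultimately show ?thesis
            by (intro exI [of _ P']) (simp add: P P' pderiv_pCons)
        qed
        have "\<exists>Y. \<forall>k\<in>{..<D}. poly (Y k) 0 = z k \<and>
            (\<forall>t. \<phi> k (\<lambda>x. f ((mat 1 + mscale t (S z)) *v x)) = \<phi> k f + t * poly (Y k) t)"
          by (rule bchoice) (use curve in simp)
        then obtain Y where Y0: "\<And>k. k < D \<Longrightarrow> poly (Y k) 0 = z k"
          and Y: "\<And>k t. k < D \<Longrightarrow> \<phi> k (\<lambda>x. f ((mat 1 + mscale t (S z)) *v x)) = \<phi> k f + t * poly (Y k) t"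
          by auto
        have "\<exists>u. \<forall>l t. coeff (p (\<lambda>i. if i < D then poly (Y i) t else 0)) l = poly (u l) t"
          by (rule choice) (use polyfun_on_curve [OF pq] in blast)
        then obtain u where u: "\<And>l t. coeff (p (trunc (\<lambda>i. poly (Y i) t))) l = poly (u l) t"
          unfolding trunc_def by blast
        have det_pf: "(\<lambda>g :: complex ^ 'm ^ 'm. det g) \<in> polyfun mscale"
          unfolding det_def by (intro polyfun_sum polyfun.mult polyfun_prod polyfun_entry polyfun.const)
        obtain \<delta> where \<delta>: "\<And>t. det (mat 1 + mscale t (S z)) = poly \<delta> t"
          using polyfun_along_line [OF det_pf, of "mat 1" "S z"] by blast
        have "poly \<delta> 0 = 1" using \<delta> [of 0] by simp
        then have \<delta>0: "\<delta> \<noteq> 0" by auto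
        \<comment> \<open>The relation holds where \<open>mat 1 + t S z\<close> is invertible, that is, off the zeros of \<open>\<delta>\<close>.\<close>
        let ?U = "\<Sum>l\<le>n. monom 1 l * u l"
        have "poly (\<delta> * ?U) t = 0" for t
        proof (cases "poly \<delta> t = 0")
          case False
          then have "invertible (mat 1 + mscale t (S z))" by (simp add: invertible_det_nz \<delta>)
          then have "R (trunc (\<lambda>k. \<phi> k (\<lambda>x. f ((mat 1 + mscale t (S z)) *v x)))) = 0"
            using relation by (auto simp: R_def trunc_def orbit_eq)
          also have "trunc (\<lambda>k. \<phi> k (\<lambda>x. f ((mat 1 + mscale t (S z)) *v x))) = a + ?scl t (trunc (\<lambda>i. poly (Y i) t))"
            by (auto simp: trunc_def a_def Y)
          finally have "poly (p (trunc (\<lambda>i. poly (Y i) t))) t = 0" by (simp only: p)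
          also have "poly (p (trunc (\<lambda>i. poly (Y i) t))) t = (\<Sum>l\<le>n. poly (u l) t * t ^ l)"
            unfolding u [symmetric] by (subst poly_altdef, rule sum.mono_neutral_left)
              (use deg in \<open>auto simp: coeff_eq_0\<close>)
          finally show ?thesis by (simp add: poly_sum poly_monom mult.commute)
        qed simp
        then have "\<delta> * ?U = 0" by (intro poly_eq_0_if_off_0)
        then have "?U = 0" using \<delta>0 by simp
        have u_less: "u j = 0" if "j < l" for j
          using less [OF that] u [of _ j] by (intro poly_eq_0_if_off_0) simp
        show "coeff (p (trunc z)) l = 0"
        proof (cases "l \<le> n")
          case True
          have "0 = coeff ?U l" by (simp only: \<open>?U = 0\<close> coeff_0)
          also have "\<dots> = (\<Sum>j\<le>n. if j = l then coeff (u l) 0 else 0)"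
            unfolding coeff_sum
          proof (rule sum.cong [OF refl])
            fix j
            show "coeff (monom 1 j * u j) l = (if j = l then coeff (u l) 0 else 0)"
              using u_less [of j] by (cases j l rule: linorder_cases) (auto simp: coeff_monom_mult)
          qed
          also have "\<dots> = poly (u l) 0" using True by (simp add: poly_0_coeff_0)
          also have "\<dots> = coeff (p (trunc (\<lambda>i. poly (Y i) 0))) l" by (simp add: u)
          also have "trunc (\<lambda>i. poly (Y i) 0) = trunc z" by (auto simp: trunc_def Y0)
          finally show ?thesis by simp
        next
          case False
          then show ?thesis using deg [of "trunc z"] by (intro coeff_eq_0) simp
        qed
      qed
    qed
    have "R z = 0" for z
    proof -
      have "R z = R (a + ?scl 1 (trunc (\<lambda>i. z i - a i)))"
        unfolding R_def by (intro sum.cong refl arg_cong2 [where f = "(*)"] prod.cong) (auto simp: trunc_def)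
      also have "\<dots> = poly (p (trunc (\<lambda>i. z i - a i))) 1" by (rule p)
      also have "p (trunc (\<lambda>i. z i - a i)) = 0" using zero by (intro poly_eqI) simp
      finally show ?thesis by simp
    qed
    then show "c \<alpha> = 0"
      unfolding R_def
      by (rule polynomial_zero_imp_coefficients_zero [OF _ finM _ _ \<alpha>, of "{..<D}", rotated 2])
        (use M in auto)
  qed
  moreover have "\<phi> k \<in> regular_functions (forms d)" for k
    by (rule regular_functions.linear) (rule \<phi>)+
  ultimately show ?thesis using that D by blast
qed

text \<open>The orbit is the quotient of the general linear group by the stabilizer; in characteristic 0 the
  dimension of the stabilizer can be read off from its Lie algebra.\<close>

theorem variety_dim_orbit_closure:
  fixes f :: "complex ^ 'm::finite \<Rightarrow> complex"
  assumes f: "f \<in> forms d"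
  shows "variety_dim (forms d) (zariski_closure (forms d) (orbit f)) + matrix_space.dim (lie_stabilizer f)
    = matrix_space.dim (UNIV :: (complex ^ 'm ^ 'm) set)"
proof -
  let ?N = "matrix_space.dim (UNIV :: (complex ^ 'm ^ 'm) set)" and ?h = "matrix_space.dim (lie_stabilizer f)"
  let ?E = "{e. \<exists>F. (\<forall>k<e. F k \<in> regular_functions (forms d)) \<and>
      alg_independent_on (zariski_closure (forms d) (orbit f)) e F}"
  obtain e F where e: "\<And>k. k < e \<Longrightarrow> F k \<in> regular_functions (forms d)" "alg_independent_on (orbit f) e F"
    "e + ?h = ?N"
    by (rule alg_independent_on_orbit_exists [OF f], rule that)
  have bound: "e' + ?h \<le> ?N" if "e' \<in> ?E" for e'
  proof -
    from that obtain F where F: "\<forall>k<e'. F k \<in> regular_functions (forms d)"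
      "alg_independent_on (zariski_closure (forms d) (orbit f)) e' F" by blast
    then have "alg_independent_on (orbit f) e' F"
      using alg_independent_on_zariski_closure [OF orbit_subset_forms [OF f], of e' F] by simp
    with F(1) show ?thesis using alg_independent_on_orbit_bound [OF f, of e' F] by blast
  qed
  have "Max ?E = e"
  proof (rule Max_eqI)
    have "?E \<subseteq> {..?N}" by (rule subsetI, drule bound) simp
    then show "finite ?E" by (rule finite_subset) simp
    show "e' \<le> e" if "e' \<in> ?E" for e' using bound [OF that] e(3) by simp
    show "e \<in> ?E" using e(1,2) alg_independent_on_zariski_closure [OF orbit_subset_forms [OF f]] by auto
  qed
  then show ?thesis using e(3) by (simp add: variety_dim_def)
qed

section \<open>Weights and diagonal matrices\<close>

lemma matrix_add_rdistrib: "(A + B) ** C = A ** C + B ** C"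
  for A B :: "'a::semiring_1 ^ 'm::finite ^ 'k"
  by (simp add: vec_eq_iff matrix_matrix_mult_def distrib_right sum.distrib)

text \<open>Multiplication by a high power of \<open>s\<close> turns the Laurent polynomial into a polynomial with infinitely
  many zeros.\<close>

lemma laurent_coefficient_zero:
  fixes a :: "'j \<Rightarrow> complex" and e :: "'j \<Rightarrow> int"
  assumes "finite J" "\<And>s. s \<noteq> 0 \<Longrightarrow> (\<Sum>j\<in>J. s powi e j * a j) = 0"
  shows "(\<Sum>j | j \<in> J \<and> e j = m. a j) = 0"
proof -
  define K where "K = \<bar>m\<bar> + (\<Sum>j\<in>J. \<bar>e j\<bar>)"
  have "0 \<le> (\<Sum>j\<in>J. \<bar>e j\<bar>)" by (rule sum_nonneg) simp
  then have Km: "m + K \<ge> 0" unfolding K_def by linarith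
  have Ke: "e j + K \<ge> 0" if "j \<in> J" for j
  proof -
    have "\<bar>e j\<bar> \<le> (\<Sum>j\<in>J. \<bar>e j\<bar>)" using that assms(1) by (intro member_le_sum) auto
    then show ?thesis unfolding K_def by linarith
  qed
  define p where "p = (\<Sum>j\<in>J. monom (a j) (nat (e j + K)))"
  have "p = 0"
  proof (rule poly_eq_0_if_off_0)
    fix s :: complex assume s: "s \<noteq> 0"
    have "poly p s = (\<Sum>j\<in>J. s powi K * (s powi e j * a j))"
      unfolding p_def poly_sum poly_monom
    proof (rule sum.cong [OF refl])
      fix j assume "j \<in> J"
      then have "s ^ nat (e j + K) = s powi (e j + K)" using Ke by (simp add: power_int_def)
      also have "\<dots> = s powi e j * s powi K" using s by (simp add: power_int_add)
      finally show "a j * s ^ nat (e j + K) = s powi K * (s powi e j * a j)" by simp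
    qed
    also have "\<dots> = 0" using assms(2) [OF s] by (simp flip: sum_distrib_left)
    finally show "poly p s = 0" .
  qed
  then have "0 = coeff p (nat (m + K))" by simp
  also have "\<dots> = (\<Sum>j\<in>J. if e j = m then a j else 0)"
    unfolding p_def coeff_sum coeff_monom
    by (intro sum.cong refl if_cong) (use Ke Km in \<open>auto simp: eq_nat_nat_iff\<close>)
  also have "\<dots> = (\<Sum>j | j \<in> J \<and> e j = m. a j)"
    using assms(1) by (simp add: sum.inter_filter)
  finally show ?thesis by simp
qed

definition diag :: "('m \<Rightarrow> complex) \<Rightarrow> complex ^ 'm ^ 'm" where
  "diag t = (\<chi> i j. if i = j then t i else 0)"

lemma diag_nth [simp]: "diag t $ i $ j = (if i = j then t i else 0)"
  by (simp add: diag_def)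

lemma diag_vector [simp]: "(diag t *v x) $ i = t i * x $ i" for t :: "'m::finite \<Rightarrow> complex"
  by (simp add: matrix_vector_mult_def if_distrib [of "\<lambda>y. y * _"] cong: if_cong)

lemma diag_mult_left [simp]: "(diag t ** A) $ i $ j = t i * A $ i $ j" for t :: "'m::finite \<Rightarrow> complex"
  by (simp add: matrix_matrix_mult_def if_distrib [of "\<lambda>y. y * _"] cong: if_cong)

lemma diag_mult_right [simp]: "(A ** diag t) $ i $ j = A $ i $ j * t j" for t :: "'m::finite \<Rightarrow> complex"
  by (simp add: matrix_matrix_mult_def if_distrib [of "\<lambda>y. _ * y"] cong: if_cong)

lemma diag_diag: "diag s ** diag t = diag (\<lambda>i. s i * t i)" for t :: "'m::finite \<Rightarrow> complex"
  by (simp add: matrix_eq_iff)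

definition weight :: "('m::finite \<Rightarrow> 'a::comm_ring_1) \<Rightarrow> ('m \<Rightarrow> nat) \<Rightarrow> 'a" where
  "weight t \<alpha> = (\<Sum>i\<in>UNIV. of_nat (\<alpha> i) * t i)"

text \<open>The exponent of the monomial \<open>x\<^sub>j \<partial>/\<partial>x\<^sub>i x\<^sup>\<alpha>\<close>; it is meaningful only if \<open>\<alpha> i > 0\<close>.\<close>

definition shift_exponent :: "'m \<Rightarrow> 'm \<Rightarrow> ('m \<Rightarrow> nat) \<Rightarrow> 'm \<Rightarrow> nat" where
  "shift_exponent i j \<alpha> = (let \<beta> = \<alpha>(i := \<alpha> i - 1) in \<beta>(j := \<beta> j + 1))"

lemma weight_upd: "weight t (\<alpha>(i := k)) = weight t \<alpha> + (of_nat k - of_nat (\<alpha> i)) * t i"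
  unfolding weight_def by (subst (1 2) sum.remove [of _ i]) (auto simp: algebra_simps intro!: sum.cong)

lemma weight_shift:
  "\<alpha> i > 0 \<Longrightarrow> weight t (shift_exponent i j \<alpha>) = weight t \<alpha> - t i + t j"
  by (simp add: shift_exponent_def Let_def weight_upd of_nat_diff algebra_simps)

lemma weight_1: "weight (\<lambda>_. 1) \<alpha> = of_nat (\<Sum>i\<in>UNIV. \<alpha> i)"
  by (simp add: weight_def)

lemma sum_shift_exponent:
  "\<alpha> i > 0 \<Longrightarrow> (\<Sum>k\<in>UNIV. shift_exponent i j \<alpha> k) = (\<Sum>k\<in>UNIV. \<alpha> k)"
  for \<alpha> :: "'m::finite \<Rightarrow> nat"
  using weight_shift [of \<alpha> i "\<lambda>_. 1 :: int" j] by (simp add: weight_1 flip: of_nat_sum)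

lemma dird_coordinate [simp]: "dird (\<lambda>x. x $ i) x v = v $ i"
  by (simp add: dird_linear)

lemma dird_power:
  assumes "f \<in> polyfun (*s)"
  shows "dird (\<lambda>x. f x ^ k) x v = of_nat k * f x ^ (k - 1) * dird f x v"
proof (induction k)
  case (Suc k)
  have "dird (\<lambda>x. f x * f x ^ k) x v = dird f x v * f x ^ k + of_nat k * f x ^ (k - 1) * dird f x v * f x"
    by (simp add: dird_mult assms polyfun_power Suc)
  then show ?case by (cases k) (simp_all add: algebra_simps)
qed simp

lemma dird_prod:
  assumes "finite I" "\<And>i. i \<in> I \<Longrightarrow> f i \<in> polyfun (*s)"
  shows "dird (\<lambda>x. \<Prod>i\<in>I. f i x) x v = (\<Sum>i\<in>I. dird (f i) x v * (\<Prod>j\<in>I - {i}. f j x))"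
  using assms
proof (induction I rule: finite_induct)
  case (insert i I)
  have "(\<Prod>j\<in>insert i I - {k}. f j x) = f i x * (\<Prod>j\<in>I - {k}. f j x)" if "k \<in> I" for k
  proof -
    have "insert i I - {k} = insert i (I - {k})" using insert that by auto
    then show ?thesis using insert by simp
  qed
  then have "(\<Sum>k\<in>I. dird (f k) x v * (\<Prod>j\<in>insert i I - {k}. f j x))
      = f i x * (\<Sum>k\<in>I. dird (f k) x v * (\<Prod>j\<in>I - {k}. f j x))"
    by (simp add: sum_distrib_left mult.left_commute)
  then show ?case using insert by (simp add: dird_mult polyfun_prod mult.commute)
qed simp

lemma dird_monomial:
  "dird (monomial \<alpha>) x v = (\<Sum>i\<in>UNIV. of_nat (\<alpha> i) * v $ i * monomial (\<alpha>(i := \<alpha> i - 1)) x)"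
proof -
  have "dird (monomial \<alpha>) x v = (\<Sum>i\<in>UNIV. of_nat (\<alpha> i) * x $ i ^ (\<alpha> i - 1) * v $ i * (\<Prod>j\<in>UNIV - {i}. x $ j ^ \<alpha> j))"
    unfolding monomial_def
    by (subst dird_prod) (auto simp: polyfun_power polyfun_coordinate dird_power)
  also have "\<dots> = (\<Sum>i\<in>UNIV. of_nat (\<alpha> i) * v $ i * monomial (\<alpha>(i := \<alpha> i - 1)) x)"
  proof (rule sum.cong [OF refl])
    fix i
    have "monomial (\<alpha>(i := \<alpha> i - 1)) x = x $ i ^ (\<alpha> i - 1) * (\<Prod>j\<in>UNIV - {i}. x $ j ^ \<alpha> j)"
      unfolding monomial_def by (subst prod.remove [of _ i]) (auto intro!: prod.cong)
    then show "of_nat (\<alpha> i) * x $ i ^ (\<alpha> i - 1) * v $ i * (\<Prod>j\<in>UNIV - {i}. x $ j ^ \<alpha> j)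
        = of_nat (\<alpha> i) * v $ i * monomial (\<alpha>(i := \<alpha> i - 1)) x" by simp
  qed
  finally show ?thesis .
qed

lemma monomial_Suc: "x $ j * monomial \<alpha> x = monomial (\<alpha>(j := \<alpha> j + 1)) x"
  unfolding monomial_def by (subst (1 2) prod.remove [of _ j]) (auto intro!: prod.cong)

lemma dird_form_of_matrix:
  "dird (form_of d c) x (A *v x) = (\<Sum>(\<alpha>, i, j) \<in> {(\<alpha>, i, j). \<alpha> \<in> exponents d \<and> \<alpha> i > 0}.
     c \<alpha> * of_nat (\<alpha> i) * A $ i $ j * monomial (shift_exponent i j \<alpha>) x)"
proof -
  have "dird (form_of d c) x (A *v x) = (\<Sum>\<alpha>\<in>exponents d. c \<alpha> * dird (monomial \<alpha>) x (A *v x))"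
    unfolding form_of_def by (simp add: dird_sum dird_cmult polyfun_cmult polyfun_monomial)
  also have "\<dots> = (\<Sum>\<alpha>\<in>exponents d. \<Sum>i\<in>UNIV. \<Sum>j\<in>UNIV.
      c \<alpha> * of_nat (\<alpha> i) * A $ i $ j * monomial (shift_exponent i j \<alpha>) x)"
  proof (rule sum.cong [OF refl])
    fix \<alpha> :: "'a \<Rightarrow> nat"
    have "x $ j * monomial (\<alpha>(i := \<alpha> i - 1)) x = monomial (shift_exponent i j \<alpha>) x" for i j
      by (simp add: monomial_Suc shift_exponent_def Let_def)
    then have "c \<alpha> * of_nat (\<alpha> i) * A $ i $ j * monomial (shift_exponent i j \<alpha>) x
        = c \<alpha> * (of_nat (\<alpha> i) * (A $ i $ j * x $ j) * monomial (\<alpha>(i := \<alpha> i - 1)) x)" for i j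
      by (metis (no_types, lifting) mult.assoc)
    then show "c \<alpha> * dird (monomial \<alpha>) x (A *v x) = (\<Sum>i\<in>UNIV. \<Sum>j\<in>UNIV.
        c \<alpha> * of_nat (\<alpha> i) * A $ i $ j * monomial (shift_exponent i j \<alpha>) x)"
      by (simp only: dird_monomial matrix_vector_mult_def vec_lambda_beta sum_distrib_left sum_distrib_right)
  qed
  also have "\<dots> = (\<Sum>(\<alpha>, i, j) \<in> exponents d \<times> UNIV \<times> UNIV.
      c \<alpha> * of_nat (\<alpha> i) * A $ i $ j * monomial (shift_exponent i j \<alpha>) x)"
    by (simp add: sum.cartesian_product)
  also have "\<dots> = (\<Sum>(\<alpha>, i, j) \<in> {(\<alpha>, i, j). \<alpha> \<in> exponents d \<and> \<alpha> i > 0}.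
     c \<alpha> * of_nat (\<alpha> i) * A $ i $ j * monomial (shift_exponent i j \<alpha>) x)"
    by (intro sum.mono_neutral_right) (auto intro: finite_cartesian_product finite_exponents)
  finally show ?thesis .
qed

lemma dird_form_of_diag: "dird (form_of d c) x (diag t *v x) = form_of d (\<lambda>\<alpha>. c \<alpha> * weight t \<alpha>) x"
proof -
  have "dird (monomial \<alpha>) x (diag t *v x) = weight t \<alpha> * monomial \<alpha> x" for \<alpha>
  proof -
    have "of_nat (\<alpha> i) * (diag t *v x) $ i * monomial (\<alpha>(i := \<alpha> i - 1)) x = of_nat (\<alpha> i) * t i * monomial \<alpha> x" for i
      using monomial_Suc [of x i "\<alpha>(i := \<alpha> i - 1)"] by (cases "\<alpha> i = 0") (auto simp: mult_ac fun_upd_idem)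
    then show ?thesis unfolding dird_monomial weight_def sum_distrib_right by (intro sum.cong refl)
  qed
  then show ?thesis
    unfolding form_of_def by (simp add: dird_sum dird_cmult polyfun_cmult polyfun_monomial mult_ac)
qed

lemma diag_stabilizes_iff:
  "diag t \<in> lie_stabilizer (form_of d c) \<longleftrightarrow> (\<forall>\<alpha>\<in>exponents d. c \<alpha> \<noteq> 0 \<longrightarrow> weight t \<alpha> = 0)"
proof -
  have "diag t \<in> lie_stabilizer (form_of d c) \<longleftrightarrow> form_of d (\<lambda>\<alpha>. c \<alpha> * weight t \<alpha>) = (\<lambda>_. 0)"
    by (simp add: lie_stabilizer_iff polyfun_form_of dird_form_of_diag fun_eq_iff)
  then show ?thesis by (auto simp: form_of_eq_0_iff)
qed

text \<open>The semisimple part of an element of the stabilizer lies in the stabilizer, for an element whose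
  Jordan decomposition \<open>diag t + n\<close> is visible. Otherwise some monomial of the form has nonzero
  weight under \<open>t\<close>; take one, \<open>\<beta>\<close>, for which the weight under \<open>v\<close> is maximal. The operator \<open>n\<close>
  preserves the weight under \<open>t\<close> and lowers the weight under \<open>v\<close>, so it reaches \<open>\<beta>\<close> only from exponents
  whose coefficient is zero. Hence the coefficient of the derivative at \<open>\<beta>\<close> is that of \<open>diag t\<close>, which is
  nonzero.\<close>

lemma diagonal_part_stabilizes:
  fixes v :: "'m::finite \<Rightarrow> int" and n :: "complex ^ 'm ^ 'm"
  assumes stab: "diag t + n \<in> lie_stabilizer (form_of d c)"
    and n: "\<And>i j. n $ i $ j \<noteq> 0 \<Longrightarrow> v i > v j \<and> t i = t j"
  shows "diag t \<in> lie_stabilizer (form_of d c)"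
proof (rule ccontr)
  assume contr: "\<not> ?thesis"
  define B where "B = {\<alpha>\<in>exponents d. c \<alpha> \<noteq> 0 \<and> weight t \<alpha> \<noteq> 0}"
  have "finite B" unfolding B_def by (rule finite_subset [OF _ finite_exponents [of d]]) auto
  moreover have "B \<noteq> {}" using contr by (auto simp: B_def diag_stabilizes_iff)
  ultimately obtain \<beta> where \<beta>: "\<beta> \<in> B" and "weight v \<beta> = Max (weight v ` B)"
    using Max_in [of "weight v ` B"] by (metis finite_imageI image_iff image_is_empty)
  have max: "weight v \<alpha> \<le> weight v \<beta>" if "\<alpha> \<in> B" for \<alpha>
    using that \<open>finite B\<close> \<open>weight v \<beta> = Max (weight v ` B)\<close> by simp
  let ?T = "{(\<alpha> :: 'm \<Rightarrow> nat, i, j :: 'm). \<alpha> \<in> exponents d \<and> \<alpha> i > 0}"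
  let ?h = "\<lambda>(\<alpha>, i, j). c \<alpha> * of_nat (\<alpha> i) * (diag t + n) $ i $ j"
  let ?g = "\<lambda>(\<alpha>, i :: 'm, j). shift_exponent i j \<alpha>"
  have finT: "finite ?T"
  proof (rule finite_subset)
    show "?T \<subseteq> exponents d \<times> (UNIV :: ('m \<times> 'm) set)" by auto
    show "finite (exponents d \<times> (UNIV :: ('m \<times> 'm) set))"
      by (rule finite_cartesian_product [OF finite_exponents finite])
  qed
  have "(\<Sum>\<gamma>\<in>exponents d. (\<Sum>\<tau> | \<tau> \<in> ?T \<and> ?g \<tau> = \<gamma>. ?h \<tau>) * monomial \<gamma> x) = 0" for x
  proof -
    have "0 = (\<Sum>\<tau>\<in>?T. ?h \<tau> * monomial (?g \<tau>) x)"
      using stab dird_form_of_matrix [of d c x "diag t + n"]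
      by (simp add: lie_stabilizer_iff polyfun_form_of split_beta)
    also have "\<dots> = (\<Sum>\<gamma>\<in>exponents d. \<Sum>\<tau> | \<tau> \<in> ?T \<and> ?g \<tau> = \<gamma>. ?h \<tau> * monomial (?g \<tau>) x)"
      using finT by (intro sum.group [symmetric] finite_exponents)
        (auto simp: sum_shift_exponent)
    also have "\<dots> = (\<Sum>\<gamma>\<in>exponents d. (\<Sum>\<tau> | \<tau> \<in> ?T \<and> ?g \<tau> = \<gamma>. ?h \<tau>) * monomial \<gamma> x)"
      unfolding sum_distrib_right by (intro sum.cong refl) auto
    finally show ?thesis by simp
  qed
  then have "(\<Sum>\<tau> | \<tau> \<in> ?T \<and> ?g \<tau> = \<beta>. ?h \<tau>) = 0"
    using form_coefficients_unique [of "exponents d" "\<lambda>\<gamma>. \<Sum>\<tau> | \<tau> \<in> ?T \<and> ?g \<tau> = \<gamma>. ?h \<tau>" \<beta>,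
        OF finite_exponents] \<beta>
    unfolding B_def by blast
  also have "(\<Sum>\<tau> | \<tau> \<in> ?T \<and> ?g \<tau> = \<beta>. ?h \<tau>) = (\<Sum>\<tau>\<in>(\<lambda>i. (\<beta>, i, i)) ` {i. \<beta> i > 0}. ?h \<tau>)"
  proof (rule sum.mono_neutral_right)
    show "finite {\<tau> \<in> ?T. ?g \<tau> = \<beta>}" using finT by simp
    show "(\<lambda>i. (\<beta>, i, i)) ` {i. \<beta> i > 0} \<subseteq> {\<tau> \<in> ?T. ?g \<tau> = \<beta>}"
      using \<beta> by (auto simp: B_def shift_exponent_def)
    show "\<forall>\<tau>\<in>{\<tau> \<in> ?T. ?g \<tau> = \<beta>} - (\<lambda>i. (\<beta>, i, i)) ` {i. \<beta> i > 0}. ?h \<tau> = 0"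
    proof
      fix \<tau> assume \<tau>: "\<tau> \<in> {\<tau> \<in> ?T. ?g \<tau> = \<beta>} - (\<lambda>i. (\<beta>, i, i)) ` {i. \<beta> i > 0}"
      obtain \<alpha> i j where \<tau>_eq: "\<tau> = (\<alpha>, i, j)" by (cases \<tau>) auto
      have a: "\<alpha> \<in> exponents d" "\<alpha> i > 0" "shift_exponent i j \<alpha> = \<beta>" using \<tau> by (auto simp: \<tau>_eq)
      have ij: "i \<noteq> j"
      proof
        assume "i = j"
        then have "\<alpha> = \<beta>" using a by (simp add: shift_exponent_def)
        then show False using \<tau> a \<open>i = j\<close> by (auto simp: \<tau>_eq)
      qed
      show "?h \<tau> = 0"
      proof (rule ccontr)
        assume "?h \<tau> \<noteq> 0"
        then have "c \<alpha> \<noteq> 0" "n $ i $ j \<noteq> 0" using ij by (auto simp: \<tau>_eq)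
        then have v: "v i > v j" and t: "t i = t j" using n by auto
        have "weight t \<alpha> = weight t \<beta>" using weight_shift [of \<alpha> i t j] a t by simp
        then have "\<alpha> \<in> B" using \<open>c \<alpha> \<noteq> 0\<close> a \<beta> by (simp add: B_def)
        moreover have "weight v \<beta> < weight v \<alpha>" using weight_shift [of \<alpha> i v j] a v by simp
        ultimately show False using max by force
      qed
    qed
  qed
  also have "\<dots> = (\<Sum>i | \<beta> i > 0. c \<beta> * of_nat (\<beta> i) * t i)"
  proof -
    have "n $ i $ i = 0" for i using n [of i i] by auto
    then show ?thesis by (subst sum.reindex) (auto simp: inj_on_def intro!: sum.cong)
  qed
  also have "\<dots> = (\<Sum>i\<in>UNIV. c \<beta> * of_nat (\<beta> i) * t i)"
    by (rule sum.mono_neutral_left) auto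
  also have "\<dots> = c \<beta> * weight t \<beta>" by (simp add: weight_def sum_distrib_left mult.assoc)
  finally show False using \<beta> by (simp add: B_def)
qed

section \<open>Splitting off the nilpotent part\<close>

lemma unipotent_invertible:
  fixes v :: "'m::finite \<Rightarrow> int" and x :: "complex ^ 'm ^ 'm"
  assumes x: "\<And>i j. x $ i $ j \<noteq> 0 \<Longrightarrow> v i > v j"
  shows "invertible (mat 1 + x)"
proof -
  have "y = 0" if y: "(mat 1 + x) *v y = 0" for y
  proof -
    have "y $ i = 0" for i
    proof (induction "nat (v i - Min (range v))" arbitrary: i rule: less_induct)
      case less
      have "(x *v y) $ i = 0"
        unfolding matrix_vector_mult_def vec_lambda_beta
      proof (intro sum.neutral ballI)
        fix j
        show "x $ i $ j * y $ j = 0"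
        proof (cases "x $ i $ j = 0")
          case False
          then have "v i > v j" by (rule x)
          moreover have "v j \<ge> Min (range v)" by simp
          ultimately have "y $ j = 0" by (intro less) linarith
          then show ?thesis by simp
        qed simp
      qed
      moreover have "y $ i + (x *v y) $ i = 0"
        using arg_cong [OF y, of "\<lambda>z. z $ i"] by (simp add: matrix_vector_mult_add_rdistrib)
      ultimately show ?case by simp
    qed
    then show ?thesis by (simp add: vec_eq_iff)
  qed
  then show ?thesis
    by (simp add: invertible_left_inverse matrix_left_invertible_ker)
qed

text \<open>Entries of \<open>n\<close> between different eigenvalues of \<open>diag t\<close> are removed degree by degree: conjugation with
  \<open>mat 1 + x\<close>, where \<open>x\<close> has degree \<open>p\<close> for \<open>v\<close>, changes the part of degree \<open>p\<close> by the commutator of \<open>x\<close> with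
  \<open>diag t\<close> and otherwise only parts of higher degree.\<close>

lemma conjugate_to_commuting_nilpotent:
  fixes v :: "'m::finite \<Rightarrow> int" and n :: "complex ^ 'm ^ 'm"
  assumes n: "\<And>i j. n $ i $ j \<noteq> 0 \<Longrightarrow> v i > v j"
  obtains u u' n' where "u ** u' = mat 1" "u ** (diag t + n) ** u' = diag t + n'"
    "\<And>i j. n' $ i $ j \<noteq> 0 \<Longrightarrow> v i > v j \<and> t i = t j"
proof -
  have "\<exists>u u' n'. u ** u' = mat 1 \<and> u ** (diag t + n) ** u' = diag t + n' \<and>
      (\<forall>i j. n' $ i $ j \<noteq> 0 \<longrightarrow> v i > v j \<and> (t i = t j \<or> v i - v j > int p))" for p
  proof (induction p)
    case 0
    show ?case by (intro exI [of _ "mat 1"] exI [of _ n]) (use n in auto)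
  next
    case (Suc p)
    then obtain u u' n1 where u: "u ** u' = mat 1" and eq: "u ** (diag t + n) ** u' = diag t + n1"
      and n1: "\<And>i j. n1 $ i $ j \<noteq> 0 \<Longrightarrow> v i > v j \<and> (t i = t j \<or> v i - v j > int p)" by blast
    \<comment> \<open>The commutator of \<open>x\<close> with \<open>diag t\<close> cancels the entries of \<open>n1\<close> of degree \<open>p + 1\<close> between
      different eigenvalues.\<close>
    define x :: "complex ^ 'm ^ 'm" where
      "x = (\<chi> i j. if v i - v j = int (Suc p) \<and> t i \<noteq> t j then n1 $ i $ j / (t i - t j) else 0)"
    have x: "v i = v j + int (Suc p)" if "x $ i $ j \<noteq> 0" for i j
      using that by (auto simp: x_def split: if_splits)
    then have "invertible (mat 1 + x)" by (intro unipotent_invertible [of x v]) force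
    then obtain y where y: "(mat 1 + x) ** y = mat 1" "y ** (mat 1 + x) = mat 1" by (auto simp: invertible_def)
    define n2 where "n2 = (mat 1 + x) ** (diag t + n1) ** y - diag t"
    have "(diag t + n2) ** (mat 1 + x) = (mat 1 + x) ** (diag t + n1) ** (y ** (mat 1 + x))"
      by (simp add: n2_def matrix_mul_assoc)
    also have "\<dots> = (mat 1 + x) ** (diag t + n1)" by (simp only: y matrix_mul_rid)
    finally have rec: "n2 + diag t ** x + n2 ** x = n1 + x ** diag t + x ** n1"
      by (simp add: matrix_add_ldistrib matrix_add_rdistrib algebra_simps)
    define m where "m = n1 + x ** diag t - diag t ** x + x ** n1"
    have m: "v i > v j \<and> (t i = t j \<or> v i - v j > int (Suc p))" if nz: "m $ i $ j \<noteq> 0" for i j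
    proof (cases "(x ** n1) $ i $ j = 0")
      case True
      then have "n1 $ i $ j + x $ i $ j * (t j - t i) \<noteq> 0"
        using nz by (simp add: m_def algebra_simps)
      then show ?thesis using n1 [of i j] by (auto simp: x_def field_simps split: if_splits)
    next
      case False
      then obtain l where l: "x $ i $ l \<noteq> 0" "n1 $ l $ j \<noteq> 0"
        unfolding matrix_matrix_mult_def by (auto elim!: sum.not_neutral_contains_not_neutral)
      then show ?thesis using x [of i l] n1 [of l j] by auto
    qed
    have n2: "v i > v j \<and> (t i = t j \<or> v i - v j > int (Suc p))" if "n2 $ i $ j \<noteq> 0" for i j
      using that
    proof (induction "nat (Max (range v) - v j)" arbitrary: j rule: less_induct)
      case less
      have n2_eq: "n2 = m - n2 ** x" using rec by (simp add: m_def algebra_simps)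
      show ?case
      proof (cases "m $ i $ j = 0")
        case True
        then have "(n2 ** x) $ i $ j \<noteq> 0"
          using less.prems arg_cong [OF n2_eq, of "\<lambda>A. A $ i $ j"] by auto
        then obtain l where l: "n2 $ i $ l \<noteq> 0" "x $ l $ j \<noteq> 0"
          unfolding matrix_matrix_mult_def by (auto elim!: sum.not_neutral_contains_not_neutral)
        have "v l \<le> Max (range v)" by simp
        with x [OF l(2)] have "nat (Max (range v) - v l) < nat (Max (range v) - v j)" by linarith
        from less.hyps [OF this l(1)] show ?thesis using x [OF l(2)] by auto
      next
        case False
        then show ?thesis by (rule m)
      qed
    qed
    have "((mat 1 + x) ** u) ** (u' ** y) = (mat 1 + x) ** (u ** u') ** y" by (simp add: matrix_mul_assoc)
    then have 1: "((mat 1 + x) ** u) ** (u' ** y) = mat 1" by (simp add: u y)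
    have "((mat 1 + x) ** u) ** (diag t + n) ** (u' ** y) = (mat 1 + x) ** (u ** (diag t + n) ** u') ** y"
      by (simp add: matrix_mul_assoc)
    also have "\<dots> = diag t + n2" by (simp add: eq n2_def)
    finally show ?case using 1 n2 by blast
  qed
  from this [of "nat (Max (range v) - Min (range v))"] obtain u u' n'
    where *: "u ** u' = mat 1" "u ** (diag t + n) ** u' = diag t + n'"
      "\<And>i j. n' $ i $ j \<noteq> 0 \<Longrightarrow> v i > v j \<and> (t i = t j \<or> v i - v j > int (nat (Max (range v) - Min (range v))))"
    by blast
  have "v i > v j \<and> t i = t j" if "n' $ i $ j \<noteq> 0" for i j
  proof -
    have "v i \<le> Max (range v)" "Min (range v) \<le> v j" by simp_all
    then have "\<not> v i - v j > int (nat (Max (range v) - Min (range v)))" by linarith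
    then show ?thesis using *(3) [OF that] by blast
  qed
  with *(1,2) show ?thesis by (rule that)
qed

text \<open>Whatever commutes with a matrix commutes with its semisimple part. An entry of \<open>B\<close> between different
  eigenvalues with \<open>v i - v j\<close> minimal cannot be compensated by the nilpotent part.\<close>

lemma commutes_with_diagonal_part:
  fixes v :: "'m::finite \<Rightarrow> int" and n B :: "complex ^ 'm ^ 'm"
  assumes n: "\<And>i j. n $ i $ j \<noteq> 0 \<Longrightarrow> v i > v j \<and> t i = t j"
    and comm: "(diag t + n) ** B = B ** (diag t + n)"
  shows "diag t ** B = B ** diag t"
proof -
  have "B $ i $ j = 0" if "t i \<noteq> t j" for i j
    using that
  proof (induction "nat (v i - v j + (Max (range v) - Min (range v)))" arbitrary: i j rule: less_induct)
    case less
    have bound: "v k - v l + (Max (range v) - Min (range v)) \<ge> 0" for k l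
    proof -
      have "v l \<le> Max (range v)" "Min (range v) \<le> v k" by simp_all
      then show ?thesis by linarith
    qed
    have "(n ** B) $ i $ j = 0"
      unfolding matrix_matrix_mult_def vec_lambda_beta
    proof (intro sum.neutral ballI)
      fix k
      show "n $ i $ k * B $ k $ j = 0"
      proof (cases "n $ i $ k = 0")
        case False
        then have "v i > v k" "t i = t k" using n by auto
        then have "B $ k $ j = 0" using less.prems bound [of k j] by (intro less.hyps) auto
        then show ?thesis by simp
      qed simp
    qed
    moreover have "(B ** n) $ i $ j = 0"
      unfolding matrix_matrix_mult_def vec_lambda_beta
    proof (intro sum.neutral ballI)
      fix k
      show "B $ i $ k * n $ k $ j = 0"
      proof (cases "n $ k $ j = 0")
        case False
        then have "v k > v j" "t k = t j" using n by auto
        then have "B $ i $ k = 0" using less.prems bound [of i k] by (intro less.hyps) auto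
        then show ?thesis by simp
      qed simp
    qed
    moreover have "t i * B $ i $ j + (n ** B) $ i $ j = B $ i $ j * t j + (B ** n) $ i $ j"
      using arg_cong [OF comm, of "\<lambda>A. A $ i $ j"] by (simp add: matrix_add_ldistrib matrix_add_rdistrib)
    ultimately show ?case using less.prems by (simp add: mult.commute)
  qed
  then show ?thesis by (simp add: matrix_eq_iff mult.commute) (metis)
qed

section \<open>Triangular and diagonal forms\<close>

text \<open>The operator \<open>q(X)\<close>, applied to a fixed vector, for a polynomial \<open>q\<close>.\<close>

definition poly_act :: "complex ^ 'm::finite ^ 'm \<Rightarrow> complex ^ 'm \<Rightarrow> complex poly \<Rightarrow> complex ^ 'm" where
  "poly_act X v q = fold_coeffs (\<lambda>a w. a *s v + X *v w) q 0"

lemma poly_act_0 [simp]: "poly_act X v 0 = 0"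
  by (simp add: poly_act_def)

lemma poly_act_pCons [simp]: "poly_act X v (pCons a q) = a *s v + X *v poly_act X v q"
  by (cases "a = 0 \<and> q = 0") (auto simp: poly_act_def)

lemma poly_act_add: "poly_act X v (p + q) = poly_act X v p + poly_act X v q"
  by (induction p q rule: poly_induct2) (simp_all add: matrix_vector_right_distrib algebra_simps)

lemma poly_act_smult: "poly_act X v (smult c q) = c *s poly_act X v q"
  by (induction q) (simp_all add: matrix_vector_right_distrib vector_scalar_commute vector_add_ldistrib)

lemma poly_act_sum: "poly_act X v (\<Sum>i\<in>I. q i) = (\<Sum>i\<in>I. poly_act X v (q i))"
  by (induction I rule: infinite_finite_induct) (simp_all add: poly_act_add)

text \<open>A polynomial \<open>q\<close> of least degree with \<open>q(X) v0 \<in> U\<close> has a root \<open>\<mu>\<close>, and the cofactor of \<open>[:- \<mu>, 1:]\<close>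
  sends \<open>v0\<close> to an eigenvector modulo \<open>U\<close>.\<close>

lemma eigenvector_modulo_subspace:
  fixes X :: "complex ^ 'm::finite ^ 'm"
  assumes U: "vec.subspace U" "U \<noteq> UNIV"
  obtains v \<mu> where "v \<notin> U" "X *v v - \<mu> *s v \<in> U"
proof -
  obtain v0 where v0: "v0 \<notin> U" using U by auto
  have "\<exists>q. q \<noteq> 0 \<and> poly_act X v0 q \<in> U"
  proof -
    obtain c where c: "\<exists>i\<in>{..CARD('m)}. c i \<noteq> 0"
      "(\<Sum>i\<le>CARD('m). c i *s poly_act X v0 (monom 1 i)) = 0"
      using vec.dependent_family [of "{..CARD('m)}" cart_basis "\<lambda>i. poly_act X v0 (monom 1 i)"]
        vec.finite_Basis vec.dim_UNIV [where 'a = complex and 'b = 'm]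
        vec_dim_card [where 'a = complex and 'n = 'm] vec.span_Basis by auto
    let ?q = "\<Sum>i\<le>CARD('m). smult (c i) (monom 1 i)"
    obtain i where "i \<le> CARD('m)" "c i \<noteq> 0" using c(1) by auto
    then have "coeff ?q i \<noteq> 0" by (simp add: coeff_sum if_distrib [of "\<lambda>y. _ * y"] cong: if_cong)
    then have "?q \<noteq> 0" by (metis coeff_0)
    moreover have "poly_act X v0 ?q \<in> U"
      using c(2) vec.subspace_0 [OF U(1)] by (simp add: poly_act_sum poly_act_smult)
    ultimately show ?thesis by blast
  qed
  then obtain q where q: "q \<noteq> 0" "poly_act X v0 q \<in> U"
    and min: "\<And>r. r \<noteq> 0 \<Longrightarrow> poly_act X v0 r \<in> U \<Longrightarrow> degree q \<le> degree r"
    using ex_has_least_nat [of "\<lambda>q. q \<noteq> 0 \<and> poly_act X v0 q \<in> U" _ degree] by blast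
  have "degree q \<noteq> 0"
  proof
    assume "degree q = 0"
    then obtain a where a: "q = [:a:]" by (rule degree_eq_zeroE)
    then have "a *s v0 \<in> U" "a \<noteq> 0" using q by auto
    then have "(1 / a) *s (a *s v0) \<in> U" using vec.subspace_scale [OF U(1)] by blast
    then show False using v0 \<open>a \<noteq> 0\<close> by simp
  qed
  then obtain \<mu> where "poly q \<mu> = 0"
    using fundamental_theorem_of_algebra [of q] by (auto simp: constant_degree)
  then have "[:- \<mu>, 1:] dvd q" by (simp add: poly_eq_0_iff_dvd)
  then obtain r where r: "q = [:- \<mu>, 1:] * r" by (rule dvdE)
  have "r \<noteq> 0" using q r by auto
  then have "degree q = degree [:- \<mu>, 1:] + degree r" unfolding r by (intro degree_mult_eq) auto
  then have "degree r < degree q" by simp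
  then have "poly_act X v0 r \<notin> U" using min [OF \<open>r \<noteq> 0\<close>] by auto
  moreover have "q = pCons 0 r + smult (- \<mu>) r" by (simp add: r)
  then have "poly_act X v0 q = X *v poly_act X v0 r - \<mu> *s poly_act X v0 r"
    by (simp only: poly_act_add poly_act_smult poly_act_pCons) simp
  ultimately show ?thesis using q(2) that by simp
qed

lemma matrix_of_columns:
  fixes p :: "'m::finite \<Rightarrow> complex ^ 'm"
  assumes "vec.independent (range p)" "inj p"
  obtains P P' where "P ** P' = mat 1" "P' ** P = mat 1" "\<And>j. P *v axis j 1 = p j"
proof -
  define P where "P = (\<chi> i j. p j $ i)"
  have col: "P *v axis j 1 = p j" for j
    by (simp add: P_def vec_eq_iff matrix_vector_mult_def axis_def if_distrib [of "\<lambda>y. _ * y"] cong: if_cong)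
  have "y = 0" if "P *v y = 0" for y
  proof -
    have "P *v y = (\<Sum>j\<in>UNIV. y $ j *s p j)"
      by (simp add: P_def vec_eq_iff matrix_vector_mult_def mult.commute sum_component)
    also have "\<dots> = (\<Sum>w\<in>range p. y $ inv p w *s w)"
      by (simp add: sum.reindex assms(2))
    finally have "(\<Sum>w\<in>range p. y $ inv p w *s w) = 0" using that by simp
    then have "y $ inv p (p j) = 0" for j
      using vec.independentD [OF assms(1), of "range p" "\<lambda>w. y $ inv p w" "p j"] by simp
    then show ?thesis using assms(2) by (simp add: vec_eq_iff)
  qed
  then have "invertible P" by (simp add: invertible_left_inverse matrix_left_invertible_ker)
  then show ?thesis using that col by (auto simp: invertible_def)
qed

lemma matrix_eq_on_axes:
  "(\<And>j. A *v axis j 1 = B *v axis j 1) \<Longrightarrow> A = B" for A B :: "complex ^ 'm::finite ^ 'm"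
proof -
  assume *: "\<And>j. A *v axis j 1 = B *v axis j 1"
  have "(C *v axis j 1) $ i = C $ i $ j" for C :: "complex ^ 'm ^ 'm" and i j
    by (simp add: matrix_vector_mult_def axis_def if_distrib [of "\<lambda>y. _ * y"] cong: if_cong)
  then show ?thesis using * by (metis matrix_eq_iff)
qed

lemma matrix_axis_nth: "(C *v axis j 1) $ i = C $ i $ j" for C :: "complex ^ 'm::finite ^ 'm"
  by (simp add: matrix_vector_mult_def axis_def if_distrib [of "\<lambda>y. _ * y"] cong: if_cong)

text \<open>An increasing flag of invariant subspaces is built by adding eigenvectors modulo the subspace so far;
  \<open>v\<close> is the negative of the position of each basis vector in the flag.\<close>

lemma triangularization:
  fixes X :: "complex ^ 'm::finite ^ 'm"
  obtains P P' t n and v :: "'m \<Rightarrow> int" where "P ** P' = mat 1" "P' ** P = mat 1" "P' ** X ** P = diag t + n"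
    "\<And>i j. n $ i $ j \<noteq> 0 \<Longrightarrow> v i > v j"
proof -
  have flag: "\<exists>p t. inj_on p {..<k} \<and> vec.independent (p ` {..<k}) \<and>
      (\<forall>j<k. X *v p j - t j *s p j \<in> vec.span (p ` {..<j}))" if "k \<le> CARD('m)" for k
    using that
  proof (induction k)
    case 0
    show ?case by (auto simp: vec.independent_empty)
  next
    case (Suc k)
    then obtain p :: "nat \<Rightarrow> complex ^ 'm" and t where p: "inj_on p {..<k}" "vec.independent (p ` {..<k})"
      "\<And>j. j < k \<Longrightarrow> X *v p j - t j *s p j \<in> vec.span (p ` {..<j})" by auto
    have "vec.dim (vec.span (p ` {..<k})) = k"
      using vec.dim_span_eq_card_independent [OF p(2)] card_image [OF p(1)] by simp
    moreover have "vec.dim (UNIV :: (complex ^ 'm) set) = CARD('m)" by (rule vec_dim_card)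
    ultimately have "vec.span (p ` {..<k}) \<noteq> UNIV" using Suc.prems by (metis Suc_n_not_le_n)
    then obtain v \<mu> where v: "v \<notin> vec.span (p ` {..<k})" "X *v v - \<mu> *s v \<in> vec.span (p ` {..<k})"
      by (rule eigenvector_modulo_subspace [OF vec.subspace_span])
    have vp: "v \<notin> p ` {..<k}" using v(1) vec.span_base [of v "p ` {..<k}"] by auto
    have im: "(p(k := v)) ` {..<j} = p ` {..<j}" if "j \<le> k" for j
      using that by (intro image_cong) auto
    have imS: "(p(k := v)) ` {..<Suc k} = insert v (p ` {..<k})" by (auto simp: lessThan_Suc)
    have "inj_on (p(k := v)) {..<Suc k}"
      using p(1) vp by (auto simp: lessThan_Suc inj_on_def)
    moreover have "vec.independent ((p(k := v)) ` {..<Suc k})"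
      unfolding imS by (rule vec.independent_insertI [OF v(1) p(2)])
    moreover have "X *v (p(k := v)) j - (t(k := \<mu>)) j *s (p(k := v)) j \<in> vec.span ((p(k := v)) ` {..<j})"
      if "j < Suc k" for j
    proof (cases "j = k")
      case True
      then show ?thesis using v(2) im [of k] by (simp del: fun_upd_image)
    next
      case False
      then show ?thesis using that p(3) [of j] im [of j] by (simp del: fun_upd_image)
    qed
    ultimately show ?case by blast
  qed
  from flag [of "CARD('m)"] obtain p :: "nat \<Rightarrow> complex ^ 'm" and s where
    p: "inj_on p {..<CARD('m)}" "vec.independent (p ` {..<CARD('m)})"
      "\<And>j. j < CARD('m) \<Longrightarrow> X *v p j - s j *s p j \<in> vec.span (p ` {..<j})" by auto
  obtain h :: "'m \<Rightarrow> nat" where h: "bij_betw h UNIV {..<CARD('m)}"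
    using ex_bij_betw_finite_nat [of "UNIV :: 'm set"] by (auto simp: atLeast0LessThan)
  have range_h: "h j < CARD('m)" for j using h by (auto simp: bij_betw_def)
  have "inj h" and im_h: "range h = {..<CARD('m)}" using h by (auto simp: bij_betw_def)
  then have inj_ph: "inj (p \<circ> h)" using p(1) by (intro comp_inj_on) simp_all
  have im_ph: "range (p \<circ> h) = p ` {..<CARD('m)}" by (simp only: image_comp [symmetric] im_h)
  obtain P P' :: "complex ^ 'm ^ 'm" where P: "P ** P' = mat 1" "P' ** P = mat 1" and col: "\<And>j. P *v axis j 1 = p (h j)"
    using matrix_of_columns [of "p \<circ> h"] inj_ph im_ph p(2) by auto
  define n where "n = P' ** X ** P - diag (s \<circ> h)"
  show ?thesis
  proof (rule that [OF P])
    show "P' ** X ** P = diag (s \<circ> h) + n" by (simp add: n_def)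
    fix i j assume nz: "n $ i $ j \<noteq> 0"
    have P'p: "P' *v p (h k) = axis k 1" for k
      using arg_cong [OF col [of k], of "(*v) P'"] by (simp add: matrix_vector_mul_assoc P)
    have P'w: "(P' *v w) $ i = 0" if w: "w \<in> vec.span (p ` {..<h j})" and ij: "\<not> h i < h j" for w
      using w
    proof (induction rule: vec.span_induct_alt)
      case (step c x y)
      then obtain l where l: "l < h j" "x = p l" by auto
      then have "l \<in> range h" using range_h [of j] unfolding im_h by simp
      then obtain k where "h k = l" by auto
      then have "P' *v x = axis k 1" "k \<noteq> i" using l ij P'p by auto
      then show ?case using step by (simp add: matrix_vector_right_distrib vector_scalar_commute axis_def)
    qed simp
    have "n $ i $ j = (P' *v (X *v p (h j) - s (h j) *s p (h j))) $ i"
    proof -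
      have "n *v axis j 1 = P' *v (X *v p (h j)) - diag (s \<circ> h) *v axis j 1"
        by (simp add: n_def matrix_vector_mult_diff_rdistrib col flip: matrix_vector_mul_assoc)
      also have "diag (s \<circ> h) *v axis j 1 = s (h j) *s axis j 1"
        by (simp add: vec_eq_iff axis_def)
      also have "\<dots> = P' *v (s (h j) *s p (h j))"
        using P'p by (simp add: vector_scalar_commute)
      finally show ?thesis
        using matrix_axis_nth [of n j i] by (simp add: matrix_vector_mult_diff_distrib)
    qed
    then have "\<not> (\<not> h i < h j)" using P'w [OF p(3) [OF range_h]] nz by metis
    then show "- int (h i) > - int (h j)" by simp
  qed
qed

lemma invertible_columns_from_spanning:
  fixes S :: "(complex ^ 'm::finite) set"
  assumes "vec.span S = UNIV"
  obtains P P' :: "complex ^ 'm ^ 'm" where "P ** P' = mat 1" "P' ** P = mat 1" "\<And>j. P *v axis j 1 \<in> S"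
proof -
  obtain B where B: "B \<subseteq> S" "vec.independent B" "S \<subseteq> vec.span B"
    using vec.maximal_independent_subset [of S] by blast
  have "vec.span B = UNIV" using B(3) assms vec.span_mono [OF B(3)] by (simp add: vec.span_span top.extremum_unique)
  then have "card B = CARD('m)"
    using vec.dim_eq_card_independent [OF B(2)] vec.dim_span [of B] vec_dim_card [where 'a = complex and 'n = 'm] by simp
  moreover have "finite B" using B(2) vec.finiteI_independent by blast
  ultimately obtain p where p: "bij_betw p (UNIV :: 'm set) B"
    using finite_same_card_bij [of "UNIV :: 'm set" B] by auto
  then have inj_p: "inj p" and rp: "range p = B" by (auto simp: bij_betw_def)
  have indep: "vec.independent (range p)" using B(2) rp by simp
  obtain P P' :: "complex ^ 'm ^ 'm" where P: "P ** P' = mat 1" "P' ** P = mat 1" and col: "\<And>j. P *v axis j 1 = p j"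
    by (rule matrix_of_columns [OF indep inj_p], rule that)
  have PS: "P *v axis j 1 \<in> S" for j using col [of j] B(1) rp by auto
  show ?thesis by (rule that [OF P PS])
qed

lemma semisimple_conj:
  fixes A P P' :: "complex ^ 'm::finite ^ 'm"
  assumes "semisimple_matrix A" "P ** P' = mat 1"
  shows "semisimple_matrix (P' ** A ** P)"
proof -
  have P'P: "P' ** P = mat 1" using assms(2) by (simp add: matrix_left_right_inverse)
  obtain R D :: "complex ^ 'm ^ 'm" where R: "invertible R" "\<forall>i j. i \<noteq> j \<longrightarrow> D $ i $ j = 0" "A = R ** D ** matrix_inv R"
    using assms(1) unfolding semisimple_matrix_def by blast
  have "(P' ** R) ** (matrix_inv R ** P) = P' ** (R ** matrix_inv R) ** P" by (simp add: matrix_mul_assoc)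
  then have 1: "(P' ** R) ** (matrix_inv R ** P) = mat 1" using R(1) P'P by (simp add: matrix_inv_inverse)
  then have "matrix_inv (P' ** R) = matrix_inv R ** P" by (rule matrix_inv_eqI)
  then show ?thesis
    unfolding semisimple_matrix_def
    by (intro exI [of _ "P' ** R"] exI [of _ D]) (simp add: R 1 invertibleI [OF 1] matrix_mul_assoc)
qed

lemma semisimple_diag: "semisimple_matrix (diag t)" for t :: "'m::finite \<Rightarrow> complex"
  unfolding semisimple_matrix_def
  by (intro exI [of _ "mat 1"] exI [of _ "diag t"])
    (simp add: invertibleI [of "mat 1" "mat 1"] matrix_inv_eqI [of "mat 1" "mat 1"])

lemma semisimple_conj_diag: "P ** P' = mat 1 \<Longrightarrow> semisimple_matrix (P ** diag t ** P')"
  for t :: "'m::finite \<Rightarrow> complex" and P P' :: "complex ^ 'm ^ 'm"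
  using semisimple_conj [OF semisimple_diag, of P' P t] by (simp add: matrix_left_right_inverse)

lemma semisimple_matrixE:
  fixes A :: "complex ^ 'm::finite ^ 'm"
  assumes "semisimple_matrix A"
  obtains P P' :: "complex ^ 'm ^ 'm" and t where "P ** P' = mat 1" "P' ** P = mat 1" "A = P ** diag t ** P'"
proof -
  obtain R D :: "complex ^ 'm ^ 'm" where R: "invertible R" "\<forall>i j. i \<noteq> j \<longrightarrow> D $ i $ j = 0" "A = R ** D ** matrix_inv R"
    using assms unfolding semisimple_matrix_def by blast
  have "D = diag (\<lambda>i. D $ i $ i)" using R(2) by (auto simp: matrix_eq_iff)
  then show ?thesis using that matrix_inv_inverse [OF R(1)] R(3) by metis
qed

text \<open>\<open>A\<close> preserves the level sets of \<open>w\<close>, so the restrictions of its eigenvectors to the levels are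
  eigenvectors again, and they span. The conclusion for all \<open>\<phi>\<close> covers both the powers \<open>s powi w i\<close>
  and the weights \<open>w i\<close> themselves.\<close>

lemma simultaneous_diagonalization:
  fixes w :: "'m::finite \<Rightarrow> 'b" and A :: "complex ^ 'm ^ 'm"
  assumes A: "semisimple_matrix A" and levels: "\<And>i j. A $ i $ j \<noteq> 0 \<Longrightarrow> w i = w j"
  obtains P P' :: "complex ^ 'm ^ 'm" and t w' where "P ** P' = mat 1" "P' ** P = mat 1" "P' ** A ** P = diag t"
    "\<And>\<phi>. P' ** diag (\<phi> \<circ> w) ** P = diag (\<phi> \<circ> w')"
proof -
  obtain R R' :: "complex ^ 'm ^ 'm" and a where R: "R ** R' = mat 1" "A = R ** diag a ** R'" "R' ** R = mat 1"
    using semisimple_matrixE [OF A] by metis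
  define r where "r j = R *v axis j 1" for j
  have Ar: "A *v r j = a j *s r j" for j
  proof -
    have "A *v r j = R *v (diag a *v ((R' ** R) *v axis j 1))"
      by (simp add: R(2) r_def matrix_vector_mul_assoc matrix_mul_assoc)
    also have "diag a *v ((R' ** R) *v axis j 1) = a j *s axis j 1"
      by (simp add: R vec_eq_iff axis_def)
    finally show ?thesis by (simp add: r_def vector_scalar_commute)
  qed
  define lev where "lev b x = (\<chi> i. if w i = b then x $ i else 0)" for b and x :: "complex ^ 'm"
  define S where "S = {lev b (r j) | b j. True}"
  have eig: "A *v lev b (r j) = a j *s lev b (r j)" for b j
  proof -
    have "(A *v lev b (r j)) $ i = (if w i = b then (A *v r j) $ i else 0)" for i
    proof -
      have "A $ i $ k = 0" if "w i \<noteq> w k" for k using levels that by blast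
      then show ?thesis
        unfolding matrix_vector_mult_def vec_lambda_beta
        by (auto simp: lev_def intro!: sum.neutral sum.cong)
    qed
    then show ?thesis by (simp add: Ar vec_eq_iff lev_def)
  qed
  have "vec.span S = UNIV"
  proof -
    have "r j \<in> vec.span S" for j
    proof -
      have "r j = (\<Sum>b\<in>range w. lev b (r j))"
        by (simp add: vec_eq_iff lev_def sum_component)
      also have "\<dots> \<in> vec.span S"
        by (intro vec.span_sum vec.span_base) (auto simp: S_def)
      finally show ?thesis .
    qed
    then have "R *v y \<in> vec.span S" for y
    proof -
      have "R *v y = (\<Sum>j\<in>UNIV. y $ j *s r j)"
        by (simp add: r_def vec_eq_iff matrix_axis_nth sum_component) (simp add: matrix_vector_mult_def mult.commute)
      then show ?thesis using \<open>\<And>j. r j \<in> vec.span S\<close> by (simp add: vec.span_sum vec.span_scale)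
    qed
    from this [of "R' *v _"] show ?thesis by (auto simp: matrix_vector_mul_assoc R)
  qed
  from invertible_columns_from_spanning [OF this] obtain P P' :: "complex ^ 'm ^ 'm"
    where P: "P ** P' = mat 1" "P' ** P = mat 1" and PS: "\<forall>j. P *v axis j 1 \<in> S"
    by auto
  from PS have "\<forall>j. \<exists>b k. P *v axis j 1 = lev b (r k)" by (auto simp: S_def)
  then obtain w' k where col: "\<And>j. P *v axis j 1 = lev (w' j) (r (k j))" by metis
  have conj_diag: "P' ** C ** P = diag c" if "\<And>j. C *v lev (w' j) (r (k j)) = c j *s lev (w' j) (r (k j))" for C c
  proof (rule matrix_eq_on_axes)
    fix j
    have "(P' ** C ** P) *v axis j 1 = P' *v (C *v (P *v axis j 1))"
      by (simp add: matrix_vector_mul_assoc matrix_mul_assoc)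
    also have "\<dots> = P' *v (c j *s (P *v axis j 1))" by (simp add: col that)
    also have "\<dots> = c j *s axis j 1" by (simp add: vector_scalar_commute matrix_vector_mul_assoc P)
    also have "\<dots> = diag c *v axis j 1" by (simp add: vec_eq_iff axis_def)
    finally show "(P' ** C ** P) *v axis j 1 = diag c *v axis j 1" .
  qed
  show ?thesis
  proof (rule that [OF P])
    show "P' ** A ** P = diag (a \<circ> k)" by (rule conj_diag) (simp add: eig)
    fix \<phi> :: "'b \<Rightarrow> complex"
    show "P' ** diag (\<phi> \<circ> w) ** P = diag (\<phi> \<circ> w')"
      by (rule conj_diag) (auto simp: vec_eq_iff lev_def)
  qed
qed

text \<open>Expand \<open>L t\<close> as a Laurent polynomial with matrix coefficients \<open>C l\<close>. Comparing coefficients in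
  \<open>L s ** L t = L (s * t)\<close> shows that the columns of each \<open>C l\<close> are eigenvectors of \<open>L s\<close> for a
  power of \<open>s\<close>, and they span because the \<open>C l\<close> sum up to \<open>L 1 = mat 1\<close>.\<close>

lemma one_parameter_subgroup_diagonalizable:
  fixes L :: "complex \<Rightarrow> complex ^ 'm::finite ^ 'm"
  assumes "one_parameter_subgroup L"
  obtains P P' and w :: "'m \<Rightarrow> int" where "P ** P' = mat 1" "P' ** P = mat 1"
    "\<And>s. s \<noteq> 0 \<Longrightarrow> P' ** L s ** P = diag (\<lambda>i. s powi w i)"
proof -
  have inv: "\<And>s. s \<noteq> 0 \<Longrightarrow> invertible (L s)" and hom: "\<And>s t. s \<noteq> 0 \<Longrightarrow> t \<noteq> 0 \<Longrightarrow> L (s * t) = L s ** L t"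
    and "\<forall>i j. \<exists>p k. \<forall>t. t \<noteq> 0 \<longrightarrow> L t $ i $ j = poly p t / t ^ k"
    using assms by (auto simp: one_parameter_subgroup_def)
  then obtain p k where pk: "\<And>i j t. t \<noteq> 0 \<Longrightarrow> L t $ i $ j = poly (p i j) t / t ^ k i j" by metis
  define K where "K = (\<Sum>i\<in>UNIV. \<Sum>j\<in>UNIV. k i j)"
  have kK: "k i j \<le> K" for i j
  proof -
    have "k i j \<le> (\<Sum>j\<in>UNIV. k i j)" by (rule member_le_sum) auto
    also have "\<dots> \<le> K" unfolding K_def by (rule member_le_sum) auto
    finally show ?thesis .
  qed
  define q where "q i j = p i j * monom 1 (K - k i j)" for i j
  have q: "poly (q i j) t = t ^ K * L t $ i $ j" if "t \<noteq> 0" for i j t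
    using that kK [of i j] by (simp add: q_def poly_monom pk power_diff field_simps)
  define d where "d = (\<Sum>i\<in>UNIV. \<Sum>j\<in>UNIV. degree (q i j))"
  have qd: "degree (q i j) \<le> d" for i j
  proof -
    have "degree (q i j) \<le> (\<Sum>j\<in>UNIV. degree (q i j))" by (rule member_le_sum) auto
    also have "\<dots> \<le> d" unfolding d_def by (rule member_le_sum) auto
    finally show ?thesis .
  qed
  define C :: "nat \<Rightarrow> complex ^ 'm ^ 'm" where "C l = (\<chi> i j. coeff (q i j) l)" for l
  have expand: "(\<Sum>l\<le>d. t ^ l * C l $ i $ j) = t ^ K * L t $ i $ j" if "t \<noteq> 0" for t i j
  proof -
    have "poly (q i j) t = (\<Sum>l\<le>d. coeff (q i j) l * t ^ l)"
      by (subst poly_altdef, rule sum.mono_neutral_left) (use qd in \<open>auto simp: coeff_eq_0\<close>)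
    then show ?thesis using q [OF that] by (simp add: C_def mult.commute)
  qed
  have eig: "L s ** C l = mscale (s powi (int l - int K)) (C l)" if s: "s \<noteq> 0" for s l
  proof -
    have "(L s ** C l) $ i $ j * s ^ K = s ^ l * C l $ i $ j" for i j
    proof -
      define r where "r = (\<Sum>l\<le>d. monom ((L s ** C l) $ i $ j * s ^ K - s ^ l * C l $ i $ j) l)"
      have "r = 0"
      proof (rule poly_eq_0_if_off_0)
        fix t :: complex assume t: "t \<noteq> 0"
        have "(\<Sum>l\<le>d. (L s ** C l) $ i $ j * t ^ l) = (\<Sum>m\<in>UNIV. L s $ i $ m * (\<Sum>l\<le>d. t ^ l * C l $ m $ j))"
          by (simp add: matrix_matrix_mult_def sum_distrib_left sum_distrib_right mult_ac) (rule sum.swap)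
        also have "\<dots> = t ^ K * (L s ** L t) $ i $ j"
          by (simp add: expand t matrix_matrix_mult_def sum_distrib_left mult_ac)
        finally have 1: "(\<Sum>l\<le>d. (L s ** C l) $ i $ j * t ^ l) = t ^ K * L (s * t) $ i $ j"
          by (simp add: hom s t)
        have 2: "(\<Sum>l\<le>d. s ^ l * C l $ i $ j * t ^ l) = (s * t) ^ K * L (s * t) $ i $ j"
          using expand [of "s * t" i j] s t by (simp add: power_mult_distrib mult_ac)
        have "poly r t = s ^ K * (\<Sum>l\<le>d. (L s ** C l) $ i $ j * t ^ l) - (\<Sum>l\<le>d. s ^ l * C l $ i $ j * t ^ l)"
          by (simp add: r_def poly_sum poly_monom algebra_simps sum_subtractf sum_distrib_left)
        then show "poly r t = 0" unfolding 1 2 by (simp add: power_mult_distrib)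
      qed
      show ?thesis
      proof (cases "l \<le> d")
        case True
        have "0 = coeff r l" using \<open>r = 0\<close> by simp
        then show ?thesis using True by (simp add: r_def coeff_sum coeff_monom)
      next
        case False
        then have "degree (q i j) < l" for i j using qd [of i j] by simp
        then have "C l = 0" by (simp add: C_def matrix_eq_iff coeff_eq_0)
        then show ?thesis by (simp add: matrix_matrix_mult_def)
      qed
    qed
    then show ?thesis using s by (simp add: matrix_eq_iff power_int_diff field_simps)
  qed
  have "L 1 ** L 1 = L 1" using hom [of 1 1] by simp
  then have L1: "L 1 = mat 1"
    using matrix_inv_inverse [OF inv [of 1]] by (metis matrix_mul_assoc matrix_mul_rid zero_neq_one)
  define S where "S = {x. \<exists>a::int. \<forall>s. s \<noteq> 0 \<longrightarrow> L s *v x = (s powi a) *s x}"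
  have "vec.span S = UNIV"
  proof -
    have "x \<in> vec.span S" for x
    proof -
      have "C l *v x \<in> S" for l
        unfolding S_def using eig
        by (intro CollectI exI [of _ "int l - int K"]) (simp add: matrix_vector_mul_assoc mscale_matrix_vector)
      moreover have "x = (\<Sum>l\<le>d. C l *v x)"
      proof -
        have "(\<Sum>l\<le>d. C l) = mat 1" using expand [of 1] by (simp add: matrix_eq_iff sum_component L1)
        moreover have "(\<Sum>l\<in>A. C l) *v x = (\<Sum>l\<in>A. C l *v x)" for A
          by (induction A rule: infinite_finite_induct) (simp_all add: matrix_vector_mult_add_rdistrib)
        from this [of "{..d}"] calculation show ?thesis by simp
      qed
      moreover have "(\<Sum>l\<le>d. C l *v x) \<in> vec.span S"
        using calculation(1) by (intro vec.span_sum vec.span_base)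
      ultimately show ?thesis by simp
    qed
    then show ?thesis by auto
  qed
  from invertible_columns_from_spanning [OF this] obtain P P' :: "complex ^ 'm ^ 'm"
    where P: "P ** P' = mat 1" "P' ** P = mat 1" and PS: "\<forall>j. P *v axis j 1 \<in> S"
    by auto
  from PS have "\<forall>j. \<exists>a::int. \<forall>s. s \<noteq> 0 \<longrightarrow> L s *v (P *v axis j 1) = (s powi a) *s (P *v axis j 1)"
    by (auto simp: S_def)
  then obtain w :: "'m \<Rightarrow> int" where w: "\<And>j s. s \<noteq> 0 \<Longrightarrow> L s *v (P *v axis j 1) = (s powi w j) *s (P *v axis j 1)"
    by metis
  show ?thesis
  proof (rule that [OF P])
    fix s :: complex assume s: "s \<noteq> 0"
    show "P' ** L s ** P = diag (\<lambda>i. s powi w i)"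
    proof (rule matrix_eq_on_axes)
      fix j
      have "(P' ** L s ** P) *v axis j 1 = P' *v (L s *v (P *v axis j 1))"
        by (simp add: matrix_vector_mul_assoc matrix_mul_assoc)
      also have "\<dots> = P' *v ((s powi w j) *s (P *v axis j 1))" by (simp only: w [OF s])
      also have "\<dots> = (s powi w j) *s axis j 1"
        by (simp add: vector_scalar_commute matrix_vector_mul_assoc P)
      also have "\<dots> = diag (\<lambda>i. s powi w i) *v axis j 1" by (simp add: vec_eq_iff axis_def)
      finally show "(P' ** L s ** P) *v axis j 1 = diag (\<lambda>i. s powi w i) *v axis j 1" .
    qed
  qed
qed

section \<open>Initial forms and gradings\<close>

definition initial_form :: "nat \<Rightarrow> ('m::finite \<Rightarrow> int) \<Rightarrow> int \<Rightarrow> (('m \<Rightarrow> nat) \<Rightarrow> complex) \<Rightarrow> complex ^ 'm \<Rightarrow> complex" where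
  "initial_form d w a c = form_of d (\<lambda>\<alpha>. if weight w \<alpha> = a then c \<alpha> else 0)"

text \<open>The part of degree \<open>p\<close> for the grading of matrices induced by the weights, that is, by the adjoint
  action of the one-parameter subgroup.\<close>

definition graded_part :: "('m \<Rightarrow> int) \<Rightarrow> int \<Rightarrow> complex ^ 'm ^ 'm \<Rightarrow> complex ^ 'm ^ 'm" where
  "graded_part w p A = (\<chi> i j. if w j - w i = p then A $ i $ j else 0)"

lemma graded_part_nth [simp]: "graded_part w p A $ i $ j = (if w j - w i = p then A $ i $ j else 0)"
  by (simp add: graded_part_def)

lemma monomial_diag_powi:
  assumes "s \<noteq> 0"
  shows "monomial \<alpha> (diag (\<lambda>i. s powi w i) *v x) = s powi weight w \<alpha> * monomial \<alpha> x"
proof -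
  have "(\<Prod>i\<in>I. (s powi w i) ^ \<alpha> i) = s powi (\<Sum>i\<in>I. of_nat (\<alpha> i) * w i)" for I
    using assms by (induction I rule: infinite_finite_induct)
      (simp_all add: power_int_add power_int_mult mult.commute flip: power_int_of_nat)
  then show ?thesis
    by (simp add: monomial_def weight_def power_mult_distrib prod.distrib)
qed

lemma laurent_coefficients_eq:
  fixes a :: "'j \<Rightarrow> complex" and e :: "'j \<Rightarrow> int" and b :: "'k \<Rightarrow> complex" and h :: "'k \<Rightarrow> int"
  assumes "finite J" "finite K"
    and "\<And>s. s \<noteq> 0 \<Longrightarrow> (\<Sum>j\<in>J. s powi e j * a j) = (\<Sum>k\<in>K. s powi h k * b k)"
  shows "(\<Sum>j | j \<in> J \<and> e j = m. a j) = (\<Sum>k | k \<in> K \<and> h k = m. b k)"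
proof -
  have "(\<Sum>x | x \<in> J <+> K \<and> case_sum e h x = m. case_sum a (\<lambda>k. - b k) x) = 0"
  proof (rule laurent_coefficient_zero)
    show "finite (J <+> K)" using assms by simp
    fix s :: complex assume "s \<noteq> 0"
    then show "(\<Sum>x\<in>J <+> K. s powi case_sum e h x * case_sum a (\<lambda>k. - b k) x) = 0"
      using assms by (simp add: sum.Plus sum_negf)
  qed
  moreover have "{x. x \<in> J <+> K \<and> case_sum e h x = m} = {j. j \<in> J \<and> e j = m} <+> {k. k \<in> K \<and> h k = m}"
    by auto
  ultimately show ?thesis using assms(1,2) by (simp add: sum.Plus sum_negf)
qed

text \<open>For fixed \<open>x\<close> both sides are Laurent polynomials in \<open>s\<close>, so the abstract coefficient functions \<open>q i\<close> are
  the weight components of the form.\<close>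

lemma initial_form_of_expansion:
  fixes w :: "'m::finite \<Rightarrow> int"
  assumes expansion: "\<And>s x. s \<noteq> 0 \<Longrightarrow> form_of d c (diag (\<lambda>i. s powi w i) *v x) = (\<Sum>i=a..e. s powi i * q i x)"
    and "a \<le> e"
  shows "q a = initial_form d w a c" "\<And>\<alpha>. \<alpha> \<in> exponents d \<Longrightarrow> c \<alpha> \<noteq> 0 \<Longrightarrow> a \<le> weight w \<alpha>"
proof -
  have part: "initial_form d w m c x = (\<Sum>i | i \<in> {a..e} \<and> i = m. q i x)" for m x
  proof -
    have "(\<Sum>\<alpha> | \<alpha> \<in> exponents d \<and> weight w \<alpha> = m. c \<alpha> * monomial \<alpha> x) = (\<Sum>i | i \<in> {a..e} \<and> i = m. q i x)"
    proof (rule laurent_coefficients_eq [OF finite_exponents])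
      fix s :: complex assume s: "s \<noteq> 0"
      show "(\<Sum>\<alpha>\<in>exponents d. s powi weight w \<alpha> * (c \<alpha> * monomial \<alpha> x)) = (\<Sum>i=a..e. s powi i * q i x)"
        using expansion [OF s, of x] by (simp add: form_of_def monomial_diag_powi s mult.left_commute)
    qed simp
    moreover have "initial_form d w m c x = (\<Sum>\<alpha> | \<alpha> \<in> exponents d \<and> weight w \<alpha> = m. c \<alpha> * monomial \<alpha> x)"
    proof -
      have "initial_form d w m c x = (\<Sum>\<alpha>\<in>exponents d. if weight w \<alpha> = m then c \<alpha> * monomial \<alpha> x else 0)"
        unfolding initial_form_def form_of_def by (intro sum.cong) auto
      also have "\<dots> = (\<Sum>\<alpha> | \<alpha> \<in> exponents d \<and> weight w \<alpha> = m. c \<alpha> * monomial \<alpha> x)"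
        by (rule sum.inter_filter [OF finite_exponents, symmetric])
      finally show ?thesis .
    qed
    ultimately show ?thesis by simp
  qed
  have "{i. i \<in> {a..e} \<and> i = a} = {a}" using \<open>a \<le> e\<close> by auto
  then show "q a = initial_form d w a c" using part [of a] by (simp add: fun_eq_iff)
  fix \<alpha> :: "'m \<Rightarrow> nat" assume \<alpha>: "\<alpha> \<in> exponents d" "c \<alpha> \<noteq> 0"
  show "a \<le> weight w \<alpha>"
  proof (rule ccontr)
    assume "\<not> a \<le> weight w \<alpha>"
    then have "(\<Sum>i | i \<in> {a..e} \<and> i = weight w \<alpha>. q i x) = 0" for x by (intro sum.neutral) auto
    then have "initial_form d w (weight w \<alpha>) c = (\<lambda>_. 0)" unfolding fun_eq_iff part by simp
    then show False using \<alpha> unfolding initial_form_def form_of_eq_0_iff by auto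
  qed
qed

text \<open>Substitute \<open>diag (\<lambda>i. s powi w i) *v x\<close> in the equation that \<open>A\<close> stabilizes the form and take the
  coefficient of \<open>s powi (a + p)\<close>; by hypothesis only the part of \<open>A\<close> of degree \<open>p\<close> and the part of the
  form of weight \<open>a\<close> contribute. This covers leading parts for a general form and all
  graded parts for a homogeneous one.\<close>

lemma graded_part_stabilizes:
  fixes w :: "'m::finite \<Rightarrow> int"
  assumes A: "A \<in> lie_stabilizer (form_of d c)"
    and lowest: "\<And>\<alpha> i j. \<lbrakk>\<alpha> \<in> exponents d; c \<alpha> \<noteq> 0; A $ i $ j \<noteq> 0; weight w \<alpha> + (w j - w i) = a + p\<rbrakk> \<Longrightarrow> weight w \<alpha> = a"
  shows "graded_part w p A \<in> lie_stabilizer (initial_form d w a c)"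
proof -
  let ?T = "{(\<alpha> :: 'm \<Rightarrow> nat, i, j :: 'm). \<alpha> \<in> exponents d \<and> \<alpha> i > 0}"
  let ?h = "\<lambda>x (\<alpha>, i, j). c \<alpha> * of_nat (\<alpha> i) * A $ i $ j * monomial (shift_exponent i j \<alpha>) x"
  let ?e = "\<lambda>(\<alpha>, i, j). weight w \<alpha> + (w j - w i)"
  have finT: "finite ?T"
  proof (rule finite_subset)
    show "?T \<subseteq> exponents d \<times> (UNIV :: ('m \<times> 'm) set)" by auto
    show "finite (exponents d \<times> (UNIV :: ('m \<times> 'm) set))"
      by (rule finite_cartesian_product [OF finite_exponents finite])
  qed
  have "dird (initial_form d w a c) x (graded_part w p A *v x) = 0" for x
  proof -
    have "(\<Sum>\<tau> | \<tau> \<in> ?T \<and> ?e \<tau> = a + p. ?h x \<tau>) = 0"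
    proof (rule laurent_coefficient_zero [OF finT])
      fix s :: complex assume s: "s \<noteq> 0"
      let ?x = "diag (\<lambda>i. s powi w i) *v x"
      have "(\<Sum>\<tau>\<in>?T. ?h ?x \<tau>) = 0"
        using A dird_form_of_matrix [of d c ?x A] by (simp add: lie_stabilizer_iff polyfun_form_of)
      moreover have "?h ?x \<tau> = s powi ?e \<tau> * ?h x \<tau>" if "\<tau> \<in> ?T" for \<tau>
      proof -
        obtain \<alpha> i j where \<tau>: "\<tau> = (\<alpha>, i, j)" by (cases \<tau>) auto
        then have "weight w (shift_exponent i j \<alpha>) = ?e \<tau>" using that by (simp add: weight_shift)
        then show ?thesis using s by (simp add: \<tau> monomial_diag_powi)
      qed
      ultimately show "(\<Sum>\<tau>\<in>?T. s powi ?e \<tau> * ?h x \<tau>) = 0" by simp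
    qed
    moreover have "dird (initial_form d w a c) x (graded_part w p A *v x) = (\<Sum>\<tau> | \<tau> \<in> ?T \<and> ?e \<tau> = a + p. ?h x \<tau>)"
    proof -
      have "dird (initial_form d w a c) x (graded_part w p A *v x) = (\<Sum>\<tau>\<in>?T. if ?e \<tau> = a + p then ?h x \<tau> else 0)"
        unfolding initial_form_def dird_form_of_matrix
      proof (rule sum.cong [OF refl])
        fix \<tau> assume "\<tau> \<in> ?T"
        moreover obtain \<alpha> i j where \<tau>: "\<tau> = (\<alpha>, i, j)" by (cases \<tau>) auto
        ultimately show "(case \<tau> of (\<alpha>, i, j) \<Rightarrow> (if weight w \<alpha> = a then c \<alpha> else 0) * of_nat (\<alpha> i) *
            graded_part w p A $ i $ j * monomial (shift_exponent i j \<alpha>) x)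
          = (if ?e \<tau> = a + p then ?h x \<tau> else 0)"
          using lowest [of \<alpha> i j] by auto
      qed
      also have "\<dots> = (\<Sum>\<tau> | \<tau> \<in> ?T \<and> ?e \<tau> = a + p. ?h x \<tau>)"
        by (rule sum.inter_filter [OF finT, symmetric])
      finally show ?thesis .
    qed
    ultimately show ?thesis by simp
  qed
  then show ?thesis by (simp add: lie_stabilizer_iff initial_form_def polyfun_form_of)
qed

lemma graded_part_plus: "graded_part w p (A + B) = graded_part w p A + graded_part w p B"
  by (simp add: matrix_eq_iff)

lemma graded_part_mscale: "graded_part w p (mscale c A) = mscale c (graded_part w p A)"
  by (simp add: matrix_eq_iff)

lemma graded_part_sum: "graded_part w p (\<Sum>b\<in>B. F b) = (\<Sum>b\<in>B. graded_part w p (F b))"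
  by (induction B rule: infinite_finite_induct) (simp_all add: graded_part_plus, simp_all add: matrix_eq_iff)

section \<open>The space of leading parts of the stabilizer\<close>

definition order_ge :: "('m \<Rightarrow> int) \<Rightarrow> int \<Rightarrow> complex ^ 'm ^ 'm \<Rightarrow> bool" where
  "order_ge w p A \<longleftrightarrow> (\<forall>i j. A $ i $ j \<noteq> 0 \<longrightarrow> p \<le> w j - w i)"

text \<open>The parts of degree \<open>p\<close> of elements of \<open>K\<close> without parts of lower degree. These span the limit of \<open>K\<close>
  under the one-parameter subgroup.\<close>

definition leading_parts :: "('m \<Rightarrow> int) \<Rightarrow> (complex ^ 'm ^ 'm) set \<Rightarrow> (complex ^ 'm ^ 'm) set" where
  "leading_parts w K = {graded_part w p A | p A. A \<in> K \<and> order_ge w p A}"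

lemma subspace_order_ge: "matrix_space.subspace {A. order_ge w p A}"
  for w :: "'m::finite \<Rightarrow> int"
proof (rule matrix_space.subspaceI)
  show "0 \<in> {A. order_ge w p A}" by (simp add: order_ge_def)
  fix A B :: "complex ^ 'm ^ 'm" and c assume A: "A \<in> {A. order_ge w p A}"
  then show "mscale c A \<in> {A. order_ge w p A}" by (simp add: order_ge_def)
  assume "B \<in> {A. order_ge w p A}"
  then show "A + B \<in> {A. order_ge w p A}" using A by (auto simp: order_ge_def) (metis add_0)
qed

text \<open>Lift a basis that consists of leading parts to \<open>K\<close>. Subtracting a combination of lifts from an
  element of \<open>K\<close> raises its order, so the lifts span \<open>K\<close>.\<close>

lemma dim_leading_parts:
  fixes w :: "'m::finite \<Rightarrow> int"
  assumes K: "matrix_space.subspace K"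
  shows "matrix_space.dim K \<le> matrix_space.dim (leading_parts w K)"
proof -
  obtain B where B: "B \<subseteq> leading_parts w K" "matrix_space.independent B" "leading_parts w K \<subseteq> matrix_space.span B"
    and cardB: "card B = matrix_space.dim (leading_parts w K)" by (rule matrix_space.basis_exists)
  have finB: "finite B" by (rule matrix_space.finiteI_independent [OF B(2)])
  have "\<forall>b\<in>B. \<exists>p A. b = graded_part w p A \<and> A \<in> K \<and> order_ge w p A"
    using B(1) by (fastforce simp: leading_parts_def)
  then obtain deg lift where "\<forall>b\<in>B. b = graded_part w (deg b) (lift b) \<and> lift b \<in> K \<and> order_ge w (deg b) (lift b)"
    by (auto dest!: bchoice)
  then have b: "b = graded_part w (deg b) (lift b)" "lift b \<in> K" "order_ge w (deg b) (lift b)" if "b \<in> B" for b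
    using that by blast+
  define M where "M = Max (range (\<lambda>(i, j). w j - w i)) + 1"
  have M: "w j - w i < M" for i j
  proof -
    have "w j - w i \<in> range (\<lambda>(i, j). w j - w i)" by (rule image_eqI [of _ _ "(i, j)"]) auto
    then have "w j - w i \<le> Max (range (\<lambda>(i, j). w j - w i))" by (intro Max_ge) auto
    then show ?thesis by (simp add: M_def)
  qed
  have "A \<in> matrix_space.span (lift ` B)" if "A \<in> K" "order_ge w p A" for A p
    using that
  proof (induction "nat (M - p)" arbitrary: A p rule: less_induct)
    case less
    show ?case
    proof (cases "p < M")
      case False
      have "A $ i $ j = 0" for i j
      proof (rule ccontr)
        assume "A $ i $ j \<noteq> 0"
        then have "p \<le> w j - w i" using less.prems(2) by (simp add: order_ge_def)
        then show False using False M [of j i] by linarith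
      qed
      then have "A = 0" by (simp add: matrix_eq_iff)
      then show ?thesis by (simp add: matrix_space.span_zero)
    next
      case True
      have "graded_part w p A \<in> matrix_space.span B"
        using B(3) less.prems by (auto simp: leading_parts_def)
      then obtain u where u: "graded_part w p A = (\<Sum>b\<in>B. mscale (u b) b)"
        using matrix_space.span_finite [OF finB] by auto
      have part_b: "graded_part w p b = (if deg b = p then graded_part w p (lift b) else 0)" if "b \<in> B" for b
        by (subst b(1) [OF that]) (auto simp: matrix_eq_iff)
      define A' where "A' = (\<Sum>b\<in>{b\<in>B. deg b = p}. mscale (u b) (lift b))"
      have "graded_part w p A = graded_part w p (graded_part w p A)" by (simp add: matrix_eq_iff)
      also have "\<dots> = (\<Sum>b\<in>B. mscale (u b) (graded_part w p b))"
        by (simp add: u graded_part_sum graded_part_mscale)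
      also have "\<dots> = (\<Sum>b\<in>B. if deg b = p then mscale (u b) (graded_part w p (lift b)) else 0)"
        by (intro sum.cong) (auto simp: part_b)
      also have "\<dots> = (\<Sum>b\<in>{b\<in>B. deg b = p}. mscale (u b) (graded_part w p (lift b)))"
        by (rule sum.inter_filter [OF finB, symmetric])
      also have "\<dots> = graded_part w p A'"
        unfolding A'_def graded_part_sum graded_part_mscale ..
      finally have eq: "graded_part w p A = graded_part w p A'" .
      have A'K: "A' \<in> K" unfolding A'_def
        by (intro matrix_space.subspace_sum [OF K] matrix_space.subspace_scale [OF K]) (auto simp: b)
      have "A' \<in> {A. order_ge w p A}" unfolding A'_def
        by (intro matrix_space.subspace_sum [OF subspace_order_ge] matrix_space.subspace_scale [OF subspace_order_ge])
          (use b(3) in auto)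
      then have ord: "A - A' \<in> {A. order_ge w p A}"
        using less.prems(2) by (intro matrix_space.subspace_diff [OF subspace_order_ge]) auto
      have part0: "(A - A') $ i $ j = 0" if "w j - w i = p" for i j
        using arg_cong [OF eq, of "\<lambda>C. C $ i $ j"] that by simp
      have "order_ge w (p + 1) (A - A')"
        unfolding order_ge_def
      proof (intro allI impI)
        fix i j assume nz: "(A - A') $ i $ j \<noteq> 0"
        then have "w j - w i \<noteq> p" using part0 by blast
        moreover have "p \<le> w j - w i" using nz ord by (auto simp: order_ge_def)
        ultimately show "p + 1 \<le> w j - w i" by linarith
      qed
      moreover have "A - A' \<in> K" using less.prems(1) A'K by (rule matrix_space.subspace_diff [OF K])
      ultimately have "A - A' \<in> matrix_space.span (lift ` B)" using True by (intro less.hyps [of "p + 1"]) auto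
      moreover have "A' \<in> matrix_space.span (lift ` B)" unfolding A'_def
        by (intro matrix_space.span_sum matrix_space.span_scale matrix_space.span_base) auto
      ultimately show ?thesis using matrix_space.span_add [of "A - A'" "lift ` B" A'] by simp
    qed
  qed
  moreover have "order_ge w (- M) A" for A
    unfolding order_ge_def
  proof (intro allI impI)
    fix i j show "- M \<le> w j - w i" using M [of i j] by linarith
  qed
  ultimately have "K \<subseteq> matrix_space.span (lift ` B)" by blast
  then have "matrix_space.dim K \<le> card (lift ` B)" using finB by (intro matrix_space.dim_le_card) auto
  also have "\<dots> \<le> card B" by (rule card_image_le [OF finB])
  finally show ?thesis by (simp add: cardB)
qed

lemma leading_part_lift:
  fixes w :: "'m::finite \<Rightarrow> int"
  assumes K: "matrix_space.subspace K" and "Y \<in> matrix_space.span (leading_parts w K)"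
  shows "\<exists>A\<in>K. order_ge w p A \<and> graded_part w p A = graded_part w p Y"
  using assms(2)
proof (rule matrix_space.span_induct)
  show "matrix_space.subspace {Y. \<exists>A\<in>K. order_ge w p A \<and> graded_part w p A = graded_part w p Y}"
  proof (rule matrix_space.subspaceI)
    show "0 \<in> {Y. \<exists>A\<in>K. order_ge w p A \<and> graded_part w p A = graded_part w p Y}"
      using matrix_space.subspace_0 [OF K] by (auto simp: order_ge_def intro!: bexI [of _ 0])
    fix Y Z c assume "Y \<in> {Y. \<exists>A\<in>K. order_ge w p A \<and> graded_part w p A = graded_part w p Y}"
    then obtain A where A: "A \<in> K" "order_ge w p A" "graded_part w p A = graded_part w p Y" by auto
    show "mscale c Y \<in> {Y. \<exists>A\<in>K. order_ge w p A \<and> graded_part w p A = graded_part w p Y}"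
      using A matrix_space.subspace_scale [OF K A(1), of c] matrix_space.subspace_scale [OF subspace_order_ge, of A w p c]
      by (auto simp: graded_part_mscale intro!: bexI [of _ "mscale c A"])
    assume "Z \<in> {Y. \<exists>A\<in>K. order_ge w p A \<and> graded_part w p A = graded_part w p Y}"
    then obtain B where B: "B \<in> K" "order_ge w p B" "graded_part w p B = graded_part w p Z" by auto
    show "Y + Z \<in> {Y. \<exists>A\<in>K. order_ge w p A \<and> graded_part w p A = graded_part w p Y}"
      using A B matrix_space.subspace_add [OF K A(1) B(1)] matrix_space.subspace_add [OF subspace_order_ge, of A w p B]
      by (auto simp: graded_part_plus intro!: bexI [of _ "A + B"])
  qed
  fix Y assume "Y \<in> leading_parts w K"
  then obtain q A where A: "A \<in> K" "order_ge w q A" "Y = graded_part w q A" by (auto simp: leading_parts_def)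
  show "\<exists>A\<in>K. order_ge w p A \<and> graded_part w p A = graded_part w p Y"
  proof (cases "q = p")
    case True
    then show ?thesis using A by (intro bexI [of _ A]) (auto simp: matrix_eq_iff)
  next
    case False
    then show ?thesis using A matrix_space.subspace_0 [OF K]
      by (intro bexI [of _ 0]) (auto simp: matrix_eq_iff order_ge_def)
  qed
qed

text \<open>By dimension, the span \<open>T\<close> of \<open>diag \<sigma>\<close> and \<open>diag \<omega>\<close> meets the span of the leading parts of the stabilizer
  of the form in a nonzero \<open>diag t\<close>. It has degree 0, so it is the leading part of an element
  \<open>diag t + n\<close> of the stabilizer with \<open>n\<close> of positive degree. The semisimple part of this element is
  a conjugate of \<open>diag t\<close>.\<close>

lemma alignment_in_coordinates:
  fixes w :: "'m::finite \<Rightarrow> int"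
  assumes lowest: "\<And>\<alpha>. \<alpha> \<in> exponents d \<Longrightarrow> c \<alpha> \<noteq> 0 \<Longrightarrow> a \<le> weight w \<alpha>"
    and stab: "diag \<sigma> \<in> lie_stabilizer (initial_form d w a c)" "diag \<omega> \<in> lie_stabilizer (initial_form d w a c)"
    and indep: "\<omega> \<noteq> (\<lambda>_. 0)" "\<And>r. \<sigma> \<noteq> (\<lambda>i. r * \<omega> i)"
    and dim: "matrix_space.dim (lie_stabilizer (initial_form d w a c)) \<le> matrix_space.dim (lie_stabilizer (form_of d c)) + 1"
  obtains t u u' where "t \<noteq> (\<lambda>_. 0)" "diag t \<in> lie_stabilizer (initial_form d w a c)"
    "u ** u' = mat 1" "u' ** diag t ** u \<in> lie_stabilizer (form_of d c)"
proof -
  let ?H = "lie_stabilizer (initial_form d w a c)" and ?K = "lie_stabilizer (form_of d c)"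
  have subH: "matrix_space.subspace ?H" and subK: "matrix_space.subspace ?K"
    by (simp_all add: subspace_lie_stabilizer initial_form_def polyfun_form_of)
  let ?L = "matrix_space.span (leading_parts w ?K)" and ?T = "matrix_space.span {diag \<sigma>, diag \<omega>}"
  have "leading_parts w ?K \<subseteq> ?H"
    unfolding leading_parts_def
  proof safe
    fix p A assume A: "A \<in> ?K" "order_ge w p A"
    show "graded_part w p A \<in> ?H"
    proof (rule graded_part_stabilizes [OF A(1)])
      fix \<alpha> i j
      assume "\<alpha> \<in> exponents d" "c \<alpha> \<noteq> 0" "A $ i $ j \<noteq> 0" "weight w \<alpha> + (w j - w i) = a + p"
      moreover from this have "a \<le> weight w \<alpha>" "p \<le> w j - w i"
        using lowest A(2) by (auto simp: order_ge_def)
      ultimately show "weight w \<alpha> = a" by linarith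
    qed
  qed
  then have LH: "?L \<subseteq> ?H" by (rule matrix_space.span_minimal [OF _ subH])
  have TH: "?T \<subseteq> ?H" using stab by (intro matrix_space.span_minimal subH) auto
  have diag_span: "diag \<sigma> \<notin> matrix_space.span {diag \<omega>}"
  proof
    assume "diag \<sigma> \<in> matrix_space.span {diag \<omega>}"
    then obtain r where "diag \<sigma> = mscale r (diag \<omega>)" by (auto simp: matrix_space.span_singleton)
    then have "\<sigma> i = r * \<omega> i" for i
      by (simp add: matrix_eq_iff) (drule spec [of _ i], drule spec [of _ i], simp)
    then show False using indep(2) [of r] by auto
  qed
  obtain i0 where "\<omega> i0 \<noteq> 0" using indep(1) by auto
  then have "diag \<omega> $ i0 $ i0 \<noteq> 0" by simp
  then have "diag \<omega> \<noteq> 0" by (metis zero_index)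
  then have "matrix_space.independent {diag \<omega>}" by simp
  with diag_span have indepT: "matrix_space.independent {diag \<sigma>, diag \<omega>}"
    by (rule matrix_space.independent_insertI)
  have "diag \<sigma> \<noteq> diag \<omega>" using diag_span matrix_space.span_base [of "diag \<omega>" "{diag \<omega>}"] by auto
  then have dimT: "matrix_space.dim ?T = 2"
    unfolding matrix_space.dim_span_eq_card_independent [OF indepT] by simp
  have "{x + y | x y. x \<in> ?T \<and> y \<in> ?L} \<subseteq> ?H"
    using TH LH matrix_space.subspace_add [OF subH] by blast
  then have "matrix_space.dim {x + y | x y. x \<in> ?T \<and> y \<in> ?L} \<le> matrix_space.dim ?H"
    by (rule matrix_space.dim_subset)
  moreover have "matrix_space.dim {x + y | x y. x \<in> ?T \<and> y \<in> ?L} + matrix_space.dim (?T \<inter> ?L)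
      = matrix_space.dim ?T + matrix_space.dim ?L"
    by (intro matrix_space.dim_sums_Int matrix_space.subspace_span)
  moreover have "matrix_space.dim ?K \<le> matrix_space.dim ?L"
    using dim_leading_parts [OF subK, of w] by simp
  ultimately have "matrix_space.dim (?T \<inter> ?L) \<noteq> 0" using dim dimT by linarith
  then obtain Y where Y: "Y \<in> ?T" "Y \<in> ?L" "Y \<noteq> 0" by auto
  have "matrix_space.subspace {A :: complex ^ 'm ^ 'm. \<exists>t. A = diag t}"
  proof (rule matrix_space.subspaceI, goal_cases)
    case 1 show ?case by (auto intro!: exI [of _ "\<lambda>_. 0"] simp: matrix_eq_iff)
  next
    case (2 x y) then show ?case by (auto intro!: exI [of _ "\<lambda>i. x $ i $ i + y $ i $ i"] simp: matrix_eq_iff)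
  next
    case (3 r x) then show ?case by (auto intro!: exI [of _ "\<lambda>i. r * x $ i $ i"] simp: matrix_eq_iff)
  qed
  then have "?T \<subseteq> {A. \<exists>t. A = diag t}" by (intro matrix_space.span_minimal) auto
  then obtain t where t: "Y = diag t" using Y(1) by auto
  obtain A where A: "A \<in> ?K" "order_ge w 0 A" "graded_part w 0 A = graded_part w 0 Y"
    using leading_part_lift [OF subK Y(2), of 0] by auto
  define n where "n = A - diag t"
  have n: "- w i > - w j" if "n $ i $ j \<noteq> 0" for i j
  proof (rule ccontr)
    assume "\<not> - w i > - w j"
    show False
    proof (cases "w i = w j")
      case True
      then show False using arg_cong [OF A(3), of "\<lambda>C. C $ i $ j"] that by (simp add: n_def t)
    next
      case False
      then have "A $ i $ j \<noteq> 0" using that by (auto simp: n_def split: if_splits)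
      then have "w i \<le> w j" using A(2) by (simp add: order_ge_def)
      then show False using False \<open>\<not> - w i > - w j\<close> by linarith
    qed
  qed
  obtain u u' n' where u: "u ** u' = mat 1" "u ** (diag t + n) ** u' = diag t + n'"
    and n': "\<And>i j. n' $ i $ j \<noteq> 0 \<Longrightarrow> - w i > - w j \<and> t i = t j"
    by (rule conjugate_to_commuting_nilpotent [where n = n and v = "\<lambda>i. - w i" and t = t], rule n, assumption, rule that)
  have u'u: "u' ** u = mat 1" using u(1) by (simp add: matrix_left_right_inverse)
  have "(\<lambda>x. form_of d c (u' *v x)) \<in> forms d" by (rule forms_comp) simp
  then obtain c' where c': "(\<lambda>x. form_of d c (u' *v x)) = form_of d c'" by (auto simp: forms_iff)
  have transfer: "B \<in> lie_stabilizer (form_of d c') \<longleftrightarrow> u' ** B ** u \<in> ?K" for B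
    unfolding c' [symmetric] by (rule lie_stabilizer_comp [OF polyfun_form_of u'u])
  have "u' ** (u ** (diag t + n) ** u') ** u = (u' ** u) ** (diag t + n) ** (u' ** u)"
    by (simp add: matrix_mul_assoc)
  then have "u' ** (diag t + n') ** u = diag t + n" unfolding u(2) by (simp only: u'u matrix_mul_lid matrix_mul_rid)
  then have "u' ** (diag t + n') ** u = A" by (simp add: n_def)
  then have "diag t + n' \<in> lie_stabilizer (form_of d c')" using transfer A(1) by simp
  then have "diag t \<in> lie_stabilizer (form_of d c')"
    by (rule diagonal_part_stabilizes [where v = "\<lambda>i. - w i"]) (rule n')
  then have "u' ** diag t ** u \<in> ?K" using transfer by simp
  moreover have "t \<noteq> (\<lambda>_. 0)"
  proof
    assume "t = (\<lambda>_. 0)"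
    then have "diag t = 0" by (simp add: matrix_eq_iff)
    then show False using Y(3) t by simp
  qed
  moreover have "diag t \<in> ?H" using Y(1) TH t by auto
  ultimately show ?thesis using u(1) that by blast
qed

section \<open>Traces of powers\<close>

primrec mpow :: "complex ^ 'm::finite ^ 'm \<Rightarrow> nat \<Rightarrow> complex ^ 'm ^ 'm" where
  "mpow X 0 = mat 1"
| "mpow X (Suc k) = mpow X k ** X"

definition power_trace :: "nat \<Rightarrow> complex ^ 'm::finite ^ 'm \<Rightarrow> complex" where
  "power_trace k X = trace (mpow X k)"

lemma power_trace_conj:
  fixes P P' X :: "complex ^ 'm::finite ^ 'm"
  assumes "P' ** P = mat 1"
  shows "power_trace k (P ** X ** P') = power_trace k X"
proof -
  have PP': "P ** P' = mat 1" using assms by (simp add: matrix_left_right_inverse)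
  have "mpow (P ** X ** P') k = P ** mpow X k ** P'"
  proof (induction k)
    case (Suc k)
    have "mpow (P ** X ** P') (Suc k) = P ** mpow X k ** (P' ** P) ** X ** P'"
      by (simp add: Suc matrix_mul_assoc)
    then show ?case by (simp add: assms matrix_mul_assoc)
  qed (simp add: PP')
  moreover have "trace (P ** mpow X k ** P') = trace (P' ** (P ** mpow X k))" by (rule trace_mul_sym)
  moreover have "P' ** (P ** mpow X k) = mpow X k" by (simp add: matrix_mul_assoc assms)
  ultimately show ?thesis by (simp add: power_trace_def)
qed

lemma power_trace_triangular:
  fixes v :: "'m::finite \<Rightarrow> int" and n :: "complex ^ 'm ^ 'm"
  assumes n: "\<And>i j. n $ i $ j \<noteq> 0 \<Longrightarrow> v i > v j"
  shows "power_trace k (diag t + n) = (\<Sum>i\<in>UNIV. t i ^ k)"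
proof -
  have "\<exists>n'. mpow (diag t + n) k = diag (\<lambda>i. t i ^ k) + n' \<and> (\<forall>i j. n' $ i $ j \<noteq> 0 \<longrightarrow> v i > v j)"
  proof (induction k)
    case 0
    show ?case by (intro exI [of _ 0]) (simp add: matrix_eq_iff mat_def)
  next
    case (Suc k)
    then obtain n' where n': "mpow (diag t + n) k = diag (\<lambda>i. t i ^ k) + n'"
      "\<And>i j. n' $ i $ j \<noteq> 0 \<Longrightarrow> v i > v j" by blast
    let ?n = "diag (\<lambda>i. t i ^ k) ** n + n' ** diag t + n' ** n"
    have "mpow (diag t + n) (Suc k) = diag (\<lambda>i. t i ^ Suc k) + ?n"
      by (simp add: n'(1) matrix_add_ldistrib matrix_add_rdistrib diag_diag mult.commute add.assoc)
    moreover have "v i > v j" if nz: "?n $ i $ j \<noteq> 0" for i j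
    proof (cases "(n' ** n) $ i $ j = 0")
      case True
      then have "n $ i $ j \<noteq> 0 \<or> n' $ i $ j \<noteq> 0" using nz by auto
      then show ?thesis using n n'(2) by blast
    next
      case False
      then obtain l where "n' $ i $ l \<noteq> 0" "n $ l $ j \<noteq> 0"
        unfolding matrix_matrix_mult_def by (auto elim!: sum.not_neutral_contains_not_neutral)
      then show ?thesis using n [of l j] n'(2) [of i l] by linarith
    qed
    ultimately show ?case by blast
  qed
  then obtain n' where n': "mpow (diag t + n) k = diag (\<lambda>i. t i ^ k) + n'"
    "\<And>i j. n' $ i $ j \<noteq> 0 \<Longrightarrow> v i > v j" by blast
  have "n' $ i $ i = 0" for i using n'(2) [of i i] by auto
  then show ?thesis by (simp add: power_trace_def n'(1) trace_def)
qed

lemma power_trace_diag: "power_trace k (diag t) = (\<Sum>i\<in>UNIV. t i ^ k)" for t :: "'m::finite \<Rightarrow> complex"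
  using power_trace_triangular [of 0 "\<lambda>_. 0" k t] by simp

lemma polyfun_power_trace: "power_trace k \<in> polyfun (mscale :: complex \<Rightarrow> complex ^ 'm::finite ^ 'm \<Rightarrow> _)"
proof -
  have "(\<lambda>X :: complex ^ 'm ^ 'm. mpow X k $ i $ j) \<in> polyfun mscale" for i j
  proof (induction k arbitrary: i j)
    case (Suc k)
    show ?case by (simp add: matrix_matrix_mult_def) (intro polyfun_sum polyfun.mult Suc polyfun_entry)
  qed (simp add: polyfun.const)
  then show ?thesis unfolding power_trace_def [abs_def] trace_def by (intro polyfun_sum)
qed

text \<open>Infinitesimal conjugation invariance: the derivative of \<open>mpow X k\<close> in the direction of the commutator with
  \<open>x\<close> is the commutator of \<open>x\<close> with \<open>mpow X k\<close>, which has trace 0.\<close>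

lemma power_trace_commutator_derivative:
  fixes x X :: "complex ^ 'm::finite ^ 'm"
  shows "((\<lambda>t. power_trace k (X + mscale t (x ** X - X ** x))) has_field_derivative 0) (at 0)"
proof -
  let ?Y = "x ** X - X ** x"
  have diff_r: "A ** (B - C) = A ** B - A ** C" and diff_l: "(B - C) ** A = B ** A - C ** A"
    for A B C :: "complex ^ 'm ^ 'm"
    by (simp_all add: matrix_eq_iff matrix_matrix_mult_def algebra_simps sum_subtractf)
  have product_rule: "(\<Sum>l\<in>UNIV. C $ i $ l * (X $ l $ j + 0 * Y $ l $ j) + Y $ l $ j * N $ i $ l) = (C ** X + N ** Y) $ i $ j"
    for C Y N :: "complex ^ 'm ^ 'm" and i j
    by (simp add: matrix_matrix_mult_def sum.distrib mult.commute)
  have "((\<lambda>t. mpow (X + mscale t ?Y) k $ i $ j) has_field_derivative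
      (x ** mpow X k - mpow X k ** x) $ i $ j) (at 0)" for i j
  proof (induction k arbitrary: i j)
    case (Suc k)
    have "((\<lambda>t. \<Sum>l\<in>UNIV. mpow (X + mscale t ?Y) k $ i $ l * (X $ l $ j + t * ?Y $ l $ j)) has_field_derivative
        (\<Sum>l\<in>UNIV. (x ** mpow X k - mpow X k ** x) $ i $ l * (X $ l $ j + 0 * ?Y $ l $ j)
          + ?Y $ l $ j * mpow (X + mscale 0 ?Y) k $ i $ l)) (at 0)"
      by (intro DERIV_sum DERIV_mult Suc) (auto intro!: derivative_eq_intros)
    moreover have "(\<Sum>l\<in>UNIV. (x ** mpow X k - mpow X k ** x) $ i $ l * (X $ l $ j + 0 * ?Y $ l $ j)
          + ?Y $ l $ j * mpow (X + mscale 0 ?Y) k $ i $ l)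
        = ((x ** mpow X k - mpow X k ** x) ** X + mpow X k ** ?Y) $ i $ j"
      using product_rule [where C = "x ** mpow X k - mpow X k ** x" and i = i and j = j and Y = ?Y and N = "mpow X k"] by simp
    moreover have "(x ** mpow X k - mpow X k ** x) ** X + mpow X k ** ?Y
        = x ** mpow X (Suc k) - mpow X (Suc k) ** x"
      by (simp add: diff_l diff_r matrix_mul_assoc)
    moreover have "mpow (X + mscale t ?Y) (Suc k) $ i $ j
        = (\<Sum>l\<in>UNIV. mpow (X + mscale t ?Y) k $ i $ l * (X $ l $ j + t * ?Y $ l $ j))" for t
      by (simp add: matrix_matrix_mult_def [of "mpow _ _"])
    ultimately show ?case by (simp only:)
  qed simp
  then have "((\<lambda>t. power_trace k (X + mscale t ?Y)) has_field_derivative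
      (\<Sum>i\<in>UNIV. (x ** mpow X k - mpow X k ** x) $ i $ i)) (at 0)"
    unfolding power_trace_def trace_def by (intro DERIV_sum)
  moreover have "(\<Sum>i\<in>UNIV. (x ** mpow X k - mpow X k ** x) $ i $ i) = 0"
    using trace_mul_sym [of x "mpow X k"] by (simp add: trace_def sum_subtractf)
  ultimately show ?thesis by simp
qed

text \<open>If \<open>D i \<noteq> 0\<close>, sum a polynomial without constant term that vanishes at all other values of \<open>D\<close>.\<close>

lemma power_sums_zero:
  fixes D :: "'m::finite \<Rightarrow> complex"
  assumes "\<And>k. k \<ge> 1 \<Longrightarrow> (\<Sum>i\<in>UNIV. D i ^ k) = 0"
  shows "D i = 0"
proof (rule ccontr)
  assume nz: "D i \<noteq> 0"
  define q where "q = pCons 0 (\<Prod>b\<in>range D - {D i}. [:- b, 1:])"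
  have "(\<Sum>j\<in>UNIV. poly q (D j)) = (\<Sum>j\<in>UNIV. \<Sum>l\<le>degree q. coeff q l * D j ^ l)"
    by (simp add: poly_altdef)
  also have "\<dots> = (\<Sum>l\<le>degree q. coeff q l * (\<Sum>j\<in>UNIV. D j ^ l))"
    by (subst sum.swap) (simp add: sum_distrib_left)
  also have "\<dots> = 0"
  proof (intro sum.neutral ballI)
    fix l
    show "coeff q l * (\<Sum>j\<in>UNIV. D j ^ l) = 0"
      using assms [of l] by (cases l) (simp_all add: q_def)
  qed
  finally have total: "(\<Sum>j\<in>UNIV. poly q (D j)) = 0" .
  have poly_value: "poly q (D j) = (if D j = D i then poly q (D i) else 0)" for j
  proof (cases "D j = D i")
    case False
    then have "(\<Prod>b\<in>range D - {D i}. poly [:- b, 1:] (D j)) = 0"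
      by (intro prod_zero bexI [where x = "D j"]) auto
    then show ?thesis using False by (simp add: q_def poly_prod)
  qed simp
  have "(\<Sum>j\<in>UNIV. poly q (D j)) = (\<Sum>j\<in>UNIV. if D j = D i then poly q (D i) else 0)"
    by (intro sum.cong refl) (rule poly_value)
  also have "\<dots> = of_nat (card {j. D j = D i}) * poly q (D i)" by (simp add: sum.If_cases)
  finally have "of_nat (card {j. D j = D i}) * poly q (D i) = 0" using total by simp
  moreover have "i \<in> {j. D j = D i}" by simp
  then have "card {j. D j = D i} \<noteq> 0" by (auto simp: card_eq_0_iff)
  moreover have "poly q (D i) \<noteq> 0" using nz by (simp add: q_def poly_prod)
  ultimately show False by simp
qed

section \<open>A grading element lies in a two-dimensional torus\<close>

text \<open>Here \<open>A\<close> and \<open>B\<close> span a two-dimensional space of semisimple matrices in \<open>H\<close>, which need not commute with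
  \<open>diag \<omega>\<close>. If the conclusion fails, then an element of the centralizer of \<open>diag \<omega>\<close> in \<open>H\<close> has a
  multiple \<open>c \<omega>\<close> as its eigenvalues, so the polynomials \<open>F k\<close> below vanish there. They are
  invariant under conjugation, and \<open>H\<close> is the sum of the centralizer and the commutators with \<open>diag \<omega>\<close>, so
  they vanish on \<open>H\<close> by \<open>polyfun_zero_if_invariant\<close>. At an isotropic vector of \<open>trace (X ** X)\<close> in the span
  of \<open>A\<close> and \<open>B\<close> all traces of powers vanish, because \<open>\<tau> 2\<close> is a sum of real squares and hence nonzero.\<close>

lemma semisimple_not_multiple_of_grading:
  fixes w :: "'m::finite \<Rightarrow> int" and q :: "('m \<Rightarrow> nat) \<Rightarrow> complex" and d :: nat
  defines "H \<equiv> lie_stabilizer (form_of d q)"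
  assumes homogeneous: "\<And>\<alpha>. \<alpha> \<in> exponents d \<Longrightarrow> q \<alpha> \<noteq> 0 \<Longrightarrow> weight w \<alpha> = a"
    and \<omega>: "\<And>i. \<omega> i = of_int (w i) - complex_of_real r" "\<omega> \<noteq> (\<lambda>_. 0)" "diag \<omega> \<in> H"
    and AB: "A \<in> H" "B \<in> H" "\<And>x y. semisimple_matrix (mscale x A + mscale y B)"
      "\<And>x y. mscale x A + mscale y B = 0 \<Longrightarrow> x = 0 \<and> y = 0"
  obtains S where "S \<in> H" "semisimple_matrix S" "S ** diag \<omega> = diag \<omega> ** S" "\<And>c. S \<noteq> mscale c (diag \<omega>)"
proof (rule ccontr)
  assume contr: "\<not> thesis"
  note goal = that
  have multiple: "\<exists>c. S = mscale c (diag \<omega>)"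
    if "S \<in> H" "semisimple_matrix S" "S ** diag \<omega> = diag \<omega> ** S" for S
    using contr goal [OF that] by blast
  have pf: "form_of d q \<in> polyfun (*s)" by (rule polyfun_form_of)
  have subH: "matrix_space.subspace H" unfolding H_def by (rule subspace_lie_stabilizer [OF pf])
  define \<tau> where "\<tau> k = (\<Sum>i\<in>UNIV. \<omega> i ^ k)" for k :: nat
  \<comment> \<open>A scalar multiple \<open>c \<omega>\<close> of the eigenvalues multiplies both terms by \<open>c ^ (2 * k)\<close>.\<close>
  define F where "F k X = power_trace 2 X ^ k * \<tau> k ^ 2 - power_trace k X ^ 2 * \<tau> 2 ^ k"
    for k and X :: "complex ^ 'm ^ 'm"
  have centralizer: "\<exists>c. \<forall>k. power_trace k X = c ^ k * \<tau> k"
    if X: "X \<in> H" and comm: "X ** diag \<omega> = diag \<omega> ** X" for X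
  proof -
    obtain P P' t n and v :: "'m \<Rightarrow> int" where P: "P ** P' = mat 1" "P' ** P = mat 1" "P' ** X ** P = diag t + n"
      and n: "\<And>i j. n $ i $ j \<noteq> 0 \<Longrightarrow> v i > v j"
      by (rule triangularization [of X], rule that)
    obtain u u' n' where u: "u ** u' = mat 1" "u ** (diag t + n) ** u' = diag t + n'"
      and n': "\<And>i j. n' $ i $ j \<noteq> 0 \<Longrightarrow> v i > v j \<and> t i = t j"
      by (rule conjugate_to_commuting_nilpotent [where n = n and v = v and t = t], rule n, assumption, rule that)
    have u'u: "u' ** u = mat 1" using u(1) by (simp add: matrix_left_right_inverse)
    define R R' where "R = P ** u'" and "R' = u ** P'"
    have "R' ** R = u ** (P' ** P) ** u'" by (simp add: R_def R'_def matrix_mul_assoc)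
    then have R'R: "R' ** R = mat 1" by (simp add: P u)
    then have RR': "R ** R' = mat 1" by (simp add: matrix_left_right_inverse)
    have "R' ** X ** R = u ** (P' ** X ** P) ** u'" by (simp add: R_def R'_def matrix_mul_assoc)
    then have RX: "R' ** X ** R = diag t + n'" by (simp add: P(3) u(2))
    have "R ** (R' ** X ** R) ** R' = (R ** R') ** X ** (R ** R')" by (simp add: matrix_mul_assoc)
    then have X_eq: "X = R ** (diag t + n') ** R'" by (simp add: RX RR')
    have "(\<lambda>x. form_of d q (R *v x)) \<in> forms d" by (rule forms_comp) simp
    then obtain q' where q': "(\<lambda>x. form_of d q (R *v x)) = form_of d q'" by (auto simp: forms_iff)
    have transfer: "B \<in> lie_stabilizer (form_of d q') \<longleftrightarrow> R ** B ** R' \<in> H" for B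
      unfolding q' [symmetric] H_def by (rule lie_stabilizer_comp [OF pf RR'])
    have "diag t + n' \<in> lie_stabilizer (form_of d q')" using X by (simp add: transfer X_eq)
    then have "diag t \<in> lie_stabilizer (form_of d q')"
      by (rule diagonal_part_stabilizes [where v = v]) (rule n')
    then have SH: "R ** diag t ** R' \<in> H" by (simp add: transfer)
    have S: "semisimple_matrix (R ** diag t ** R')" by (rule semisimple_conj_diag [OF RR'])
    have cancel: "C ** R ** R' = C" "C ** R' ** R = C" for C :: "complex ^ 'm ^ 'm"
      by (simp_all add: RR' R'R flip: matrix_mul_assoc)
    let ?B = "R' ** diag \<omega> ** R"
    have "R' ** (X ** diag \<omega>) ** R = (R' ** X ** R) ** ?B" "R' ** (diag \<omega> ** X) ** R = ?B ** (R' ** X ** R)"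
      by (simp_all add: X_eq matrix_mul_assoc R'R cancel)
    then have comm': "(diag t + n') ** ?B = ?B ** (diag t + n')" using comm by (simp add: RX)
    have tB: "diag t ** ?B = ?B ** diag t"
      by (rule commutes_with_diagonal_part [where n = n' and v = v, OF _ comm']) (rule n')
    have "(R ** diag t ** R') ** diag \<omega> = R ** (diag t ** ?B) ** R'"
      by (simp add: matrix_mul_assoc cancel)
    also have "\<dots> = diag \<omega> ** (R ** diag t ** R')"
      unfolding tB by (simp add: matrix_mul_assoc RR')
    finally obtain c where c: "R ** diag t ** R' = mscale c (diag \<omega>)" using multiple [OF SH S] by blast
    have "power_trace k X = c ^ k * \<tau> k" for k
    proof -
      have "power_trace k X = power_trace k (diag t + n')" unfolding X_eq by (rule power_trace_conj [OF R'R])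
      also have "\<dots> = power_trace k (diag t)"
        unfolding power_trace_diag by (rule power_trace_triangular [where v = v]) (use n' in blast)
      also have "\<dots> = power_trace k (R ** diag t ** R')" by (rule power_trace_conj [OF R'R, symmetric])
      also have "R ** diag t ** R' = diag (\<lambda>i. c * \<omega> i)" unfolding c by (simp add: matrix_eq_iff)
      finally show ?thesis
        by (simp add: power_trace_diag \<tau>_def power_mult_distrib sum_distrib_left)
    qed
    then show ?thesis by blast
  qed
  have F0: "F k X = 0" if "X \<in> H" for k X
  proof (rule polyfun_zero_if_invariant [where a = "diag \<omega>" and E = H and S = "{X \<in> H. X ** diag \<omega> = diag \<omega> ** X}"
        and C = "(\<lambda>x X. x ** X - X ** x) ` H" and P = "F k" and scl = mscale])
    show "vector_space (mscale :: complex \<Rightarrow> complex ^ 'm ^ 'm \<Rightarrow> _)" by (rule matrix_space.vector_space_axioms)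
    show "F k \<in> polyfun mscale" unfolding F_def
      by (intro polyfun_diff polyfun.mult polyfun_power polyfun_power_trace polyfun.const)
    show "matrix_space.subspace H" "diag \<omega> \<in> H" "X \<in> H" by fact+
    show "{X \<in> H. X ** diag \<omega> = diag \<omega> ** X} \<subseteq> H" by auto
    show "c X \<in> H" if "c \<in> (\<lambda>x X. x ** X - X ** x) ` H" "X \<in> H" for c X
      using that lie_stabilizer_commutator [OF pf] by (auto simp: H_def)
    show "c (X + Y) = c X + c Y" if "c \<in> (\<lambda>x X. x ** X - X ** x) ` H" for c X Y
      using that by (auto simp: matrix_add_ldistrib matrix_add_rdistrib)
    show "c (mscale s X) = mscale s (c X)" if "c \<in> (\<lambda>x X. x ** X - X ** x) ` H" for c s X
      using that by (auto simp: matrix_eq_iff matrix_matrix_mult_def sum_distrib_left algebra_simps)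
    show "((\<lambda>t. F k (X + mscale t (c X))) has_field_derivative 0) (at 0)"
      if c: "c \<in> (\<lambda>x X. x ** X - X ** x) ` H" for c X
    proof -
      obtain x where "c = (\<lambda>X. x ** X - X ** x)" using c by auto
      then show ?thesis unfolding F_def
        by (auto intro!: derivative_eq_intros power_trace_commutator_derivative)
    qed
    show "mscale s X \<in> {X \<in> H. X ** diag \<omega> = diag \<omega> ** X}" if "X \<in> {X \<in> H. X ** diag \<omega> = diag \<omega> ** X}" for X s
      using that matrix_space.subspace_scale [OF subH] by (auto simp: matrix_eq_iff mult.commute)
    show "F k (diag \<omega> + X) = 0" if "X \<in> {X \<in> H. X ** diag \<omega> = diag \<omega> ** X}" for X
    proof -
      have "diag \<omega> + X \<in> H" using that \<omega>(3) matrix_space.subspace_add [OF subH] by auto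
      moreover have "(diag \<omega> + X) ** diag \<omega> = diag \<omega> ** (diag \<omega> + X)"
        using that by (simp add: matrix_add_ldistrib matrix_add_rdistrib)
      ultimately obtain c where "\<And>k. power_trace k (diag \<omega> + X) = c ^ k * \<tau> k" using centralizer by blast
      then show ?thesis by (simp add: F_def power_mult_distrib flip: power_mult) (simp add: mult_ac)
    qed
    show "\<exists>s\<in>{X \<in> H. X ** diag \<omega> = diag \<omega> ** X}. \<exists>c\<in>(\<lambda>x X. x ** X - X ** x) ` H. X = s + c (diag \<omega>)"
      if X: "X \<in> H" for X
    proof -
      have graded: "graded_part w p X \<in> H" for p
      proof -
        have "graded_part w p X \<in> lie_stabilizer (initial_form d w a q)"
          using X homogeneous unfolding H_def by (intro graded_part_stabilizes) auto
        moreover have "initial_form d w a q = form_of d q"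
          unfolding initial_form_def form_of_def using homogeneous by (intro ext sum.cong) auto
        ultimately show ?thesis by (simp add: H_def)
      qed
      define I where "I = range (\<lambda>(i, j). w j - w i) - {0}"
      \<comment> \<open>The commutator with \<open>diag \<omega>\<close> multiplies the part of degree \<open>p\<close> by \<open>p\<close>, so it is invertible on the
        parts of nonzero degree.\<close>
      define Z where "Z = (\<Sum>p\<in>I. mscale (1 / of_int p) (graded_part w p X))"
      have "finite I" by (simp add: I_def)
      have Z: "Z $ i $ j = (if w j = w i then 0 else X $ i $ j / of_int (w j - w i))" for i j
      proof -
        have "w j - w i \<in> range (\<lambda>(i, j). w j - w i)" by (rule image_eqI [of _ _ "(i, j)"]) auto
        then have "w j - w i \<in> I \<longleftrightarrow> w j \<noteq> w i" by (auto simp: I_def)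
        moreover have "Z $ i $ j = (\<Sum>p\<in>I. if w j - w i = p then X $ i $ j / of_int p else 0)"
          unfolding Z_def by (simp add: sum_component) (intro sum.cong, auto)
        ultimately show ?thesis using \<open>finite I\<close> by simp
      qed
      have ZH: "Z \<in> H" unfolding Z_def
        by (intro matrix_space.subspace_sum [OF subH] matrix_space.subspace_scale [OF subH] graded)
      have comm: "graded_part w 0 X ** diag \<omega> = diag \<omega> ** graded_part w 0 X"
        by (simp add: matrix_eq_iff \<omega>(1) mult.commute)
      have X_eq: "X = graded_part w 0 X + (Z ** diag \<omega> - diag \<omega> ** Z)"
        unfolding matrix_eq_iff
      proof (intro allI)
        fix i j
        have "Z $ i $ j * \<omega> j - \<omega> i * Z $ i $ j = Z $ i $ j * of_int (w j - w i)"
          by (simp add: \<omega>(1) algebra_simps)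
        also have "\<dots> = (if w j = w i then 0 else X $ i $ j)" by (simp add: Z del: of_int_diff)
        finally show "X $ i $ j = (graded_part w 0 X + (Z ** diag \<omega> - diag \<omega> ** Z)) $ i $ j" by simp
      qed
      have "graded_part w 0 X \<in> {X \<in> H. X ** diag \<omega> = diag \<omega> ** X}" using graded [of 0] comm by simp
      moreover have "(\<lambda>Y. Z ** Y - Y ** Z) \<in> (\<lambda>x X. x ** X - X ** x) ` H" using ZH by (rule imageI)
      ultimately show ?thesis by (intro bexI [where x = "graded_part w 0 X"] bexI [where x = "\<lambda>Y. Z ** Y - Y ** Z"] X_eq)
    qed
  qed
  have \<tau>2: "\<tau> 2 \<noteq> 0"
  proof -
    obtain i where "\<omega> i \<noteq> 0" using \<omega>(2) by auto
    have re: "\<omega> i = complex_of_real (of_int (w i) - r)" for i by (simp add: \<omega>(1))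
    have "(\<Sum>i\<in>UNIV. (of_int (w i) - r)\<^sup>2) \<noteq> 0"
    proof
      assume "(\<Sum>i\<in>UNIV. (of_int (w i) - r)\<^sup>2) = 0"
      then have "(of_int (w i) - r)\<^sup>2 = 0" by (simp add: sum_nonneg_eq_0_iff)
      then show False using \<open>\<omega> i \<noteq> 0\<close> by (simp add: re)
    qed
    moreover have "\<tau> 2 = complex_of_real (\<Sum>i\<in>UNIV. (of_int (w i) - r)\<^sup>2)" by (simp add: \<tau>_def re)
    ultimately show ?thesis by (metis of_real_eq_0_iff)
  qed
  obtain x y where xy: "x \<noteq> 0 \<or> y \<noteq> 0" and isotropic: "power_trace 2 (mscale x A + mscale y B) = 0"
  proof -
    define \<alpha> \<beta> \<gamma> where "\<alpha> = trace (A ** A)" and "\<beta> = trace (A ** B) + trace (B ** A)" and "\<gamma> = trace (B ** B)"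
    have tr_scale: "trace (mscale c C) = c * trace C" for c and C :: "complex ^ 'm ^ 'm"
      by (simp add: trace_def sum_distrib_left)
    have sc: "mscale c C ** D = mscale c (C ** D)" "C ** mscale c D = mscale c (C ** D)"
      for c and C D :: "complex ^ 'm ^ 'm"
      by (simp_all add: matrix_eq_iff matrix_matrix_mult_def sum_distrib_left mult_ac)
    have quad: "power_trace 2 (mscale x A + mscale y B) = x\<^sup>2 * \<alpha> + x * y * \<beta> + y\<^sup>2 * \<gamma>" for x y
      by (simp add: power_trace_def numeral_2_eq_2 matrix_add_ldistrib matrix_add_rdistrib sc trace_add tr_scale
          \<alpha>_def \<beta>_def \<gamma>_def algebra_simps)
    show ?thesis
    proof (cases "\<alpha> = 0")
      case True
      then show ?thesis using that [of 1 0] quad [of 1 0] by simp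
    next
      case False
      obtain x where "poly [:\<gamma>, \<beta>, \<alpha>:] x = 0"
        using fundamental_theorem_of_algebra [of "[:\<gamma>, \<beta>, \<alpha>:]"] False by (auto simp: constant_degree)
      then show ?thesis using that [of x 1] quad [of x 1] by (simp add: algebra_simps power2_eq_square)
    qed
  qed
  define Y where "Y = mscale x A + mscale y B"
  have YH: "Y \<in> H" unfolding Y_def
    using AB(1,2) matrix_space.subspace_add [OF subH] matrix_space.subspace_scale [OF subH] by blast
  have "semisimple_matrix Y" unfolding Y_def by (rule AB(3))
  then obtain P P' :: "complex ^ 'm ^ 'm" and D where P: "P ** P' = mat 1" "P' ** P = mat 1" "Y = P ** diag D ** P'"
    by (rule semisimple_matrixE)
  have "(\<Sum>i\<in>UNIV. D i ^ k) = 0" if "k \<ge> 1" for k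
  proof -
    have "power_trace k Y ^ 2 * \<tau> 2 ^ k = 0"
      using F0 [OF YH, of k] isotropic \<open>k \<ge> 1\<close> by (auto simp: F_def power_0_left simp flip: Y_def)
    then have "power_trace k Y = 0" using \<tau>2 by simp
    then show ?thesis by (simp add: P(3) power_trace_conj [OF P(2)] power_trace_diag)
  qed
  then have "D i = 0" for i by (rule power_sums_zero)
  then have "diag D = 0" by (simp add: matrix_eq_iff)
  then have "Y = 0" by (simp add: P(3) matrix_eq_iff matrix_matrix_mult_def)
  then show False using AB(4) [of x y] xy by (simp add: Y_def)
qed

section \<open>Limits of one-parameter subgroups\<close>

lemma mscale_matrix_mult:
  fixes A B :: "complex ^ 'm::finite ^ 'm"
  shows "mscale k A ** B = mscale k (A ** B)" "A ** mscale k B = mscale k (A ** B)"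
  by (simp_all add: matrix_eq_iff matrix_matrix_mult_def sum_distrib_left mult_ac)

text \<open>A change of basis replaces the form by another point of its orbit.\<close>

lemma orbit_comp:
  fixes f :: "complex ^ 'm::finite \<Rightarrow> complex" and P P' :: "complex ^ 'm ^ 'm"
  assumes "P ** P' = mat 1"
  shows "orbit (\<lambda>x. f (P *v x)) = orbit f"
proof -
  have P'P: "P' ** P = mat 1" using assms by (simp add: matrix_left_right_inverse)
  have sub: "orbit (\<lambda>x. h (R *v x)) \<subseteq> orbit h" if "invertible R" for h and R :: "complex ^ 'm ^ 'm"
    unfolding orbit_eq using invertible_mult [OF that] by (auto simp: matrix_vector_mul_assoc)
  have "orbit (\<lambda>x. (\<lambda>x. f (P *v x)) (P' *v x)) \<subseteq> orbit (\<lambda>x. f (P *v x))"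
    by (rule sub [OF invertibleI [OF P'P]])
  then have "orbit f \<subseteq> orbit (\<lambda>x. f (P *v x))" by (simp add: matrix_vector_mul_assoc assms)
  then show ?thesis using sub [OF invertibleI [OF assms], of f] by simp
qed

lemma dim_lie_stabilizer_comp:
  fixes f :: "complex ^ 'm::finite \<Rightarrow> complex" and P P' :: "complex ^ 'm ^ 'm"
  assumes f: "f \<in> forms d" and "P ** P' = mat 1"
  shows "matrix_space.dim (lie_stabilizer (\<lambda>x. f (P *v x))) = matrix_space.dim (lie_stabilizer f)"
  using variety_dim_orbit_closure [OF f] variety_dim_orbit_closure [OF forms_comp [OF f, of P]]
  unfolding orbit_comp [OF assms(2)] by linarith

text \<open>The line through \<open>A\<close> is a torus, so a rank different from 1 is at least 2, and two independent elements of
  a torus that attains the rank are as required.\<close>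

lemma lie_rank_cases:
  fixes H :: "(complex ^ 'm::finite ^ 'm) set"
  assumes H: "matrix_space.subspace H" and A: "A \<in> H" "semisimple_matrix A" "A \<noteq> 0" and "lie_rank H \<noteq> 1"
  obtains B C where "B \<in> H" "C \<in> H" "\<And>x y. semisimple_matrix (mscale x B + mscale y C)"
    "\<And>x y. mscale x B + mscale y C = 0 \<Longrightarrow> x = 0 \<and> y = 0"
proof -
  let ?D = "{matrix_space.dim T | T. T \<subseteq> H \<and> lie_torus T}"
  have semisimple_mscale: "semisimple_matrix (mscale r A)" for r
  proof -
    obtain P P' :: "complex ^ 'm ^ 'm" and t where P: "P ** P' = mat 1" "P' ** P = mat 1" "A = P ** diag t ** P'"
      by (rule semisimple_matrixE [OF A(2)])
    have "mscale r A = P ** diag (\<lambda>i. r * t i) ** P'"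
      unfolding P(3) by (simp add: matrix_eq_iff matrix_matrix_mult_def [of _ P'] sum_distrib_left mult_ac)
    then show ?thesis using semisimple_conj_diag [OF P(1)] by simp
  qed
  have fin: "finite ?D"
  proof (rule finite_subset)
    show "?D \<subseteq> {..matrix_space.dim (UNIV :: (complex ^ 'm ^ 'm) set)}"
      using matrix_space.dim_subset [OF subset_UNIV] by auto
  qed simp
  have "lie_torus (matrix_space.span {A})"
    unfolding lie_torus_def matrix_space.span_singleton
  proof (intro conjI ballI)
    show "matrix_space.subspace (range (\<lambda>k. mscale k A))"
      using matrix_space.subspace_span [of "{A}"] by (simp add: matrix_space.span_singleton)
  next
    fix X Y assume "X \<in> range (\<lambda>k. mscale k A)" "Y \<in> range (\<lambda>k. mscale k A)"
    then show "X ** Y = Y ** X"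
      by (auto simp: matrix_eq_iff matrix_matrix_mult_def mult_ac)
  next
    fix X assume "X \<in> range (\<lambda>k. mscale k A)"
    then show "semisimple_matrix X" using semisimple_mscale by auto
  qed
  moreover have "matrix_space.span {A} \<subseteq> H" using A(1) by (intro matrix_space.span_minimal H) auto
  moreover have "matrix_space.dim (matrix_space.span {A}) = 1" using A(3) by simp
  ultimately have one: "1 \<in> ?D" by (intro CollectI exI [of _ "matrix_space.span {A}"]) simp
  then have "Max ?D \<in> ?D" by (intro Max_in [OF fin]) (metis empty_iff)
  then obtain T where T: "T \<subseteq> H" "lie_torus T" "Max ?D = matrix_space.dim T" by auto
  have "1 \<le> Max ?D" by (rule Max_ge [OF fin one])
  moreover have "Max ?D \<noteq> 1" using assms(5) unfolding lie_rank_def .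
  ultimately have T2: "2 \<le> matrix_space.dim T" unfolding T(3) by linarith
  have subT: "matrix_space.subspace T" and ssT: "\<And>X. X \<in> T \<Longrightarrow> semisimple_matrix X"
    using T(2) by (auto simp: lie_torus_def)
  have "\<not> T \<subseteq> {0}"
  proof
    assume "T \<subseteq> {0}"
    then have "matrix_space.dim T = 0" by (rule matrix_space.dim_eq_0 [THEN iffD2])
    then show False using T2 by linarith
  qed
  then obtain B where B: "B \<in> T" "B \<noteq> 0" by auto
  have "\<not> T \<subseteq> matrix_space.span {B}"
  proof
    assume "T \<subseteq> matrix_space.span {B}"
    then have "matrix_space.dim T \<le> card {B}" by (rule matrix_space.dim_le_card) simp
    then have "matrix_space.dim T \<le> 1" by simp
    then show False using T2 by linarith
  qed
  then obtain C where C: "C \<in> T" "C \<notin> matrix_space.span {B}" by auto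
  show ?thesis
  proof (rule that [of B C])
    show "B \<in> H" "C \<in> H" using B C T(1) by auto
    show "semisimple_matrix (mscale x B + mscale y C)" for x y
      using B C by (intro ssT matrix_space.subspace_add [OF subT] matrix_space.subspace_scale [OF subT])
    fix x y assume zero: "mscale x B + mscale y C = 0"
    have "y = 0"
    proof (rule ccontr)
      assume y: "y \<noteq> 0"
      have "mscale y C = mscale (- x) B" using zero by (simp add: eq_neg_iff_add_eq_0 add.commute)
      then have "mscale (inverse y) (mscale y C) = mscale (inverse y) (mscale (- x) B)" by simp
      then have C_eq: "C = mscale (inverse y * - x) B" using y by simp
      have "mscale (inverse y * - x) B \<in> matrix_space.span {B}"
        by (intro matrix_space.span_scale matrix_space.span_base) simp
      then have "C \<in> matrix_space.span {B}" unfolding C_eq [symmetric] .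
      then show False using C(2) by contradiction
    qed
    with zero B(2) show "x = 0 \<and> y = 0" by simp
  qed
qed

text \<open>The argument for an arbitrary form \<open>f\<close> of positive degree, with the codimension of the orbit of the limit
  expressed through the stabilizers. Two changes of basis are made. The first, \<open>P\<close>, diagonalizes the
  one-parameter subgroup and provides \<open>\<omega>\<close>; the second, \<open>R\<close>, in addition diagonalizes the semisimple matrix \<open>S\<close>
  that commutes with \<open>diag \<omega>\<close>.\<close>

theorem limit_rank_or_alignment:
  fixes f Q :: "complex ^ 'm::finite \<Rightarrow> complex"
  assumes f: "f \<in> forms d" and Q: "Q \<in> forms d" and "d > 0"
    and L: "one_parameter_subgroup L" and limit: "leading_term L f Q"
    and not_in_orbit: "Q \<notin> orbit f"
    and dim: "matrix_space.dim (lie_stabilizer Q) \<le> matrix_space.dim (lie_stabilizer f) + 1"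
  shows "lie_rank (lie_stabilizer Q) = 1 \<or> (\<exists>A. is_alignment A Q f)"
  unfolding disj_imp
proof (rule impI)
  assume rank: "lie_rank (lie_stabilizer Q) \<noteq> 1"
  note pf = polyfun_form [OF f] and pQ = polyfun_form [OF Q]
  obtain P P' and w0 :: "'m \<Rightarrow> int" where P: "P ** P' = mat 1" "P' ** P = mat 1"
    and PL: "\<And>s. s \<noteq> 0 \<Longrightarrow> P' ** L s ** P = diag (\<lambda>i. s powi w0 i)"
    by (rule one_parameter_subgroup_diagonalizable [OF L], rule that)
  \<comment> \<open>The group acts on forms through the inverse matrix, hence the sign.\<close>
  define w where "w i = - w0 i" for i
  obtain a e q where ae: "a \<le> e" and qa: "q a = Q"
    and expansion: "\<And>s. s \<noteq> 0 \<Longrightarrow> group_act (L s) f = (\<lambda>x. \<Sum>i=a..e. s powi i * q i x)"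
    using limit unfolding leading_term_def by blast
  have act: "f (P *v (diag (\<lambda>i. s powi w i) *v y)) = (\<Sum>i=a..e. s powi i * q i (P *v y))" if s: "s \<noteq> 0" for s y
  proof -
    have cancel: "C ** P ** P' = C" for C :: "complex ^ 'm ^ 'm" by (simp add: P flip: matrix_mul_assoc)
    have "P ** (P' ** L s ** P) ** P' = L s" by (simp add: matrix_mul_assoc P cancel)
    then have Ls: "L s = P ** diag (\<lambda>i. s powi w0 i) ** P'" by (simp add: PL s)
    have cancel': "C ** P' ** P = C" for C :: "complex ^ 'm ^ 'm" by (simp add: P flip: matrix_mul_assoc)
    have "diag (\<lambda>i. s powi w0 i) ** diag (\<lambda>i. s powi w i) = mat 1"
      using s by (simp add: diag_diag w_def power_int_minus) (simp add: matrix_eq_iff mat_def)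
    then have "P ** (diag (\<lambda>i. s powi w0 i) ** diag (\<lambda>i. s powi w i)) ** P' = mat 1" by (simp add: P)
    then have "L s ** (P ** diag (\<lambda>i. s powi w i) ** P') = mat 1"
      by (simp add: Ls matrix_mul_assoc cancel')
    then have "matrix_inv (L s) = P ** diag (\<lambda>i. s powi w i) ** P'" by (rule matrix_inv_eqI)
    then have "group_act (L s) f (P *v y) = f ((P ** diag (\<lambda>i. s powi w i) ** (P' ** P)) *v y)"
      by (simp add: group_act_def matrix_vector_mul_assoc matrix_mul_assoc)
    then show ?thesis using expansion [OF s] by (simp add: P matrix_vector_mul_assoc)
  qed
  have "(\<lambda>x. f (P *v x)) \<in> forms d" by (rule forms_comp [OF f])
  then obtain c1 where c1: "(\<lambda>x. f (P *v x)) = form_of d c1" by (auto simp: forms_iff)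
  have ex1: "form_of d c1 (diag (\<lambda>i. s powi w i) *v x) = (\<Sum>i=a..e. s powi i * q i (P *v x))" if "s \<noteq> 0" for s x
    using act [OF that, of x] fun_cong [OF c1] by simp
  note init1 = initial_form_of_expansion [where q = "\<lambda>i x. q i (P *v x)", OF ex1 ae]
  have Q1: "(\<lambda>x. Q (P *v x)) = initial_form d w a c1" using init1(1) qa by simp
  define r where "r = real_of_int a / real d"
  define \<omega> where "\<omega> i = of_int (w i) - complex_of_real r" for i
  have weight_shifted: "weight (\<lambda>i. of_int (w' i) - complex_of_real r) \<alpha> = of_int (weight w' \<alpha> - a)"
    if "\<alpha> \<in> exponents d" for w' :: "'m \<Rightarrow> int" and \<alpha>
  proof -
    have "weight (\<lambda>i. of_int (w' i) - complex_of_real r) \<alpha>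
        = of_int (weight w' \<alpha>) - complex_of_real r * of_nat (\<Sum>i\<in>UNIV. \<alpha> i)"
      by (simp add: weight_def right_diff_distrib sum_subtractf sum_distrib_left mult.commute)
    also have "\<dots> = of_int (weight w' \<alpha> - a)" using that \<open>d > 0\<close> by (simp add: r_def)
    finally show ?thesis .
  qed
  have grading_stab: "diag (\<lambda>i. of_int (w' i) - complex_of_real r) \<in> lie_stabilizer (initial_form d w' a c)"
    for w' :: "'m \<Rightarrow> int" and c
    unfolding initial_form_def diag_stabilizes_iff by (auto simp: weight_shifted simp del: of_int_diff)
  have \<omega>0: "\<omega> \<noteq> (\<lambda>_. 0)"
  proof
    assume "\<omega> = (\<lambda>_. 0)"
    then have "weight w \<alpha> = a" if "\<alpha> \<in> exponents d" for \<alpha>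
      using weight_shifted [OF that, of w] by (simp add: \<omega>_def [abs_def] weight_def [of "\<lambda>_. 0"] fun_eq_iff)
    then have "initial_form d w a c1 = form_of d c1"
      unfolding initial_form_def form_of_def by (intro ext sum.cong) auto
    then have "(\<lambda>x. Q (P *v (P' *v x))) = (\<lambda>x. f (P *v (P' *v x)))"
      using Q1 c1 by (metis (no_types))
    then have "Q = f" by (simp add: matrix_vector_mul_assoc P)
    then show False using not_in_orbit self_in_orbit [of f] by simp
  qed
  have transferP: "B \<in> lie_stabilizer (\<lambda>x. h (P *v x)) \<longleftrightarrow> P ** B ** P' \<in> lie_stabilizer h"
    if "h \<in> polyfun (*s)" for h B by (rule lie_stabilizer_comp [OF that P(1)])
  have conjP: "P' ** (P ** B ** P') ** P = B" "P ** (P' ** B ** P) ** P' = B" for B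
  proof -
    have "P' ** (P ** B ** P') ** P = (P' ** P) ** B ** (P' ** P)"
      "P ** (P' ** B ** P) ** P' = (P ** P') ** B ** (P ** P')" by (simp_all add: matrix_mul_assoc)
    then show "P' ** (P ** B ** P') ** P = B" "P ** (P' ** B ** P) ** P' = B" by (simp_all add: P)
  qed
  have \<omega>H: "diag \<omega> \<in> lie_stabilizer (initial_form d w a c1)" unfolding \<omega>_def by (rule grading_stab)
  have "P ** diag \<omega> ** P' \<in> lie_stabilizer Q" using \<omega>H transferP [OF pQ] by (simp add: Q1)
  moreover have "P ** diag \<omega> ** P' \<noteq> 0"
  proof
    assume "P ** diag \<omega> ** P' = 0"
    then have "diag \<omega> = 0" using conjP(1) [of "diag \<omega>"] by (simp add: matrix_eq_iff matrix_matrix_mult_def)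
    then have "\<omega> i = 0" for i by (simp add: matrix_eq_iff) (drule spec [of _ i], drule spec [of _ i], simp)
    then show False using \<omega>0 by auto
  qed
  ultimately obtain B C where BC: "B \<in> lie_stabilizer Q" "C \<in> lie_stabilizer Q"
    "\<And>x y. semisimple_matrix (mscale x B + mscale y C)"
    "\<And>x y. mscale x B + mscale y C = 0 \<Longrightarrow> x = 0 \<and> y = 0"
    using lie_rank_cases [OF subspace_lie_stabilizer [OF pQ] _ semisimple_conj_diag [OF P(1)] _ rank, of \<omega>]
    by metis
  have conj_comb: "mscale x (P' ** B ** P) + mscale y (P' ** C ** P) = P' ** (mscale x B + mscale y C) ** P" for x y
    by (simp add: matrix_add_ldistrib matrix_add_rdistrib mscale_matrix_mult)
  obtain S where S: "S \<in> lie_stabilizer (initial_form d w a c1)" "semisimple_matrix S"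
    "S ** diag \<omega> = diag \<omega> ** S" "\<And>c. S \<noteq> mscale c (diag \<omega>)"
  proof (rule semisimple_not_multiple_of_grading [where d = d and q = "\<lambda>\<alpha>. if weight w \<alpha> = a then c1 \<alpha> else 0"
        and w = w and a = a and r = r and \<omega> = \<omega> and A = "P' ** B ** P" and B = "P' ** C ** P"])
    show "diag \<omega> \<in> lie_stabilizer (form_of d (\<lambda>\<alpha>. if weight w \<alpha> = a then c1 \<alpha> else 0))"
      using \<omega>H by (simp add: initial_form_def)
    show "P' ** B ** P \<in> lie_stabilizer (form_of d (\<lambda>\<alpha>. if weight w \<alpha> = a then c1 \<alpha> else 0))"
      "P' ** C ** P \<in> lie_stabilizer (form_of d (\<lambda>\<alpha>. if weight w \<alpha> = a then c1 \<alpha> else 0))"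
      using BC(1,2) transferP [OF pQ, of "P' ** B ** P"] transferP [OF pQ, of "P' ** C ** P"]
      unfolding Q1 initial_form_def conjP by simp_all
    show "semisimple_matrix (mscale x (P' ** B ** P) + mscale y (P' ** C ** P))" for x y
      unfolding conj_comb by (rule semisimple_conj [OF BC(3) P(1)])
    show "x = 0 \<and> y = 0" if "mscale x (P' ** B ** P) + mscale y (P' ** C ** P) = 0" for x y
    proof (rule BC(4))
      have "P ** (P' ** (mscale x B + mscale y C) ** P) ** P' = P ** 0 ** P'" using that by (simp only: conj_comb)
      then show "mscale x B + mscale y C = 0" unfolding conjP by (simp add: matrix_eq_iff matrix_matrix_mult_def)
    qed
    show "weight w \<alpha> = a" if "(if weight w \<alpha> = a then c1 \<alpha> else 0) \<noteq> 0" for \<alpha>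
      using that by (auto split: if_splits)
    fix S assume "S \<in> lie_stabilizer (form_of d (\<lambda>\<alpha>. if weight w \<alpha> = a then c1 \<alpha> else 0))" "semisimple_matrix S"
      "S ** diag \<omega> = diag \<omega> ** S" "\<And>c. S \<noteq> mscale c (diag \<omega>)"
    then show thesis by (intro that [of S]) (simp_all add: initial_form_def)
  qed (simp_all add: \<omega>_def \<omega>0)
  have levels: "w i = w j" if "S $ i $ j \<noteq> 0" for i j
  proof -
    have "S $ i $ j * \<omega> j = \<omega> i * S $ i $ j" using arg_cong [OF S(3), of "\<lambda>C. C $ i $ j"] by simp
    then have "\<omega> i = \<omega> j" using that by simp
    then show ?thesis by (simp add: \<omega>_def)
  qed
  obtain R R' :: "complex ^ 'm ^ 'm" and \<sigma> w' where R: "R ** R' = mat 1" "R' ** R = mat 1" "R' ** S ** R = diag \<sigma>"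
    and w': "\<And>\<phi>. R' ** diag (\<phi> \<circ> w) ** R = diag (\<phi> \<circ> w')"
    by (rule simultaneous_diagonalization [OF S(2) levels], assumption, rule that)
  have cancelR: "C ** R ** R' = C" "C ** R' ** R = C" for C :: "complex ^ 'm ^ 'm"
    by (simp_all add: R flip: matrix_mul_assoc)
  have diag_R: "R ** diag (\<phi> \<circ> w') = diag (\<phi> \<circ> w) ** R" for \<phi>
    unfolding w' [symmetric] by (simp add: matrix_mul_assoc R)
  define M M' where "M = P ** R" and "M' = R' ** P'"
  have "M ** M' = P ** (R ** R') ** P'" by (simp add: M_def M'_def matrix_mul_assoc)
  then have MM': "M ** M' = mat 1" by (simp add: R P)
  then have M'M: "M' ** M = mat 1" by (simp add: matrix_left_right_inverse)
  have fM: "(\<lambda>x. f (M *v x)) \<in> forms d" by (rule forms_comp [OF f])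
  then obtain c2 where c2: "(\<lambda>x. f (M *v x)) = form_of d c2" by (auto simp: forms_iff)
  have ex2: "form_of d c2 (diag (\<lambda>i. s powi w' i) *v x) = (\<Sum>i=a..e. s powi i * q i (M *v x))" if "s \<noteq> 0" for s x
  proof -
    have "form_of d c2 (diag (\<lambda>i. s powi w' i) *v x) = f (P *v ((R ** diag ((\<lambda>k. s powi k) \<circ> w')) *v x))"
      unfolding c2 [symmetric] by (simp add: M_def o_def matrix_vector_mul_assoc matrix_mul_assoc)
    also have "\<dots> = f (P *v (diag (\<lambda>i. s powi w i) *v (R *v x)))"
      unfolding diag_R by (simp add: o_def matrix_vector_mul_assoc matrix_mul_assoc)
    also have "\<dots> = (\<Sum>i=a..e. s powi i * q i (M *v x))"
      unfolding act [OF that] by (simp add: M_def matrix_vector_mul_assoc)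
    finally show ?thesis .
  qed
  note init2 = initial_form_of_expansion [where q = "\<lambda>i x. q i (M *v x)", OF ex2 ae]
  have Q2: "(\<lambda>x. Q (M *v x)) = initial_form d w' a c2" using init2(1) qa by simp
  have transferM: "B \<in> lie_stabilizer (\<lambda>x. h (M *v x)) \<longleftrightarrow> M ** B ** M' \<in> lie_stabilizer h"
    if "h \<in> polyfun (*s)" for h B by (rule lie_stabilizer_comp [OF that MM'])
  define \<theta> where "\<theta> i = of_int (w' i) - complex_of_real r" for i
  have \<theta>: "R' ** diag \<omega> ** R = diag \<theta>"
    using w' [of "\<lambda>k. of_int k - complex_of_real r"] by (simp add: \<omega>_def [abs_def] \<theta>_def [abs_def] o_def)
  have conjR: "R ** (R' ** X ** R) ** R' = X" for X by (simp add: matrix_mul_assoc R cancelR)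
  obtain t u u' where t: "t \<noteq> (\<lambda>_. 0)" and tH: "diag t \<in> lie_stabilizer (initial_form d w' a c2)"
    and u: "u ** u' = mat 1" and tK: "u' ** diag t ** u \<in> lie_stabilizer (form_of d c2)"
  proof (rule alignment_in_coordinates [where w = w' and d = d and c = c2 and a = a and \<sigma> = \<sigma> and \<omega> = \<theta>])
    show "a \<le> weight w' \<alpha>" if "\<alpha> \<in> exponents d" "c2 \<alpha> \<noteq> 0" for \<alpha> by (rule init2(2)) (use that in auto)
    have "M ** diag \<sigma> ** M' = P ** (R ** (R' ** S ** R) ** R') ** P'"
      by (simp add: M_def M'_def matrix_mul_assoc R(3))
    then have "M ** diag \<sigma> ** M' = P ** S ** P'" by (simp only: conjR)
    moreover have "P ** S ** P' \<in> lie_stabilizer Q" using S(1) transferP [OF pQ] by (simp add: Q1)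
    ultimately show "diag \<sigma> \<in> lie_stabilizer (initial_form d w' a c2)"
      unfolding Q2 [symmetric] transferM [OF pQ] by simp
    show "diag \<theta> \<in> lie_stabilizer (initial_form d w' a c2)" unfolding \<theta>_def by (rule grading_stab)
    show "\<theta> \<noteq> (\<lambda>_. 0)"
    proof
      assume "\<theta> = (\<lambda>_. 0)"
      then have "diag \<theta> = 0" by (simp add: matrix_eq_iff)
      then have "diag \<omega> = 0" using conjR [of "diag \<omega>"] unfolding \<theta> by (simp add: matrix_eq_iff matrix_matrix_mult_def)
      then have "\<omega> i = 0" for i by (simp add: matrix_eq_iff) (drule spec [of _ i], drule spec [of _ i], simp)
      then show False using \<omega>0 by auto
    qed
    show "\<sigma> \<noteq> (\<lambda>i. k * \<theta> i)" for k
    proof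
      assume "\<sigma> = (\<lambda>i. k * \<theta> i)"
      then have "diag \<sigma> = mscale k (diag \<theta>)" by (simp add: matrix_eq_iff)
      then have "R' ** S ** R = mscale k (R' ** diag \<omega> ** R)" by (simp add: R(3) \<theta>)
      also have "\<dots> = R' ** mscale k (diag \<omega>) ** R"
        by (simp add: mscale_matrix_mult)
      finally have "R' ** S ** R = R' ** mscale k (diag \<omega>) ** R" .
      then have "R ** (R' ** S ** R) ** R' = R ** (R' ** mscale k (diag \<omega>) ** R) ** R'" by (simp only:)
      then have "S = mscale k (diag \<omega>)" unfolding conjR .
      then show False using S(4) by blast
    qed
    have "matrix_space.dim (lie_stabilizer (\<lambda>x. Q (M *v x))) \<le> matrix_space.dim (lie_stabilizer (\<lambda>x. f (M *v x))) + 1"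
      unfolding dim_lie_stabilizer_comp [OF f MM'] dim_lie_stabilizer_comp [OF Q MM'] by (rule dim)
    then show "matrix_space.dim (lie_stabilizer (initial_form d w' a c2)) \<le> matrix_space.dim (lie_stabilizer (form_of d c2)) + 1"
      by (simp only: Q2 c2)
  qed (rule that)
  have cancelM: "C ** M ** M' = C" "C ** M' ** M = C" for C :: "complex ^ 'm ^ 'm"
    by (simp_all add: MM' M'M flip: matrix_mul_assoc)
  have u'u: "u' ** u = mat 1" using u by (simp add: matrix_left_right_inverse)
  have cancelu: "C ** u ** u' = C" for C :: "complex ^ 'm ^ 'm" by (simp add: u flip: matrix_mul_assoc)
  define g where "g = M ** u ** M'"
  have g_inv: "g ** (M ** u' ** M') = mat 1"
    unfolding g_def by (simp add: matrix_mul_assoc cancelM cancelu MM')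
  have "M ** diag t ** M' \<in> lie_stabilizer Q" using tH unfolding Q2 [symmetric] transferM [OF pQ] .
  moreover have "M ** (u' ** diag t ** u) ** M' \<in> lie_stabilizer f"
    using tK unfolding c2 [symmetric] transferM [OF pf] .
  moreover have "M ** diag t ** M' = g ** (M ** (u' ** diag t ** u) ** M') ** matrix_inv g"
    unfolding matrix_inv_eqI [OF g_inv] unfolding g_def
    by (simp add: matrix_mul_assoc cancelM cancelu)
  moreover have "M ** diag t ** M' \<noteq> 0"
  proof
    assume zero: "M ** diag t ** M' = 0"
    have "M' ** (M ** diag t ** M') ** M = diag t" by (simp add: matrix_mul_assoc M'M cancelM)
    then have "diag t = 0" unfolding zero by (simp add: matrix_eq_iff matrix_matrix_mult_def)
    then have "t i = 0" for i by (simp add: matrix_eq_iff) (drule spec [of _ i], drule spec [of _ i], simp)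
    then show False using t by auto
  qed
  ultimately show "\<exists>A. is_alignment A Q f"
    unfolding is_alignment_def
    using semisimple_conj_diag [OF MM', of t] invertibleI [OF g_inv] by blast
qed

theorem corollary1p3:
  fixes Q :: "complex ^ ('n::finite \<times> 'n) \<Rightarrow> complex"
    and I :: "'i set"
    and W :: "'i \<Rightarrow> (complex ^ ('n \<times> 'n) \<Rightarrow> complex) set"
    and i :: 'i
    and L :: "complex \<Rightarrow> complex ^ ('n \<times> 'n) ^ ('n \<times> 'n)"
  assumes "finite I"
    and "zariski_closure (forms CARD('n)) (orbit det_form) - orbit det_form = (\<Union>j\<in>I. W j)"
    and "\<And>j. j \<in> I \<Longrightarrow> closed_G_variety (forms CARD('n)) (W j)"
    and "\<And>j. j \<in> I \<Longrightarrow> variety_dim (forms CARD('n)) (W j) + 1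
           = variety_dim (forms CARD('n)) (zariski_closure (forms CARD('n))
               (orbit (det_form :: complex ^ ('n \<times> 'n) \<Rightarrow> complex)))"
    and "i \<in> I"
    and "Q \<in> forms CARD('n)"
    and "W i = zariski_closure (forms CARD('n)) (orbit Q)"
    and "one_parameter_subgroup L"
    and "leading_term L det_form Q"
  shows "lie_rank (lie_stabilizer Q) = 1 \<or> (\<exists>A. is_alignment A Q det_form)"
proof (rule limit_rank_or_alignment [OF det_form_in_forms assms(6) _ assms(8,9)])
  show "0 < CARD('n)" by simp
  have "Q \<in> W i" using self_in_orbit [of Q] zariski_closure_superset [of "orbit Q"] unfolding assms(7) by blast
  then show "Q \<notin> orbit det_form" using assms(2,5) by blast
  let ?f = "det_form :: complex ^ ('n \<times> 'n) \<Rightarrow> complex"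
  have "variety_dim (forms CARD('n)) (zariski_closure (forms CARD('n)) (orbit Q)) + 1
      = variety_dim (forms CARD('n)) (zariski_closure (forms CARD('n)) (orbit ?f))"
    using assms(4) [OF assms(5)] unfolding assms(7) .
  moreover have "variety_dim (forms CARD('n)) (zariski_closure (forms CARD('n)) (orbit ?f))
      + matrix_space.dim (lie_stabilizer ?f) = matrix_space.dim (UNIV :: (complex ^ ('n \<times> 'n) ^ ('n \<times> 'n)) set)"
    by (rule variety_dim_orbit_closure [OF det_form_in_forms])
  ultimately show "matrix_space.dim (lie_stabilizer Q) \<le> matrix_space.dim (lie_stabilizer ?f) + 1"
    using variety_dim_orbit_closure [OF assms(6)] by linarith
qed

end
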